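(* Let $m\in\mathbb{N}$, $\overline{\alpha}=(\alpha_1,\dots,\alpha_m)$ with $\alpha_j>0$ for $j=1,\dots,m$, and suppose that either $1<p\le2$ and $1<\tau\le2$, or $2<p<\infty$ and $1<\tau<\infty$. Then there are constants $C_1,C_2>0$, independent of $f$ and $n_1,\dots,n_m$, such that for every $f\in\Lambda_{p,\tau}$ and all $n_1,\dots,n_m\in\mathbb{N}$, writing $$I_{\overline{n}}(f)=\prod_{j=1}^mn_j^{-\alpha_j}\Biggl(\sum_{\nu_1=1}^{n_1+1}\cdots\sum_{\nu_m=1}^{n_m+1}\ \prod_{j=1}^m\nu_j^{2\alpha_j-1}\;Y^2_{\nu_1-1,\dots,\nu_m-1}(f)_{p,\tau}\Biggr)^{1/2},$$ one has $$C_1\,I_{\overline{n}}(f)\le\omega_{\overline{\alpha}}\Bigl(f,\frac1{n_1},\dots,\frac1{n_m}\Bigr)_{p,\tau}\le C_2\,I_{\overline{n}}(f).$$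
   Context: $\mathbb{N}=\{1,2,\dots\}$, $\mathbb{Z}_+=\mathbb{N}\cup\{0\}$, $\mathbb{T}^m=[0,2\pi)^m$, $\mathbb{I}^m=[0,1)^m$. $L_{p,\tau}(\mathbb{T}^m)$ is the Lorentz space of real-valued Lebesgue measurable functions $f$ on $\mathbb{R}^m$, $2\pi$-periodic in each variable, with $$\|f\|_{p,\tau}=\Bigl(\int_0^1 (f^*(t))^{\tau}t^{\frac{\tau}{p}-1}dt\Bigr)^{1/\tau}<\infty,$$ where $f^*$ is the non-increasing rearrangement of $|f(2\pi\overline{x})|$, $\overline{x}\in\mathbb{I}^m$. $\mathring{L}_{p,\tau}(\mathbb{T}^m)$ is the set of $f\in L_{p,\tau}(\mathbb{T}^m)$ with $\int_0^1 f(2\pi\overline{x})\,dx_j=0$ for each $j=1,\dots,m$. $\Lambda_{p,\tau}$ is the set of all $f\in\mathring{L}_{p,\tau}(\mathbb{T}^m)$ having a lacunary Fourier series $f(\overline{x})\sim\sum_{\overline{\nu}\in\mathbb{Z}_+^m}\lambda_{\overline{\nu}}\prod_{j=1}^m\cos2^{\nu_j}x_j$ with $\lambda_{\overline{\nu}}\in\mathbb{R}$. Best approximation by "angle": for integers $l_1,\dots,l_m\ge0$, $$Y_{l_1,\dots,l_m}(f)_{p,\tau}=\inf\Bigl\|f-\sum_{j=1}^mT_{l_j}\Bigr\|_{p,\tau},$$ the infimum being over all $T_{l_1},\dots,T_{l_m}\in\mathring{L}_{p,\tau}(\mathbb{T}^m)$ such that $T_{l_j}$ is a trigonometric polynomial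 of order $l_j$ with respect to the variable $x_j$ (i.e. its Fourier coefficients vanish at all $\overline{k}\in\mathbb{Z}^m$ with $|k_j|>l_j$). Mixed difference: with $\binom{\alpha}{0}=1$ and $\binom{\alpha}{\nu}=\frac{\alpha(\alpha-1)\cdots(\alpha-\nu+1)}{\nu!}$ for $\nu\ge1$, $$\Delta_{\overline{h}}^{\overline{\alpha}}f(\overline{x})=\sum_{\nu_m=0}^\infty\cdots\sum_{\nu_1=0}^\infty(-1)^{\nu_1+\dots+\nu_m}\prod_{j=1}^m\binom{\alpha_j}{\nu_j}f\Bigl(\overline{x}+\sum_{i=1}^m(\alpha_i-\nu_i)h_i\overline{e}_i\Bigr),$$ where $\overline{e}_1,\dots,\overline{e}_m$ is the standard basis of $\mathbb{R}^m$. Mixed modulus of smoothness: $\omega_{\overline{\alpha}}(f,t_1,\dots,t_m)_{p,\tau}=\sup_{|h_1|\le t_1,\dots,|h_m|\le t_m}\|\Delta_{\overline{h}}^{\overline{\alpha}}f\|_{p,\tau}$. *)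

theory Defs
  imports "HOL-Analysis.Analysis"
begin

text \<open>Points of R^m, the exponents \<open>\<alpha>\<close> and the steps \<open>h\<close> are of type \<open>real^'m\<close> with
  \<open>m = CARD('m)\<close>; integer multi-indices are functions on \<open>'m\<close>.
  Norms, best approximations and moduli of smoothness take values in \<open>[0, \<infinity>]\<close>, so that no
  infimum, supremum or integral below depends on a finiteness convention.\<close>

definition unit_cell :: "(real^'m) set" where
  "unit_cell = {x. \<forall>j. 0 \<le> x $ j \<and> x $ j < 1}"

text \<open>Real powers on \<open>[0, \<infinity>]\<close>, only meant for exponents \<open>a > 0\<close>.\<close>

definition ennpowr :: "ennreal \<Rightarrow> real \<Rightarrow> ennreal" where
  "ennpowr x a = (if x = \<infinity> then \<infinity> else ennreal (enn2real x powr a))"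

text \<open>Non-increasing rearrangement of \<open>f(2\<pi>x)\<close>, \<open>x\<close> in the unit cell, used for \<open>0 < t < 1\<close>. The
  cell has measure one and \<open>f\<close> is finite-valued, so the set below is nonempty for measurable \<open>f\<close>.\<close>

definition rearrangement :: "(real^'m \<Rightarrow> real) \<Rightarrow> real \<Rightarrow> real" where
  "rearrangement f t =
     Inf {y. 0 \<le> y \<and> measure lebesgue {x \<in> unit_cell. y < \<bar>f ((2 * pi) *\<^sub>R x)\<bar>} \<le> t}"

definition lorentz_norm :: "real \<Rightarrow> real \<Rightarrow> (real^'m \<Rightarrow> real) \<Rightarrow> ennreal" where
  "lorentz_norm p \<tau> f =
     ennpowr (\<integral>\<^sup>+ t\<in>{0<..<1}. ennreal (rearrangement f t powr \<tau> * t powr (\<tau> / p - 1)) \<partial>lborel)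
       (1 / \<tau>)"

definition lorentz_space :: "real \<Rightarrow> real \<Rightarrow> (real^'m \<Rightarrow> real) set" where
  "lorentz_space p \<tau> =
     {f. f \<in> borel_measurable lebesgue
       \<and> (\<forall>x j. f (x + axis j (2 * pi)) = f x)
       \<and> lorentz_norm p \<tau> f < \<infinity>}"

text \<open>The zero-mean condition in each variable: the integral in \<open>x\<^sub>j\<close> is a function of the remaining
  variables, defined and equal to zero almost everywhere. Integrating with respect to
  \<open>lebesgue\<close> rather than \<open>lborel\<close> matters, as slices of \<open>f\<close> need not be Borel.\<close>

definition lorentz_space_zero_mean :: "real \<Rightarrow> real \<Rightarrow> (real^'m \<Rightarrow> real) set" where
  "lorentz_space_zero_mean p \<tau> =
     {f \<in> lorentz_space p \<tau>.
       \<forall>j. AE x in lebesgue.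
         has_bochner_integral (lebesgue_on {0..1})
           (\<lambda>s. f ((2 * pi) *\<^sub>R (\<chi> i. if i = j then s else x $ i))) 0}"

definition fourier_coeff :: "(real^'m \<Rightarrow> real) \<Rightarrow> ('m \<Rightarrow> int) \<Rightarrow> complex" where
  "fourier_coeff f k =
     (LINT x:unit_cell|lebesgue.
        of_real (f ((2 * pi) *\<^sub>R x)) * cis (- (2 * pi * (\<Sum>j\<in>UNIV. of_int (k j) * x $ j))))"

text \<open>\<open>f \<sim> \<Sum>\<^sub>\<nu> \<lambda>\<^sub>\<nu> \<Prod>\<^sub>j cos (2^\<nu>\<^sub>j x\<^sub>j)\<close> is an identity of Fourier coefficients only, without any
  convergence: for each \<open>k\<close> at most one term of the sum over \<open>\<nu>\<close> is nonzero.\<close>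

definition has_lacunary_series :: "(real^'m \<Rightarrow> real) \<Rightarrow> (('m \<Rightarrow> nat) \<Rightarrow> real) \<Rightarrow> bool" where
  "has_lacunary_series f c \<longleftrightarrow>
     (\<forall>k. fourier_coeff f k =
       (\<Sum>\<^sub>\<infinity>\<nu>. of_real (c \<nu>) * fourier_coeff (\<lambda>x. \<Prod>j\<in>UNIV. cos (2 ^ \<nu> j * x $ j)) k))"

definition lacunary_class :: "real \<Rightarrow> real \<Rightarrow> (real^'m \<Rightarrow> real) set" where
  "lacunary_class p \<tau> = {f \<in> lorentz_space_zero_mean p \<tau>. \<exists>c. has_lacunary_series f c}"

definition trig_poly_in_var :: "real \<Rightarrow> real \<Rightarrow> 'm \<Rightarrow> nat \<Rightarrow> (real^'m \<Rightarrow> real) set" where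
  "trig_poly_in_var p \<tau> j l =
     {T \<in> lorentz_space_zero_mean p \<tau>. \<forall>k. \<bar>k j\<bar> > int l \<longrightarrow> fourier_coeff T k = 0}"

definition angle_approx ::
  "real \<Rightarrow> real \<Rightarrow> ('m \<Rightarrow> nat) \<Rightarrow> (real^'m \<Rightarrow> real) \<Rightarrow> ennreal" where
  "angle_approx p \<tau> l f =
     (INF T\<in>{T :: 'm \<Rightarrow> real^'m \<Rightarrow> real. \<forall>j. T j \<in> trig_poly_in_var p \<tau> j (l j)}.
        lorentz_norm p \<tau> (\<lambda>x. f x - (\<Sum>j\<in>UNIV. T j x)))"

text \<open>The multiple series is summed unconditionally. For \<open>\<alpha>\<^sub>j > 0\<close> the binomial coefficients are
  absolutely summable, so for periodic, locally integrable \<open>f\<close> the series converges absolutely at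
  almost every \<open>x\<close>, where its value is that of the iterated series.\<close>

definition mixed_difference ::
  "real^'m \<Rightarrow> real^'m \<Rightarrow> (real^'m \<Rightarrow> real) \<Rightarrow> real^'m \<Rightarrow> real" where
  "mixed_difference \<alpha> h f x =
     (\<Sum>\<^sub>\<infinity>\<nu> :: 'm \<Rightarrow> nat. (-1) ^ (\<Sum>j\<in>UNIV. \<nu> j) * (\<Prod>j\<in>UNIV. (\<alpha> $ j) gchoose \<nu> j)
        * f (x + (\<Sum>i\<in>UNIV. ((\<alpha> $ i - real (\<nu> i)) * h $ i) *\<^sub>R axis i 1)))"

definition mixed_modulus ::
  "real \<Rightarrow> real \<Rightarrow> real^'m \<Rightarrow> (real^'m \<Rightarrow> real) \<Rightarrow> real^'m \<Rightarrow> ennreal" where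
  "mixed_modulus p \<tau> \<alpha> f t =
     (SUP h\<in>{h. \<forall>j. \<bar>h $ j\<bar> \<le> t $ j}. lorentz_norm p \<tau> (mixed_difference \<alpha> h f))"

definition angle_sum ::
  "real \<Rightarrow> real \<Rightarrow> real^'m \<Rightarrow> ('m \<Rightarrow> nat) \<Rightarrow> (real^'m \<Rightarrow> real) \<Rightarrow> ennreal" where
  "angle_sum p \<tau> \<alpha> n f =
     ennreal (\<Prod>j\<in>UNIV. real (n j) powr (- (\<alpha> $ j))) *
     ennpowr
       (\<Sum>\<nu>\<in>{\<nu>. \<forall>j. \<nu> j \<in> {1..n j + 1}}.
          ennreal (\<Prod>j\<in>UNIV. real (\<nu> j) powr (2 * \<alpha> $ j - 1)) *
          (angle_approx p \<tau> (\<lambda>j. \<nu> j - 1) f)\<^sup>2)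
       (1 / 2)"

end

theory Submission
  imports Defs
begin

text \<open>A function with spectrum in the lacunary set \<open>{k. \<bar>k\<^sub>j\<bar> is a power of 2 for all j}\<close> has a
  Lorentz norm comparable to the \<open>l\<^sup>2\<close> norm of its Fourier coefficients. Indeed
  \<open>L\<^sub>s \<subseteq> L\<^sub>p\<^sub>,\<^sub>\<tau> \<subseteq> L\<^sub>q\<close> for \<open>q < p < s\<close>, and even moments of lacunary sums are controlled
  combinatorially because sums of few powers of a large base determine their summands.
  The lower bound holds for arbitrary functions, with only the lacunary coefficients on the left.

  The mixed difference multiplies the coefficient at \<open>k\<close> by a factor of modulus
  \<open>\<Prod>\<^sub>j \<bar>2 sin (k\<^sub>j h\<^sub>j / 2)\<bar> powr \<alpha>\<^sub>j\<close>, and the best angular approximation sees exactly the coefficients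
  with \<open>\<bar>k\<^sub>j\<bar> > l\<^sub>j\<close> for all \<open>j\<close>. So the squares of both sides are comparable to the sum of
  \<open>\<bar>fourier_coeff f k\<bar>\<^sup>2 \<Prod>\<^sub>j min 1 (\<bar>k\<^sub>j\<bar> / n\<^sub>j) powr (2 \<alpha>\<^sub>j)\<close> over \<open>k\<close>.\<close>

section \<open>Translation invariance over a fundamental domain\<close>

text \<open>The moment bound is available for trigonometric polynomials only, while \<open>f\<close>
  is known just through its Fourier coefficients, without convergence of its series. Duality bridges
  this gap twice: an arbitrary function is paired with the polynomial built from its own lacunary
  coefficients, which gives the lower bound; a function of lacunary spectrum is then paired with
  arbitrary polynomials, to which that lower bound applies, and this gives the upper bound. The
  lower bound has to cover arbitrary functions because the competitors in the best approximation
  need not have lacunary spectrum: once they are subtracted, only the coefficients with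
  \<open>\<bar>k j\<bar> > l j\<close> for all \<open>j\<close> are still known. One integer
  \<open>r\<close> with \<open>2 r / (2 r - 1) < p < 2 r\<close> serves as the source of both
  auxiliary exponents; the strict gaps absorb the second Lorentz exponent. A near-best approximant
  must be an actual function, periodic and with vanishing integral on almost every line parallel to
  an axis. It is therefore built from finitely many translates of \<open>f\<close>, which keep these
  properties, and not from a partial sum of the Fourier series.\<close>

definition tiles :: "'a::euclidean_space set \<Rightarrow> 'a set \<Rightarrow> bool" where
  "tiles D Z \<longleftrightarrow> D \<in> sets lebesgue \<and> countable Z \<and> (\<forall>z\<in>Z. - z \<in> Z) \<and> (\<forall>x. \<exists>!z. z \<in> Z \<and> x - z \<in> D)"

lemma lebesgue_eq_distr_translation:
  "(lebesgue :: 'a::euclidean_space measure) = distr lebesgue lebesgue (\<lambda>x. a + x)"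
proof -
  have "(lebesgue :: 'a measure) = density (distr lebesgue lebesgue (\<lambda>x. a + (\<Sum>j\<in>Basis. (1 * (x \<bullet> j)) *\<^sub>R j))) (\<lambda>_. (\<Prod>j\<in>Basis. \<bar>1::real\<bar>))"
    using lebesgue_affine_euclidean[of "\<lambda>_. 1 :: real" a] by simp
  then show ?thesis
    by (simp add: euclidean_representation density_1)
qed

lemma measurable_lebesgue_translation [measurable]:
  "(\<lambda>x::'a::euclidean_space. a + x) \<in> lebesgue \<rightarrow>\<^sub>M lebesgue"
  using lebesgue_affine_measurable[of "\<lambda>_. 1" a] by (simp add: euclidean_representation)

lemma nn_integral_lebesgue_translation:
  fixes F :: "'a::euclidean_space \<Rightarrow> ennreal"
  assumes "F \<in> borel_measurable lebesgue"
  shows "(\<integral>\<^sup>+x. F (a + x) \<partial>lebesgue) = (\<integral>\<^sup>+x. F x \<partial>lebesgue)"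
  using assms by (subst (2) lebesgue_eq_distr_translation[of a], subst nn_integral_distr) auto

text \<open>Used to insert a factor 1, written as a sum over all tiles of the indicator that the
  point lies in that tile.\<close>

lemma nn_integral_count_space_unique:
  assumes "\<exists>!z. z \<in> Z \<and> P z"
  shows "(\<integral>\<^sup>+z. (c :: ennreal) * indicator {z. P z} z \<partial>count_space Z) = c"
proof -
  obtain z where z: "z \<in> Z" "P z" "\<And>y. y \<in> Z \<Longrightarrow> P y \<Longrightarrow> y = z" using assms by blast
  have 0: "c * indicator {z. P z} y = 0" if "y \<in> Z" "y \<notin> {z}" for y
    using z(3)[of y] that by (auto simp: indicator_def)
  have "(\<integral>\<^sup>+z. c * indicator {z. P z} z \<partial>count_space Z) = (\<Sum>a\<in>{z}. c * indicator {z. P z} a)"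
    using z(1) 0 by (intro nn_integral_count_space') blast+
  with z(2) show ?thesis by simp
qed

text \<open>The integral over \<open>a + D\<close> is cut along the tiles \<open>z + D\<close>, and
  each piece is moved back into \<open>D\<close> by periodicity. The moved pieces cover
  \<open>D\<close> exactly once because the translates of \<open>a + D\<close> tile the space as
  well. For nonnegative integrands the interchange of sum and integral is free.\<close>

lemma nn_integral_tile_translation:
  fixes F :: "'a::euclidean_space \<Rightarrow> ennreal"
  assumes t: "tiles D Z" and F[measurable]: "F \<in> borel_measurable lebesgue"
    and per: "\<And>x z. z \<in> Z \<Longrightarrow> F (x + z) = F x"
  shows "(\<integral>\<^sup>+x. F (a + x) \<partial>lebesgue_on D) = (\<integral>\<^sup>+x. F x \<partial>lebesgue_on D)"
proof -
  have D[measurable]: "D \<in> sets lebesgue" and Z: "countable Z" and neg: "\<And>z. z \<in> Z \<Longrightarrow> - z \<in> Z"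
    and ex: "\<And>x. \<exists>!z. z \<in> Z \<and> x - z \<in> D" using t by (auto simp: tiles_def)
  have per': "\<And>x z. z \<in> Z \<Longrightarrow> F (z + x) = F x" using per by (metis add.commute)
  have ind: "(\<lambda>x. indicator D (c + x) :: ennreal) \<in> borel_measurable lebesgue" for c
    by measurable
  have ind': "(\<lambda>x. indicator D (x - c) :: ennreal) \<in> borel_measurable lebesgue" for c
    using ind[of "-c"] by simp
  have Ft: "(\<lambda>x. F (c + x)) \<in> borel_measurable lebesgue" for c
    by measurable
  have "(\<integral>\<^sup>+x. F (a + x) \<partial>lebesgue_on D) = (\<integral>\<^sup>+x. F (a + x) * indicator D x \<partial>lebesgue)"
    by (subst nn_integral_restrict_space) auto
  also have "\<dots> = (\<integral>\<^sup>+x. F (a + (-a + x)) * indicator D (-a + x) \<partial>lebesgue)"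
    by (subst nn_integral_lebesgue_translation[of _ "-a"]) (use Ft in auto)
  also have "\<dots> = (\<integral>\<^sup>+x. F x * indicator D (x - a) \<partial>lebesgue)"
    by simp
  also have "\<dots> = (\<integral>\<^sup>+x. (\<integral>\<^sup>+z. F x * indicator D (x - a) * indicator {z. x - z \<in> D} z \<partial>count_space Z) \<partial>lebesgue)"
    using ex by (subst nn_integral_count_space_unique) auto
  also have "\<dots> = (\<integral>\<^sup>+z. (\<integral>\<^sup>+x. F x * indicator D (x - a) * indicator D (x - z) \<partial>lebesgue) \<partial>count_space Z)"
    using Z ind' by (subst nn_integral_count_space_nn_integral[symmetric])
      (auto intro!: nn_integral_cong simp: indicator_def)
  also have "\<dots> = (\<integral>\<^sup>+z. (\<integral>\<^sup>+x. F (z + x) * indicator D (z + x - a) * indicator D (z + x - z) \<partial>lebesgue) \<partial>count_space Z)"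
    by (subst nn_integral_lebesgue_translation) (use ind' in auto)
  also have "\<dots> = (\<integral>\<^sup>+z. (\<integral>\<^sup>+x. F x * indicator D x * indicator {z. x - a - (- z) \<in> D} z \<partial>lebesgue) \<partial>count_space Z)"
    by (intro nn_integral_cong)
      (auto simp: indicator_def per' algebra_simps)
  also have "\<dots> = (\<integral>\<^sup>+x. (\<integral>\<^sup>+z. F x * indicator D x * indicator {z. x - a - (- z) \<in> D} z \<partial>count_space Z) \<partial>lebesgue)"
  proof (subst nn_integral_count_space_nn_integral[symmetric])
    fix z
    have "(\<lambda>x. F x * indicator D x * indicator {z. x - a - (- z) \<in> D} z)
        = (\<lambda>x. F x * indicator D x * indicator D (x - (a - z)))"
      by (auto simp: indicator_def algebra_simps)
    moreover have "(\<lambda>x. F x * indicator D x * indicator D (x - (a - z))) \<in> borel_measurable lebesgue"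
      using ind'[of "a - z"] by measurable
    ultimately show "(\<lambda>x. F x * indicator D x * indicator {z. x - a - (- z) \<in> D} z) \<in> borel_measurable lebesgue"
      by simp
  qed (use Z in auto)
  \<comment> \<open>The sum over \<open>z\<close> now finds the unique tile containing
    \<open>x - a\<close>, but under the index \<open>- z\<close>; closure of \<open>Z\<close> under
    negation makes it run over all tiles.\<close>
  also have "\<dots> = (\<integral>\<^sup>+x. F x * indicator D x \<partial>lebesgue)"
  proof (intro nn_integral_cong nn_integral_count_space_unique)
    fix x
    obtain z where z: "z \<in> Z" "x - a - z \<in> D" "\<And>y. y \<in> Z \<Longrightarrow> x - a - y \<in> D \<Longrightarrow> y = z"
      using ex[of "x - a"] by (elim ex1E) blast
    show "\<exists>!z. z \<in> Z \<and> x - a - (- z) \<in> D"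
    proof (rule ex1I[of _ "-z"])
      show "- z \<in> Z \<and> x - a - (- (- z)) \<in> D" using z(1,2) neg by simp
      fix y assume "y \<in> Z \<and> x - a - (- y) \<in> D"
      then have "- y = z" using neg by (intro z(3)) blast+
      then show "y = - z" by (metis minus_minus)
    qed
  qed
  also have "\<dots> = (\<integral>\<^sup>+x. F x \<partial>lebesgue_on D)"
    by (subst nn_integral_restrict_space) auto
  finally show ?thesis .
qed

lemma has_bochner_integral_tile_translation_real:
  fixes F :: "'a::euclidean_space \<Rightarrow> real"
  assumes t: "tiles D Z" and F[measurable]: "F \<in> borel_measurable lebesgue"
    and per: "\<And>x z. z \<in> Z \<Longrightarrow> F (x + z) = F x"
    and I: "has_bochner_integral (lebesgue_on D) F I"
  shows "has_bochner_integral (lebesgue_on D) (\<lambda>x. F (a + x)) I"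
proof -
  have D[measurable]: "D \<in> sets lebesgue" using t by (auto simp: tiles_def)
  have m: "(\<lambda>x. F (a + x)) \<in> borel_measurable lebesgue" by measurable
  have mD: "(\<lambda>x. F (a + x)) \<in> borel_measurable (lebesgue_on D)"
    using m by (rule measurable_restrict_space1)
  have int: "integrable (lebesgue_on D) F" and eq: "integral\<^sup>L (lebesgue_on D) F = I"
    using I by (auto simp: has_bochner_integral_iff)
  \<comment> \<open>To be used with the absolute value, the identity and the negation as
    \<open>g\<close>: since \<open>ennreal\<close> sends negative reals to 0, the last two give the
    positive and the negative part.\<close>
  have *: "(\<integral>\<^sup>+x. ennreal (g (F (a + x))) \<partial>lebesgue_on D) = (\<integral>\<^sup>+x. ennreal (g (F x)) \<partial>lebesgue_on D)"
    if [measurable]: "g \<in> borel_measurable borel" for g :: "real \<Rightarrow> real"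
    by (rule nn_integral_tile_translation[OF t]) (use per in auto)
  have int': "integrable (lebesgue_on D) (\<lambda>x. F (a + x))"
    using int mD *[of "\<lambda>x. \<bar>x\<bar>"] by (simp add: integrable_iff_bounded)
  then have "integral\<^sup>L (lebesgue_on D) (\<lambda>x. F (a + x)) = I"
    using int eq *[of "\<lambda>x. x"] *[of "\<lambda>x. - x"] by (simp add: real_lebesgue_integral_def)
  with int' show ?thesis by (simp add: has_bochner_integral_iff)
qed

lemma has_bochner_integral_complex_iff:
  "has_bochner_integral M F I \<longleftrightarrow>
    has_bochner_integral M (\<lambda>x. Re (F x)) (Re I) \<and> has_bochner_integral M (\<lambda>x. Im (F x)) (Im I)"
proof
  assume "has_bochner_integral M F I"
  then show "has_bochner_integral M (\<lambda>x. Re (F x)) (Re I) \<and> has_bochner_integral M (\<lambda>x. Im (F x)) (Im I)"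
    by (auto intro: has_bochner_integral_bounded_linear bounded_linear_Re bounded_linear_Im)
next
  assume *: "has_bochner_integral M (\<lambda>x. Re (F x)) (Re I) \<and> has_bochner_integral M (\<lambda>x. Im (F x)) (Im I)"
  have "has_bochner_integral M (\<lambda>x. complex_of_real (Re (F x)) + \<i> * complex_of_real (Im (F x))) (of_real (Re I) + \<i> * of_real (Im I))"
    using * by (intro has_bochner_integral_add has_bochner_integral_mult_right)
      (auto intro: has_bochner_integral_bounded_linear bounded_linear_of_real)
  then show "has_bochner_integral M F I"
    by (simp flip: complex_eq)
qed

lemma has_bochner_integral_tile_translation:
  fixes F :: "'a::euclidean_space \<Rightarrow> complex"
  assumes "tiles D Z" "F \<in> borel_measurable lebesgue"
    and "\<And>x z. z \<in> Z \<Longrightarrow> F (x + z) = F x"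
    and "has_bochner_integral (lebesgue_on D) F I"
  shows "has_bochner_integral (lebesgue_on D) (\<lambda>x. F (a + x)) I"
  using assms unfolding has_bochner_integral_complex_iff
  by (auto intro!: has_bochner_integral_tile_translation_real[OF assms(1)])

abbreviation int_vectors :: "(real^'m) set" where
  "int_vectors \<equiv> range (\<lambda>k :: 'm \<Rightarrow> int. \<chi> j. of_int (k j))"

abbreviation torus :: "(real^'m) measure" where
  "torus \<equiv> lebesgue_on unit_cell"

lemma unit_cell_lmeasurable: "(unit_cell :: (real^'m) set) \<in> sets borel" "emeasure lebesgue (unit_cell :: (real^'m) set) = 1"
proof -
  have eq: "unit_cell = cbox 0 (1 :: real^'m) - (\<Union>j. {x. x $ j = 1})"
    by (auto simp: unit_cell_def mem_box_cart less_le)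
  have "closed {x :: real^'m. x $ j = 1}" for j
    by (intro closed_Collect_eq continuous_intros)
  then show b: "unit_cell \<in> sets (borel :: (real^'m) measure)"
    unfolding eq by (intro sets.Diff sets.countable_UN'') (auto simp: borel_closed)
  have ss: "box 0 (1 :: real^'m) \<subseteq> unit_cell" "unit_cell \<subseteq> cbox 0 (1 :: real^'m)"
    by (auto simp: unit_cell_def mem_box_cart less_imp_le)
  have 1: "(1 :: real^'m) \<bullet> b = 1" if "b \<in> Basis" for b
    using that by (auto simp: Basis_vec_def inner_axis)
  have "emeasure lborel (unit_cell :: (real^'m) set) \<le> emeasure lborel (cbox 0 (1 :: real^'m))"
    using ss(2) by (intro emeasure_mono) simp_all
  moreover have "emeasure lborel (box 0 (1 :: real^'m)) \<le> emeasure lborel (unit_cell :: (real^'m) set)"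
    using ss(1) b by (intro emeasure_mono) simp_all
  ultimately show "emeasure lebesgue (unit_cell :: (real^'m) set) = 1"
    using b by (intro antisym) (simp_all add: emeasure_lborel_box_eq emeasure_lborel_cbox_eq 1 less_imp_le)
qed

lemma unit_cell_sets [measurable]: "unit_cell \<in> sets lebesgue"
  using unit_cell_lmeasurable by auto

lemma emeasure_torus: "emeasure torus (space (torus :: (real^'m) measure)) = 1"
  using unit_cell_lmeasurable by (auto simp: emeasure_restrict_space space_restrict_space)

lemma finite_measure_torus: "finite_measure (torus :: (real^'m) measure)"
  by (intro finite_measureI) (simp only: emeasure_torus infinity_ennreal_def, simp)

lemma tiles_unit_cell: "tiles unit_cell (int_vectors :: (real^'m) set)"
  unfolding tiles_def
proof (intro conjI ballI allI)
  show "unit_cell \<in> sets (lebesgue :: (real^'m) measure)"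
    using unit_cell_lmeasurable by auto
  show "- z \<in> int_vectors" if "z \<in> int_vectors" for z :: "real^'m"
  proof -
    from that obtain k :: "'m \<Rightarrow> int" where "z = (\<chi> j. of_int (k j))" by auto
    then show ?thesis by (intro image_eqI[where x = "\<lambda>j. - k j"]) (auto simp: vec_eq_iff)
  qed
  fix x :: "real^'m"
  show "\<exists>!z. z \<in> int_vectors \<and> x - z \<in> unit_cell"
  proof (rule ex1I)
    show "(\<chi> j. of_int \<lfloor>x $ j\<rfloor>) \<in> int_vectors \<and> x - (\<chi> j. of_int \<lfloor>x $ j\<rfloor>) \<in> unit_cell"
    proof (intro conjI)
      show "(\<chi> j. of_int \<lfloor>x $ j\<rfloor>) \<in> int_vectors"
        by (rule range_eqI[of _ _ "\<lambda>j. \<lfloor>x $ j\<rfloor>"]) simp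
      show "x - (\<chi> j. of_int \<lfloor>x $ j\<rfloor>) \<in> unit_cell"
        unfolding unit_cell_def using floor_correct[of "x $ j" for j] by (simp add: algebra_simps)
    qed
    fix z assume "z \<in> int_vectors \<and> x - z \<in> unit_cell"
    then obtain k :: "'m \<Rightarrow> int" where k: "z = (\<chi> j. of_int (k j))" "x - z \<in> unit_cell" by auto
    have "0 \<le> x $ j - of_int (k j) \<and> x $ j - of_int (k j) < 1" for j
      using k(2) unfolding k(1) unit_cell_def by simp
    then have "\<lfloor>x $ j\<rfloor> = k j" for j
      by (intro floor_unique) (smt (verit))+
    then show "z = (\<chi> j. of_int \<lfloor>x $ j\<rfloor>)" using k(1) by simp
  qed
qed auto

lemma tiles_unit_interval: "tiles {0..<1::real} \<int>"
  unfolding tiles_def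
proof (intro conjI ballI allI)
  show "countable (\<int> :: real set)" by (simp add: Ints_def)
  fix x :: real
  show "\<exists>!z. z \<in> \<int> \<and> x - z \<in> {0..<1}"
  proof (rule ex1I[of _ "of_int \<lfloor>x\<rfloor>"])
    show "real_of_int \<lfloor>x\<rfloor> \<in> \<int> \<and> x - real_of_int \<lfloor>x\<rfloor> \<in> {0..<1}" by (auto, linarith)
    fix z assume "z \<in> \<int> \<and> x - z \<in> {0..<1}"
    then obtain k where "z = of_int k" "x - of_int k \<in> {0..<1}" by (auto elim: Ints_cases)
    moreover from this have "\<lfloor>x\<rfloor> = k" by (intro floor_unique) auto
    ultimately show "z = of_int \<lfloor>x\<rfloor>" by simp
  qed
  show "- z \<in> \<int>" if "z \<in> \<int>" for z :: real
    using that by (rule Ints_minus)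
qed simp

section \<open>Trigonometric sums with lacunary spectrum\<close>

text \<open>The characters in the rescaled variable of the unit cell, hence of period 1 in each
  coordinate.\<close>

definition echar :: "('m \<Rightarrow> int) \<Rightarrow> real^'m \<Rightarrow> complex" where
  "echar k x = cis (2 * pi * (\<Sum>j\<in>UNIV. of_int (k j) * x $ j))"

definition fcoef :: "(real^'m \<Rightarrow> complex) \<Rightarrow> ('m \<Rightarrow> int) \<Rightarrow> complex" where
  "fcoef G k = (LINT x|torus. G x * echar (\<lambda>j. - k j) x)"

lemma fourier_coeff_eq_fcoef: "fourier_coeff f k = fcoef (\<lambda>x. of_real (f ((2 * pi) *\<^sub>R x))) k"
  by (simp add: fourier_coeff_def fcoef_def echar_def set_lebesgue_integral_def
      integral_restrict_space sum_negf)

lemma norm_echar [simp]: "norm (echar k x) = 1"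
  by (simp add: echar_def)

lemma echar_nonzero [simp]: "echar k x \<noteq> 0"
  by (simp add: echar_def)

lemma echar_add: "echar (\<lambda>j. k j + l j) x = echar k x * echar l x"
  by (simp add: echar_def cis_mult sum.distrib algebra_simps)

lemma echar_add_right: "echar k (x + y) = echar k x * echar k y"
  by (simp add: echar_def cis_mult sum.distrib algebra_simps)

lemma echar_zero [simp]: "echar (\<lambda>_. 0) x = 1"
  by (simp add: echar_def)

lemma echar_sum: "echar (\<lambda>j. \<Sum>i\<in>I. \<kappa> i j) x = (\<Prod>i\<in>I. echar (\<kappa> i) x)"
  by (induction I rule: infinite_finite_induct) (simp_all add: echar_add)

lemma cnj_echar: "cnj (echar k x) = echar (\<lambda>j. - k j) x"
  by (simp add: echar_def cis_cnj sum_negf)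

lemma echar_int_vectors: "z \<in> int_vectors \<Longrightarrow> echar k z = 1"
proof -
  assume "z \<in> int_vectors"
  then obtain l :: "'a \<Rightarrow> int" where "z = (\<chi> j. of_int (l j))" by auto
  then have "2 * pi * (\<Sum>j\<in>UNIV. of_int (k j) * z $ j) = 2 * pi * of_int (\<Sum>j\<in>UNIV. k j * l j)"
    by simp
  then show ?thesis unfolding echar_def by (metis cis_multiple_2pi Ints_of_int)
qed

lemma echar_axis: "echar k (axis j c) = cis (2 * pi * of_int (k j) * c)"
proof -
  have "(\<Sum>i\<in>UNIV. of_int (k i) * axis j c $ i) = (\<Sum>i\<in>UNIV. if i = j then of_int (k j) * c else 0)"
    by (intro sum.cong) (auto simp: axis_def)
  then show ?thesis by (simp add: echar_def mult_ac)
qed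

lemma continuous_echar: "continuous_on S (echar k)"
  unfolding echar_def by (intro continuous_intros)

lemma borel_measurable_echar [measurable]: "echar k \<in> borel_measurable lebesgue"
  using continuous_imp_measurable_on_sets_lebesgue[OF continuous_echar, of UNIV] by (simp add: lebesgue_on_UNIV_eq)

lemma borel_measurable_echar_torus [measurable]: "echar k \<in> borel_measurable torus"
  using borel_measurable_echar by (rule measurable_restrict_space1)

lemma integrable_torus_bounded:
  fixes G :: "real^'m \<Rightarrow> 'b::{banach,second_countable_topology}"
  assumes "G \<in> borel_measurable torus" "\<And>x. norm (G x) \<le> B"
  shows "integrable torus G"
  using assms by (intro finite_measure.integrable_const_bound[OF finite_measure_torus, of _ B]) auto

text \<open>Translating by half a period of a nonzero frequency changes the sign of the character
  but not its integral over the cell.\<close>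

lemma has_bochner_integral_echar:
  "has_bochner_integral torus (echar k) (if k = (\<lambda>_. 0) then 1 else 0)"
proof (cases "k = (\<lambda>_. 0)")
  case True
  have "has_bochner_integral torus (\<lambda>x::real^'a. 1 :: complex) (of_real (measure torus (space (torus :: (real^'a) measure))))"
    using finite_measure.integrable_const[OF finite_measure_torus[where 'm = 'a], of "1::complex"]
    unfolding has_bochner_integral_iff by (simp add: scaleR_conv_of_real)
  moreover have "echar k = (\<lambda>x. 1)" using True by auto
  moreover have "measure torus (space (torus :: (real^'a) measure)) = 1"
    using emeasure_torus by (simp add: measure_def)
  ultimately show ?thesis using True by simp
next
  case False
  then obtain j where j: "k j \<noteq> 0" by auto
  define a :: "real^'a" where "a = axis j (1 / (2 * of_int (k j)))"
  have a: "echar k a = -1"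
    using j by (simp add: a_def echar_axis)
  have int: "has_bochner_integral torus (echar k) (integral\<^sup>L torus (echar k))"
    by (intro has_bochner_integral_integrable integrable_torus_bounded[of _ 1]) auto
  have "has_bochner_integral torus (\<lambda>x. echar k (a + x)) (integral\<^sup>L torus (echar k))"
    by (rule has_bochner_integral_tile_translation[OF tiles_unit_cell _ _ int])
      (auto simp: echar_add_right echar_int_vectors)
  then have "has_bochner_integral torus (\<lambda>x. - echar k x) (integral\<^sup>L torus (echar k))"
    by (simp add: echar_add_right a)
  from has_bochner_integral_minus[OF this]
  have "integral\<^sup>L torus (echar k) = - integral\<^sup>L torus (echar k)"
    using int by (simp add: has_bochner_integral_iff)
  then have "integral\<^sup>L torus (echar k) = 0" by simp
  with int show ?thesis using False by simp
qed

definition trigsum :: "(('m \<Rightarrow> int) \<Rightarrow> complex) \<Rightarrow> ('m \<Rightarrow> int) set \<Rightarrow> real^'m \<Rightarrow> complex" where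
  "trigsum c F x = (\<Sum>k\<in>F. c k * echar k x)"

lemma borel_measurable_trigsum [measurable]: "trigsum c F \<in> borel_measurable torus"
  unfolding trigsum_def by measurable

lemma norm_trigsum_le: "norm (trigsum c F x) \<le> (\<Sum>k\<in>F. norm (c k))"
  unfolding trigsum_def by (rule order_trans[OF norm_sum]) (simp add: norm_mult)

text \<open>The pairing is bilinear, without conjugation; this is why coefficients at negated
  frequencies appear and why the duality arguments below reflect their frequency sets.\<close>

lemma has_bochner_integral_trigsum_mult:
  assumes "integrable torus G"
  shows "has_bochner_integral torus (\<lambda>x. G x * trigsum c F x) (\<Sum>k\<in>F. c k * fcoef G (\<lambda>j. - k j))"
proof -
  have *: "has_bochner_integral torus (\<lambda>x. c k * (G x * echar k x)) (c k * fcoef G (\<lambda>j. - k j))" for k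
  proof (intro has_bochner_integral_mult_right)
    have "integrable torus (\<lambda>x. G x * echar k x)"
    proof (rule Bochner_Integration.integrable_bound[OF assms])
      show "(\<lambda>x. G x * echar k x) \<in> borel_measurable torus" using assms by measurable
    qed (auto simp: norm_mult)
    then show "has_bochner_integral torus (\<lambda>x. G x * echar k x) (fcoef G (\<lambda>j. - k j))"
      by (simp add: has_bochner_integral_iff fcoef_def)
  qed
  have eq: "(\<lambda>x. G x * trigsum c F x) = (\<lambda>x. \<Sum>k\<in>F. c k * (G x * echar k x))"
    by (simp add: trigsum_def sum_distrib_left mult_ac)
  show ?thesis unfolding eq by (intro has_bochner_integral_sum *)
qed

lemma integrable_trigsum: "integrable torus (trigsum c F)"
  by (rule integrable_torus_bounded[of _ "(\<Sum>k\<in>F. norm (c k))"]) (auto intro: norm_trigsum_le)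

lemma fcoef_trigsum:
  assumes "finite F"
  shows "fcoef (trigsum c F) k = (if k \<in> F then c k else 0)"
proof -
  have "has_bochner_integral torus (\<lambda>x. \<Sum>l\<in>F. c l * echar (\<lambda>j. l j + - k j) x)
      (\<Sum>l\<in>F. c l * (if (\<lambda>j. l j + - k j) = (\<lambda>_. 0) then 1 else 0))"
    by (intro has_bochner_integral_sum has_bochner_integral_mult_right has_bochner_integral_echar)
  moreover have "(\<lambda>x. \<Sum>l\<in>F. c l * echar (\<lambda>j. l j + - k j) x) = (\<lambda>x. trigsum c F x * echar (\<lambda>j. - k j) x)"
    by (simp only: trigsum_def sum_distrib_right echar_add mult.assoc)
  moreover have "(\<Sum>l\<in>F. c l * (if (\<lambda>j. l j + - k j) = (\<lambda>_. 0) then 1 else 0)) = (\<Sum>l\<in>F. if l = k then c k else 0)"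
  proof (intro sum.cong refl)
    fix l
    have "(\<lambda>j. l j + - k j) = (\<lambda>_. 0) \<longleftrightarrow> l = k" by (simp add: fun_eq_iff)
    then show "c l * (if (\<lambda>j. l j + - k j) = (\<lambda>_. 0) then 1 else 0) = (if l = k then c k else 0)"
      by simp
  qed
  ultimately show ?thesis
    using assms by (simp add: fcoef_def has_bochner_integral_iff)
qed

lemma parseval_trigsum:
  assumes "finite F"
  shows "has_bochner_integral torus (\<lambda>x. (norm (trigsum c F x))\<^sup>2) (\<Sum>k\<in>F. (norm (c k))\<^sup>2)"
proof -
  have *: "cnj (trigsum c F x) = trigsum (\<lambda>k. cnj (c (\<lambda>j. - k j))) ((\<lambda>k j. - k j) ` F) x" for x
  proof -
    have "inj_on (\<lambda>k j. - (k j :: int)) F" by (auto simp: inj_on_def fun_eq_iff)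
    then show ?thesis
      by (simp add: trigsum_def sum.reindex cnj_echar)
  qed
  have "has_bochner_integral torus (\<lambda>x. trigsum c F x * cnj (trigsum c F x))
     (\<Sum>k\<in>(\<lambda>k j. - k j) ` F. cnj (c (\<lambda>j. - k j)) * fcoef (trigsum c F) (\<lambda>j. - k j))"
    unfolding * by (rule has_bochner_integral_trigsum_mult[OF integrable_trigsum])
  also have "(\<Sum>k\<in>(\<lambda>k j. - k j) ` F. cnj (c (\<lambda>j. - k j)) * fcoef (trigsum c F) (\<lambda>j. - k j))
     = (\<Sum>k\<in>F. cnj (c k) * c k)"
  proof -
    have "inj_on (\<lambda>k j. - (k j :: int)) F" by (auto simp: inj_on_def fun_eq_iff)
    then show ?thesis
      by (simp add: sum.reindex fcoef_trigsum[OF assms])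
  qed
  also have "\<dots> = of_real (\<Sum>k\<in>F. (norm (c k))\<^sup>2)"
    by (simp add: mult.commute complex_norm_square del: of_real_power)
  also have "(\<lambda>x. trigsum c F x * cnj (trigsum c F x)) = (\<lambda>x. of_real ((norm (trigsum c F x))\<^sup>2))"
    by (simp only: complex_norm_square)
  finally show ?thesis
    by (simp add: has_bochner_integral_complex_iff)
qed

lemma norm_sum_squared_le:
  fixes f :: "'a \<Rightarrow> 'b::real_normed_vector"
  shows "(norm (sum f I))\<^sup>2 \<le> real (card I) * (\<Sum>i\<in>I. (norm (f i))\<^sup>2)"
proof -
  have "(norm (sum f I))\<^sup>2 \<le> (\<Sum>i\<in>I. norm (f i))\<^sup>2"
    by (intro power_mono norm_sum) auto
  also have "\<dots> \<le> (\<Sum>i\<in>I. (norm (f i))\<^sup>2) * real (card I)"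
    using sum_squared_le_sum_of_squares by blast
  finally show ?thesis by (simp add: mult.commute)
qed

text \<open>The moment of order \<open>2 * r\<close> is the squared \<open>L^2\<close> norm of the
  \<open>r\<close>-th power, so Parseval applies to that power. Its coefficient at \<open>n\<close>
  is a sum over the representations of \<open>n\<close> as an ordered sum of \<open>r\<close>
  frequencies from \<open>F\<close>; with at most \<open>R\<close> of them, Cauchy--Schwarz loses
  the factor \<open>R\<close>, and the squares recombine to the \<open>r\<close>-th power of the
  sum.\<close>

lemma integral_trigsum_power_le:
  fixes c :: "('m::finite \<Rightarrow> int) \<Rightarrow> complex"
  assumes F: "finite F"
    and R: "\<And>n. card {u \<in> {..<r} \<rightarrow>\<^sub>E F. (\<lambda>j. \<Sum>i<r. u i j) = n} \<le> R"
  shows "(LINT x|torus. norm (trigsum c F x) ^ (2 * r)) \<le> real R * (\<Sum>k\<in>F. (norm (c k))\<^sup>2) ^ r"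
proof -
  define S where "S = ({..<r} \<rightarrow>\<^sub>E F)"
  define s :: "(nat \<Rightarrow> 'm \<Rightarrow> int) \<Rightarrow> 'm \<Rightarrow> int" where "s u = (\<lambda>j. \<Sum>i<r. u i j)" for u
  define d where "d n = (\<Sum>u\<in>{u \<in> S. s u = n}. \<Prod>i<r. c (u i))" for n
  have finS: "finite S" using F by (auto simp: S_def intro: finite_PiE)
  have pow: "trigsum c F x ^ r = trigsum d (s ` S) x" for x
  proof -
    have "trigsum c F x ^ r = (\<Prod>i<r. \<Sum>k\<in>F. c k * echar k x)"
      by (simp add: trigsum_def)
    also have "\<dots> = (\<Sum>u\<in>S. \<Prod>i<r. c (u i) * echar (u i) x)"
      unfolding S_def using F by (subst prod_sum_PiE) auto
    also have "\<dots> = (\<Sum>u\<in>S. (\<Prod>i<r. c (u i)) * echar (s u) x)"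
      by (simp add: prod.distrib s_def echar_sum)
    also have "\<dots> = (\<Sum>n\<in>s ` S. \<Sum>u\<in>{u \<in> S. s u = n}. (\<Prod>i<r. c (u i)) * echar (s u) x)"
      using finS by (rule sum.image_gen)
    also have "\<dots> = trigsum d (s ` S) x"
      by (auto simp: trigsum_def d_def sum_distrib_right intro!: sum.cong)
    finally show ?thesis .
  qed
  have "(LINT x|torus. norm (trigsum c F x) ^ (2 * r)) = (LINT x|torus. (norm (trigsum d (s ` S) x))\<^sup>2)"
    by (simp flip: pow add: norm_power power_mult[symmetric] mult.commute)
  also have "\<dots> = (\<Sum>n\<in>s ` S. (norm (d n))\<^sup>2)"
    using parseval_trigsum[of "s ` S" d] finS by (simp add: has_bochner_integral_iff)
  also have "\<dots> \<le> (\<Sum>n\<in>s ` S. real R * (\<Sum>u\<in>{u \<in> S. s u = n}. (norm (\<Prod>i<r. c (u i)))\<^sup>2))"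
  proof (rule sum_mono)
    fix n
    have "(norm (d n))\<^sup>2 \<le> real (card {u \<in> S. s u = n}) * (\<Sum>u\<in>{u \<in> S. s u = n}. (norm (\<Prod>i<r. c (u i)))\<^sup>2)"
      unfolding d_def by (rule norm_sum_squared_le)
    also have "\<dots> \<le> real R * (\<Sum>u\<in>{u \<in> S. s u = n}. (norm (\<Prod>i<r. c (u i)))\<^sup>2)"
      using R[of n] by (intro mult_right_mono sum_nonneg) (auto simp: S_def s_def)
    finally show "(norm (d n))\<^sup>2 \<le> real R * (\<Sum>u\<in>{u \<in> S. s u = n}. (norm (\<Prod>i<r. c (u i)))\<^sup>2)" .
  qed
  also have "\<dots> = real R * (\<Sum>u\<in>S. (norm (\<Prod>i<r. c (u i)))\<^sup>2)"
    using sum.image_gen[OF finS, of "\<lambda>u. (norm (\<Prod>i<r. c (u i)))\<^sup>2" s] by (simp add: sum_distrib_left)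
  also have "(\<Sum>u\<in>S. (norm (\<Prod>i<r. c (u i)))\<^sup>2) = (\<Sum>u\<in>S. \<Prod>i<r. (norm (c (u i)))\<^sup>2)"
    by (simp add: prod_norm[symmetric] prod_power_distrib)
  also have "\<dots> = (\<Sum>k\<in>F. (norm (c k))\<^sup>2) ^ r"
    unfolding S_def using F by (subst prod_sum_PiE[symmetric]) auto
  finally show ?thesis .
qed

section \<open>Uniqueness of sums of few powers of a large base\<close>

text \<open>Fewer than \<open>B\<close> powers with exponents below \<open>a\<close> cannot reach
  the single power \<open>B ^ a\<close>, so the larger maximal exponent decides.\<close>

lemma sum_powers_less:
  fixes B :: nat
  assumes "a \<in># M" "\<And>x. x \<in># N \<Longrightarrow> x < a" "size N < B"
  shows "(\<Sum>x\<in>#N. B ^ x) < (\<Sum>x\<in>#M. B ^ x)"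
proof -
  have B: "B > 0" using assms(3) by simp
  have "(\<Sum>x\<in>#N. B ^ x) < B ^ a"
  proof (cases "N = {#}")
    case False
    then obtain y where "y \<in># N" by blast
    with assms(2) obtain a' where a': "a = Suc a'" by (metis less_imp_Suc_add)
    have "(\<Sum>x\<in>#N. B ^ x) \<le> (\<Sum>x\<in>#N. B ^ a')"
      using assms(2) B unfolding a' by (intro sum_mset_mono power_increasing) (auto simp flip: less_Suc_eq_le)
    also have "\<dots> = size N * B ^ a'" by simp
    also have "\<dots> < B * B ^ a'" using assms(3) B by simp
    finally show ?thesis using a' by simp
  qed (use B in simp)
  also have "B ^ a \<le> (\<Sum>x\<in>#M. B ^ x)"
    using assms(1) by (metis (no_types, lifting) insert_DiffM le_add1 image_mset_add_mset sum_mset.insert)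
  finally show ?thesis .
qed

text \<open>Multiplicities below \<open>B\<close> act as digits, so this is uniqueness of the
  expansion in base \<open>B\<close>. By the preceding comparison the largest exponents agree; one
  copy is stripped from each side.\<close>

lemma mset_eq_if_sum_powers_eq:
  fixes B :: nat
  assumes "(\<Sum>x\<in>#M. B ^ x) = (\<Sum>x\<in>#N. B ^ x)" "size M < B" "size N < B"
  shows "M = N"
  using assms
proof (induction "size M" arbitrary: M N)
  case 0
  then have "M = {#}" by simp
  show ?case
  proof (rule ccontr)
    assume "M \<noteq> N"
    then obtain a where "a \<in># N" using \<open>M = {#}\<close> by auto
    then have "(\<Sum>x\<in>#M. B ^ x) < (\<Sum>x\<in>#N. B ^ x)"
      using \<open>M = {#}\<close> 0 by (intro sum_powers_less) auto
    with 0 show False by simp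
  qed
next
  case (Suc n)
  have ne: "M \<noteq> {#}" using Suc.hyps(2) by auto
  define a where "a = Max (set_mset M)"
  have a: "a \<in># M" "\<And>x. x \<in># M \<Longrightarrow> x \<le> a" using ne by (auto simp: a_def)
  have "N \<noteq> {#}"
    using sum_powers_less[of a M "{#}" B] a(1) Suc.prems by auto
  define b where "b = Max (set_mset N)"
  have b: "b \<in># N" "\<And>x. x \<in># N \<Longrightarrow> x \<le> b" using \<open>N \<noteq> {#}\<close> by (auto simp: b_def)
  have "\<not> a < b" using sum_powers_less[of b N M B] a b Suc.prems by (metis le_less_trans less_irrefl)
  moreover have "\<not> b < a" using sum_powers_less[of a M N B] a b Suc.prems by (metis le_less_trans less_irrefl)
  ultimately have "a = b" by simp
  obtain M' N' where M': "M = add_mset a M'" and N': "N = add_mset a N'"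
    using a(1) b(1) \<open>a = b\<close> by (metis insert_DiffM)
  have "M' = N'"
    using Suc.hyps(2) Suc.prems unfolding M' N' by (intro Suc.hyps(1)) auto
  then show ?case using M' N' by simp
qed

text \<open>Multiplicities are dropped: for counting it is enough that every exponent on one side
  also occurs on the other.\<close>

lemma image_eq_if_sum_powers_eq:
  fixes B :: nat
  assumes "finite I" "card I < B" "(\<Sum>i\<in>I. B ^ a i) = (\<Sum>i\<in>I. B ^ b i)"
  shows "a ` I = b ` I"
proof -
  have "image_mset a (mset_set I) = image_mset b (mset_set I)"
    using assms by (intro mset_eq_if_sum_powers_eq[where B = B])
      (auto simp: image_mset.compositionality comp_def sum_unfold_sum_mset)
  then have "set_mset (image_mset a (mset_set I)) = set_mset (image_mset b (mset_set I))"
    by simp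
  then show ?thesis using assms(1) by simp
qed

text \<open>The coordinates of a sum of \<open>r < B\<close> frequencies determine the digits of the summands in base \<open>B\<close>.\<close>

lemma card_representations_le:
  fixes F :: "('m::finite \<Rightarrow> int) set" and B :: nat
  assumes F: "\<And>k j. k \<in> F \<Longrightarrow> \<exists>a. k j = w j * int (B ^ a)"
    and w: "\<And>j. w j \<noteq> 0" and B: "r < B"
  shows "card {u \<in> {..<r} \<rightarrow>\<^sub>E F. (\<lambda>j. \<Sum>i<r. u i j) = n} \<le> (r ^ CARD('m)) ^ r"
proof (cases "{u \<in> {..<r} \<rightarrow>\<^sub>E F. (\<lambda>j. \<Sum>i<r. u i j) = n} = {}")
  case False
  then obtain u0 where k0: "u0 \<in> {..<r} \<rightarrow>\<^sub>E F" "(\<lambda>j. \<Sum>i<r. u0 i j) = n" by blast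
  obtain a where a: "\<And>k j. k \<in> F \<Longrightarrow> k j = w j * int (B ^ a k j)" using F by metis
  \<comment> \<open>One reference representation \<open>u0\<close> fixes, for each coordinate, at
    most \<open>r\<close> values that any other representation of \<open>n\<close> may use. Each of
    the \<open>r\<close> summands thus has at most \<open>r ^ CARD('m)\<close> candidates.\<close>
  define V where "V j = (\<lambda>i. u0 i j) ` {..<r}" for j
  have fV: "finite (V j)" "card (V j) \<le> r" for j
    using card_image_le[of "{..<r}" "\<lambda>i. u0 i j"] by (auto simp: V_def)
  have "{u \<in> {..<r} \<rightarrow>\<^sub>E F. (\<lambda>j. \<Sum>i<r. u i j) = n} \<subseteq> {..<r} \<rightarrow>\<^sub>E PiE UNIV V'" if "V' = V" for V'
  proof -
    have *: "u i j \<in> V j"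
      if u: "u \<in> {..<r} \<rightarrow>\<^sub>E F" "(\<lambda>j. \<Sum>i<r. u i j) = n" and i: "i < r" for u i j
      proof -
        have eq: "(\<Sum>i<r. u i j) = w j * int (\<Sum>i<r. B ^ a (u i) j)"
          if "u \<in> {..<r} \<rightarrow>\<^sub>E F" for u :: "nat \<Rightarrow> 'm \<Rightarrow> int"
          unfolding of_nat_sum sum_distrib_left
          by (intro sum.cong refl a) (use that in auto)
        have "(\<Sum>i<r. u i j) = (\<Sum>i<r. u0 i j)" using u(2) k0(2) by metis
        then have "w j * int (\<Sum>i<r. B ^ a (u i) j) = w j * int (\<Sum>i<r. B ^ a (u0 i) j)"
          using eq[OF u(1)] eq[OF k0(1)] by simp
        then have "(\<Sum>i<r. B ^ a (u i) j) = (\<Sum>i<r. B ^ a (u0 i) j)"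
          using w[of j] by (simp only: mult_cancel_left of_nat_eq_iff simp_thms)
        then have "(\<lambda>i. a (u i) j) ` {..<r} = (\<lambda>i. a (u0 i) j) ` {..<r}"
          using B by (intro image_eq_if_sum_powers_eq) auto
        then obtain i' where i': "i' < r" "a (u i) j = a (u0 i') j" using i by blast
        have "u i \<in> F" "u0 i' \<in> F" using u(1) k0(1) i i'(1) by auto
        then have "u i j = u0 i' j" using a i'(2) by metis
        then show ?thesis using i'(1) by (auto simp: V_def)
      qed
    show ?thesis
    proof
      fix u assume u: "u \<in> {u \<in> {..<r} \<rightarrow>\<^sub>E F. (\<lambda>j. \<Sum>i<r. u i j) = n}"
      show "u \<in> {..<r} \<rightarrow>\<^sub>E PiE UNIV V'"
      proof (rule PiE_I)
        fix i assume "i \<in> {..<r}"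
        with u * show "u i \<in> PiE UNIV V'" unfolding that by (auto simp: PiE_UNIV_domain)
      next
        fix i assume "i \<notin> {..<r}"
        with u show "u i = undefined" by (auto simp: PiE_def extensional_def)
      qed
    qed
  qed
  moreover have "finite ({..<r} \<rightarrow>\<^sub>E PiE UNIV V)"
    using fV by (intro finite_PiE) auto
  ultimately have "card {u \<in> {..<r} \<rightarrow>\<^sub>E F. (\<lambda>j. \<Sum>i<r. u i j) = n} \<le> card ({..<r} \<rightarrow>\<^sub>E PiE UNIV V)"
    by (intro card_mono) auto
  also have "\<dots> = (\<Prod>j\<in>UNIV. card (V j)) ^ r"
    by (simp add: card_PiE)
  also have "\<dots> \<le> (\<Prod>j\<in>(UNIV :: 'm set). r) ^ r"
    using fV by (intro power_mono prod_mono) auto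
  finally show ?thesis by simp
next
  case True
  then show ?thesis by (simp only: card.empty)
qed

text \<open>Every sign pattern occurs because a cosine is a sum of two opposite characters. No
  coordinate vanishes, the least modulus being \<open>2 ^ 0\<close>.\<close>

definition lacunary :: "('m \<Rightarrow> int) set" where
  "lacunary = {k. \<forall>j. \<exists>\<nu>::nat. \<bar>k j\<bar> = 2 ^ \<nu>}"

lemma norm_sum_power_le:
  fixes f :: "'a \<Rightarrow> 'b::real_normed_vector"
  assumes "finite I" "n > 0"
  shows "norm (sum f I) ^ n \<le> real (card I) ^ n * (\<Sum>i\<in>I. norm (f i) ^ n)"
proof (cases "I = {}")
  case False
  define M where "M = Max ((\<lambda>i. norm (f i)) ` I)"
  have M: "M \<in> (\<lambda>i. norm (f i)) ` I" "\<And>i. i \<in> I \<Longrightarrow> norm (f i) \<le> M"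
    using assms False by (auto simp: M_def intro!: Max_in)
  then obtain i where i: "i \<in> I" "M = norm (f i)" by auto
  have "norm (sum f I) \<le> real (card I) * M"
    using M(2) by (intro order_trans[OF norm_sum] sum_bounded_above) auto
  then have "norm (sum f I) ^ n \<le> (real (card I) * M) ^ n" by (intro power_mono) auto
  also have "\<dots> = real (card I) ^ n * norm (f i) ^ n" using i by (simp add: power_mult_distrib)
  also have "\<dots> \<le> real (card I) ^ n * (\<Sum>i\<in>I. norm (f i) ^ n)"
    using assms i(1) by (intro mult_left_mono member_le_sum) auto
  finally show ?thesis .
qed (use assms in \<open>simp add: power_0_left\<close>)

text \<open>Fixing the signs and the residues modulo \<open>r\<close> of the dyadic exponents splits the lacunary set into
  finitely many classes whose coordinates are multiples of powers of \<open>2 ^ r > r\<close>.\<close>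

lemma lacunary_polynomial_bound:
  assumes r: "r > 0"
  shows "\<exists>C>0. \<forall>F (c :: ('m::finite \<Rightarrow> int) \<Rightarrow> complex). finite F \<longrightarrow> F \<subseteq> lacunary \<longrightarrow>
     (LINT x|torus. norm (trigsum c F x) ^ (2 * r)) \<le> C * (\<Sum>k\<in>F. (norm (c k))\<^sup>2) ^ r"
proof -
  define W :: "('m \<Rightarrow> int) set" where "W = (UNIV \<rightarrow>\<^sub>E ((\<lambda>(e, b). e * 2 ^ b) ` ({1, -1} \<times> {..<r})))"
  have finW: "finite W" unfolding W_def by (intro finite_PiE) auto
  have Wnz: "w j \<noteq> 0" if "w \<in> W" for w j using PiE_mem[OF that[unfolded W_def], of j] by auto
  have "\<exists>w\<in>W. \<forall>j. \<exists>a. k j = w j * int ((2 ^ r) ^ a)" if "k \<in> lacunary" for k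
  proof -
    have "\<exists>\<nu>. \<forall>j. \<bar>k j\<bar> = 2 ^ \<nu> j"
      using that by (intro choice) (simp add: lacunary_def)
    then obtain \<nu> where \<nu>: "\<And>j. \<bar>k j\<bar> = 2 ^ \<nu> j" by blast
    have "k j = (sgn (k j) * 2 ^ (\<nu> j mod r)) * int ((2 ^ r) ^ (\<nu> j div r))" for j
    proof -
      have "k j = sgn (k j) * 2 ^ \<nu> j" using \<nu>[of j] by (metis sgn_mult_abs)
      also have "(2::int) ^ \<nu> j = 2 ^ (\<nu> j mod r) * (2 ^ r) ^ (\<nu> j div r)"
        by (simp flip: power_add power_mult)
      finally show ?thesis by simp
    qed
    moreover have "(\<lambda>j. sgn (k j) * 2 ^ (\<nu> j mod r)) \<in> W"
      unfolding W_def PiE_UNIV_domain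
    proof (intro CollectI allI Pi_I)
      fix j
      have "k j \<noteq> 0" using \<nu>[of j] by auto
      then show "sgn (k j) * 2 ^ (\<nu> j mod r) \<in> (\<lambda>(e, b). e * 2 ^ b) ` ({1, -1} \<times> {..<r})"
        using r by (intro image_eqI[of _ _ "(sgn (k j), \<nu> j mod r)"]) (auto simp: sgn_if)
    qed
    ultimately show ?thesis by (intro bexI[of _ "\<lambda>j. sgn (k j) * 2 ^ (\<nu> j mod r)"]) blast+
  qed
  then obtain cl where cl: "\<And>k. k \<in> lacunary \<Longrightarrow> cl k \<in> W"
    "\<And>k j. k \<in> lacunary \<Longrightarrow> \<exists>a. k j = cl k j * int ((2 ^ r) ^ a)" by metis
  define R where "R = (r ^ CARD('m)) ^ r"
  define C where "C = real (card W) ^ (2 * r) * (real (card W) * real R)"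
  have "W \<noteq> {}"
    unfolding W_def PiE_eq_empty_iff using r by auto
  then have "card W > 0" using finW by (simp add: card_gt_0_iff)
  moreover have "R > 0" using r by (simp add: R_def)
  ultimately have "C > 0" by (simp add: C_def)
  moreover have "(LINT x|torus. norm (trigsum c F x) ^ (2 * r)) \<le> C * (\<Sum>k\<in>F. (norm (c k))\<^sup>2) ^ r"
    if F: "finite F" "F \<subseteq> lacunary" for F and c :: "('m \<Rightarrow> int) \<Rightarrow> complex"
  proof -
    define G where "G w = {k \<in> F. cl k = w}" for w
    define A where "A = (\<Sum>k\<in>F. (norm (c k))\<^sup>2)"
    let ?G = "\<lambda>w x. norm (trigsum c (G w) x) ^ (2 * r)"
    have int: "integrable torus (\<lambda>x. norm (trigsum c E x) ^ (2 * r))" for E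
      by (rule integrable_torus_bounded[of _ "(\<Sum>k\<in>E. norm (c k)) ^ (2 * r)"])
        (auto simp: norm_power intro!: power_mono norm_trigsum_le)
    have split: "trigsum c F x = (\<Sum>w\<in>W. trigsum c (G w) x)" for x
      unfolding trigsum_def G_def
      by (rule sum.group[symmetric]) (use F finW cl(1) in auto)
    have "(LINT x|torus. norm (trigsum c F x) ^ (2 * r))
        \<le> (LINT x|torus. real (card W) ^ (2 * r) * (\<Sum>w\<in>W. ?G w x))"
    proof (rule integral_mono[OF int])
      show "integrable torus (\<lambda>x. real (card W) ^ (2 * r) * (\<Sum>w\<in>W. ?G w x))"
        by (intro integrable_mult_right Bochner_Integration.integrable_sum int)
    qed (unfold split, rule norm_sum_power_le[OF finW], use r in simp)
    also have "\<dots> = real (card W) ^ (2 * r) * (\<Sum>w\<in>W. LINT x|torus. ?G w x)"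
      using int by simp
    also have "\<dots> \<le> real (card W) ^ (2 * r) * (\<Sum>w\<in>W. real R * A ^ r)"
    proof (intro mult_left_mono sum_mono)
      fix w assume w: "w \<in> W"
      have "(LINT x|torus. ?G w x) \<le> real R * (\<Sum>k\<in>G w. (norm (c k))\<^sup>2) ^ r"
      proof (rule integral_trigsum_power_le)
        show "card {u \<in> {..<r} \<rightarrow>\<^sub>E G w. (\<lambda>j. \<Sum>i<r. u i j) = n} \<le> R" for n
          unfolding R_def
        proof (rule card_representations_le[of "G w" w "2 ^ r"])
          show "\<exists>a. k j = w j * int ((2 ^ r) ^ a)" if "k \<in> G w" for k j
            using that F(2) cl(2)[of k j] by (auto simp: G_def)
        qed (use w Wnz in auto)
      qed (use F in \<open>auto simp: G_def\<close>)
      also have "\<dots> \<le> real R * A ^ r"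
        unfolding A_def using F by (intro mult_left_mono power_mono sum_mono2 sum_nonneg) (auto simp: G_def)
      finally show "(LINT x|torus. ?G w x) \<le> real R * A ^ r" .
    qed auto
    also have "\<dots> = C * A ^ r" by (simp add: C_def)
    finally show ?thesis by (simp add: A_def)
  qed
  ultimately show ?thesis by blast
qed

section \<open>Norm comparison by duality\<close>

text \<open>Young's inequality for \<open>f / B\<close> and \<open>g / D\<close>, integrated.
  Positive upper bounds \<open>B\<close> and \<open>D\<close> stand in for the norms, so that norms
  equal to zero are no special case.\<close>

lemma nn_integral_holder:
  fixes f g :: "'a \<Rightarrow> real"
  assumes pq: "p > 1" "q > 1" "1 / p + 1 / q = (1::real)"
    and [measurable]: "f \<in> borel_measurable M" "g \<in> borel_measurable M"
    and f: "(\<integral>\<^sup>+x. ennreal (\<bar>f x\<bar> powr p) \<partial>M) \<le> ennreal (B powr p)" and B: "B > 0"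
    and g: "(\<integral>\<^sup>+x. ennreal (\<bar>g x\<bar> powr q) \<partial>M) \<le> ennreal (D powr q)" and D: "D > 0"
  shows "(\<integral>\<^sup>+x. ennreal \<bar>f x * g x\<bar> \<partial>M) \<le> ennreal (B * D)"
proof -
  define a b where "a = B * D / (p * B powr p)" and "b = B * D / (q * D powr q)"
  have ab: "a \<ge> 0" "b \<ge> 0" using B D pq by (auto simp: a_def b_def)
  have "\<bar>f x * g x\<bar> \<le> a * \<bar>f x\<bar> powr p + b * \<bar>g x\<bar> powr q" for x
  proof -
    have "(\<bar>f x\<bar> / B) * (\<bar>g x\<bar> / D) \<le> (\<bar>f x\<bar> / B) powr p / p + (\<bar>g x\<bar> / D) powr q / q"
      using pq B D by (intro Youngs_inequality) auto
    then have "B * D * ((\<bar>f x\<bar> / B) * (\<bar>g x\<bar> / D)) \<le> B * D * ((\<bar>f x\<bar> / B) powr p / p + (\<bar>g x\<bar> / D) powr q / q)"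
      using B D by (intro mult_left_mono) auto
    then show ?thesis
      using B D by (simp add: a_def b_def powr_divide abs_mult field_simps)
  qed
  then have "(\<integral>\<^sup>+x. ennreal \<bar>f x * g x\<bar> \<partial>M) \<le> (\<integral>\<^sup>+x. ennreal a * ennreal (\<bar>f x\<bar> powr p) + ennreal b * ennreal (\<bar>g x\<bar> powr q) \<partial>M)"
    using ab by (intro nn_integral_mono) (simp flip: ennreal_mult ennreal_plus)
  also have "\<dots> = ennreal a * (\<integral>\<^sup>+x. ennreal (\<bar>f x\<bar> powr p) \<partial>M) + ennreal b * (\<integral>\<^sup>+x. ennreal (\<bar>g x\<bar> powr q) \<partial>M)"
    by (simp add: nn_integral_add nn_integral_cmult)
  also have "\<dots> \<le> ennreal a * ennreal (B powr p) + ennreal b * ennreal (D powr q)"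
    by (intro add_mono mult_left_mono f g) auto
  also have "\<dots> = ennreal (a * B powr p + b * D powr q)"
    using ab by (simp add: ennreal_mult ennreal_plus)
  also have "a * B powr p + b * D powr q = B * D * (1 / p + 1 / q)"
    using B D pq by (simp add: a_def b_def field_simps)
  finally show ?thesis using pq by simp
qed

text \<open>On a space of finite measure \<open>1 + t powr q\<close> is an integrable majorant of
  \<open>t\<close>.\<close>

lemma integrable_torus_powr:
  fixes G :: "real^'m \<Rightarrow> complex"
  assumes "G \<in> borel_measurable torus" "q > 1" "(\<integral>\<^sup>+x. ennreal (norm (G x) powr q) \<partial>torus) < \<infinity>"
  shows "integrable torus G"
proof (rule Bochner_Integration.integrable_bound)
  have "integrable torus (\<lambda>x. norm (G x) powr q)"
    using assms by (intro integrableI_bounded) auto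
  then show "integrable torus (\<lambda>x. 1 + norm (G x) powr q)"
    by (intro Bochner_Integration.integrable_add integrable_torus_bounded[of "\<lambda>_. 1 :: real" 1]) auto
  have "norm (G x) \<le> 1 + norm (G x) powr q" for x
  proof (cases "norm (G x) \<le> 1")
    case False
    then have "norm (G x) powr 1 \<le> norm (G x) powr q" using assms by (intro powr_mono) auto
    then show ?thesis using False by simp
  qed (smt (verit) powr_ge_zero)
  then show "AE x in torus. norm (G x) \<le> norm (1 + norm (G x) powr q)"
    by (intro AE_I2) (smt (verit) real_norm_def)
qed fact

text \<open>The Hoelder conjugate of \<open>2 * r\<close>.\<close>

abbreviation conj_exp :: "nat \<Rightarrow> real" where
  "conj_exp r \<equiv> 2 * real r / (2 * real r - 1)"

text \<open>With \<open>A\<close> the \<open>l^2\<close> norm of the coefficients of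
  \<open>G\<close> on \<open>F\<close>, the polynomial with the conjugate coefficients on the
  reflected set has pairing \<open>A\<^sup>2\<close> with \<open>G\<close>. Hoelder and the moment
  bound for this polynomial estimate the pairing by a constant times \<open>B * A\<close>, and one
  factor \<open>A\<close> cancels.\<close>

lemma lacunary_lower_bound:
  assumes r: "r > 0"
  shows "\<exists>C>0. \<forall>(G :: real^'m \<Rightarrow> complex) B F. G \<in> borel_measurable torus \<longrightarrow> B > 0 \<longrightarrow>
     (\<integral>\<^sup>+x. ennreal (norm (G x) powr conj_exp r) \<partial>torus) \<le> ennreal (B powr conj_exp r) \<longrightarrow>
     finite F \<longrightarrow> F \<subseteq> lacunary \<longrightarrow> (\<Sum>k\<in>F. (norm (fcoef G k))\<^sup>2) \<le> (C * B)\<^sup>2"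
proof -
  obtain C where C: "C > 0" and bd: "\<And>F (c :: ('m \<Rightarrow> int) \<Rightarrow> complex). finite F \<Longrightarrow> F \<subseteq> lacunary \<Longrightarrow>
     (LINT x|torus. norm (trigsum c F x) ^ (2 * r)) \<le> C * (\<Sum>k\<in>F. (norm (c k))\<^sup>2) ^ r"
    using lacunary_polynomial_bound[OF r, where 'm = 'm] by blast
  define q where "q = conj_exp r"
  have q: "q > 1" "1 / q + 1 / (2 * real r) = 1" using r by (auto simp: q_def field_simps)
  define C' where "C' = C powr (1 / (2 * real r))"
  have C': "C' > 0" "C' ^ (2 * r) = C"
    using C r by (auto simp: C'_def powr_powr simp flip: powr_realpow)
  have "(\<Sum>k\<in>F. (norm (fcoef G k))\<^sup>2) \<le> (C' * B)\<^sup>2"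
    if G[measurable]: "G \<in> borel_measurable torus" and B: "B > 0"
      and GB: "(\<integral>\<^sup>+x. ennreal (norm (G x) powr q) \<partial>torus) \<le> ennreal (B powr q)"
      and F: "finite F" "F \<subseteq> lacunary" for G :: "real^'m \<Rightarrow> complex" and B F
  proof -
    define A where "A = sqrt (\<Sum>k\<in>F. (norm (fcoef G k))\<^sup>2)"
    have A: "A \<ge> 0" "A\<^sup>2 = (\<Sum>k\<in>F. (norm (fcoef G k))\<^sup>2)" by (auto simp: A_def sum_nonneg)
    have "A \<le> C' * B"
    proof (cases "A = 0")
      case False
      then have Apos: "A > 0" using A by simp
      define F' where "F' = (\<lambda>k j. - k j) ` F"
      have inj: "inj_on (\<lambda>k j. - (k j :: int)) F" by (auto simp: inj_on_def fun_eq_iff)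
      define c where "c k = cnj (fcoef G (\<lambda>j. - k j))" for k
      have F': "finite F'" "F' \<subseteq> lacunary" using F by (auto simp: F'_def lacunary_def)
      have int: "integrable torus G"
        using GB q by (intro integrable_torus_powr[of _ q]) (auto simp: le_less_trans)
      have sums: "(\<Sum>k\<in>F'. (norm (c k))\<^sup>2) = A\<^sup>2"
        unfolding A(2) F'_def using inj by (simp add: sum.reindex c_def)
      have "(\<integral>x. G x * trigsum c F' x \<partial>torus) = (\<Sum>k\<in>F'. c k * fcoef G (\<lambda>j. - k j))"
        using has_bochner_integral_trigsum_mult[OF int] by (simp add: has_bochner_integral_iff)
      also have "\<dots> = (\<Sum>k\<in>F'. of_real ((norm (c k))\<^sup>2))"
        unfolding complex_norm_square c_def by simp
      also have "\<dots> = of_real (A\<^sup>2)" by (simp only: sums of_real_sum[symmetric])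
      finally have "A\<^sup>2 = norm (\<integral>x. G x * trigsum c F' x \<partial>torus)" by (simp add: norm_power)
      then have "ennreal (A\<^sup>2) = ennreal (norm (\<integral>x. G x * trigsum c F' x \<partial>torus))" by simp
      also have "\<dots> \<le> (\<integral>\<^sup>+x. ennreal (norm (G x * trigsum c F' x)) \<partial>torus)"
        using has_bochner_integral_trigsum_mult[OF int, of c F']
        by (intro integral_norm_bound_ennreal) (simp add: has_bochner_integral_iff)
      also have "\<dots> = (\<integral>\<^sup>+x. ennreal \<bar>norm (G x) * norm (trigsum c F' x)\<bar> \<partial>torus)"
        by (simp add: norm_mult)
      also have "\<dots> \<le> ennreal (B * (C' * A))"
      proof (rule nn_integral_holder[where p = q and q = "2 * real r"])
        have "integrable torus (\<lambda>x. norm (trigsum c F' x) ^ (2 * r))"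
          by (rule integrable_torus_bounded[of _ "(\<Sum>k\<in>F'. norm (c k)) ^ (2 * r)"])
            (auto simp: norm_power intro!: power_mono norm_trigsum_le)
        then have "(\<integral>\<^sup>+x. ennreal (norm (trigsum c F' x) ^ (2 * r)) \<partial>torus) =
            ennreal (LINT x|torus. norm (trigsum c F' x) ^ (2 * r))"
          by (intro nn_integral_eq_integral) auto
        also have "\<dots> \<le> ennreal (C * (\<Sum>k\<in>F'. (norm (c k))\<^sup>2) ^ r)"
          by (intro ennreal_leI bd F')
        also have "C * (\<Sum>k\<in>F'. (norm (c k))\<^sup>2) ^ r = (C' * A) ^ (2 * r)"
          by (simp add: sums power_mult_distrib C'(2) flip: power_mult)
        also have "\<dots> = (C' * A) powr (2 * real r)"
          using C' Apos by (simp flip: powr_realpow)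
        also have "(\<integral>\<^sup>+x. ennreal (norm (trigsum c F' x) ^ (2 * r)) \<partial>torus) =
            (\<integral>\<^sup>+x. ennreal (\<bar>norm (trigsum c F' x)\<bar> powr (2 * real r)) \<partial>torus)"
        proof (intro nn_integral_cong arg_cong[of _ _ ennreal])
          fix x show "norm (trigsum c F' x) ^ (2 * r) = \<bar>norm (trigsum c F' x)\<bar> powr (2 * real r)"
            using r powr_realpow'[of "norm (trigsum c F' x)" "2 * r"] by simp
        qed
        finally show "(\<integral>\<^sup>+x. ennreal (\<bar>norm (trigsum c F' x)\<bar> powr (2 * real r)) \<partial>torus)
            \<le> ennreal ((C' * A) powr (2 * real r))" .
      qed (use q r B C' Apos GB in auto)
      finally have "A * A \<le> (C' * B) * A"
        using B C' Apos by (simp add: power2_eq_square mult_ac)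
      then show ?thesis using Apos by simp
    qed (use B C' in auto)
    then show ?thesis using A by (metis power_mono)
  qed
  then show ?thesis using C' unfolding q_def by blast
qed

section \<open>Density of trigonometric polynomials\<close>

definition trigpolys :: "(real^'m \<Rightarrow> complex) set" where
  "trigpolys = {P. \<exists>c F. finite F \<and> P = trigsum c F}"

lemma trigpolys_echar: "(\<lambda>x. c * echar k x) \<in> trigpolys"
  unfolding trigpolys_def by (auto intro!: exI[of _ "\<lambda>_. c"] exI[of _ "{k}"] simp: trigsum_def)

lemma trigpolys_const: "(\<lambda>x. c) \<in> trigpolys"
  using trigpolys_echar[of c "\<lambda>_. 0"] by simp

lemma trigpolys_add:
  assumes "P \<in> trigpolys" "Q \<in> trigpolys"
  shows "(\<lambda>x. P x + Q x) \<in> trigpolys"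
proof -
  obtain c F d G where *: "finite F" "P = trigsum c F" "finite G" "Q = trigsum d G"
    using assms unfolding trigpolys_def by blast
  have "(\<lambda>x. P x + Q x) = trigsum (\<lambda>k. (if k \<in> F then c k else 0) + (if k \<in> G then d k else 0)) (F \<union> G)"
  proof
    fix x
    have "trigsum c F x = (\<Sum>k\<in>F \<union> G. (if k \<in> F then c k else 0) * echar k x)"
      unfolding trigsum_def using * by (intro sum.mono_neutral_cong_left) auto
    moreover have "trigsum d G x = (\<Sum>k\<in>F \<union> G. (if k \<in> G then d k else 0) * echar k x)"
      unfolding trigsum_def using * by (intro sum.mono_neutral_cong_left) auto
    ultimately show "P x + Q x = trigsum (\<lambda>k. (if k \<in> F then c k else 0) + (if k \<in> G then d k else 0)) (F \<union> G) x"
      unfolding * by (simp only: trigsum_def distrib_right sum.distrib)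
  qed
  then show ?thesis using * unfolding trigpolys_def by blast
qed

lemma trigpolys_sum: "(\<And>i. i \<in> I \<Longrightarrow> P i \<in> trigpolys) \<Longrightarrow> (\<lambda>x. \<Sum>i\<in>I. P i x) \<in> trigpolys"
  by (induction I rule: infinite_finite_induct) (auto intro: trigpolys_add trigpolys_const)

lemma trigpolys_mult:
  assumes "P \<in> trigpolys" "Q \<in> trigpolys"
  shows "(\<lambda>x. P x * Q x) \<in> trigpolys"
proof -
  obtain c F d G where *: "finite F" "P = trigsum c F" "finite G" "Q = trigsum d G"
    using assms unfolding trigpolys_def by blast
  have "(\<lambda>x. P x * Q x) = (\<lambda>x. \<Sum>k\<in>F. \<Sum>l\<in>G. (c k * d l) * echar (\<lambda>j. k j + l j) x)"
    by (simp add: * trigsum_def sum_product echar_add mult_ac)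
  also have "\<dots> \<in> trigpolys"
    by (intro trigpolys_sum trigpolys_echar)
  finally show ?thesis .
qed

definition torus_embedding :: "real^'m \<Rightarrow> complex^'m" where
  "torus_embedding x = (\<chi> j. cis (2 * pi * x $ j))"

lemma continuous_torus_embedding: "continuous_on S torus_embedding"
  unfolding torus_embedding_def by (intro continuous_intros)

lemma inj_on_torus_embedding: "inj_on torus_embedding unit_cell"
proof (rule inj_onI)
  fix x y :: "real^'m" assume xy: "x \<in> unit_cell" "y \<in> unit_cell" "torus_embedding x = torus_embedding y"
  have "x $ j = y $ j" for j
  proof -
    have "cis (2 * pi * x $ j) = cis (2 * pi * y $ j)"
      using xy(3) by (simp add: torus_embedding_def vec_eq_iff)
    then have "cis (2 * pi * x $ j - 2 * pi * y $ j) = 1"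
      by (simp flip: cis_divide)
    then have "cos (2 * pi * x $ j - 2 * pi * y $ j) = 1"
      by (simp add: complex_eq_iff)
    then obtain n :: int where "2 * pi * x $ j - 2 * pi * y $ j = of_int n * 2 * pi"
      using cos_one_2pi_int by blast
    then have "2 * pi * (x $ j - y $ j) = 2 * pi * of_int n" by (simp add: algebra_simps)
    then have n: "x $ j - y $ j = of_int n" by simp
    moreover have "\<bar>x $ j - y $ j\<bar> < 1"
      using xy(1,2) by (auto simp: unit_cell_def abs_less_iff) (smt (verit))+
    ultimately have "n = 0" by linarith
    then show ?thesis using n by simp
  qed
  then show "x = y" by (simp add: vec_eq_iff)
qed

text \<open>Stone--Weierstrass will supply polynomials in the real and imaginary parts of the
  coordinates of the embedded torus. These parts are cosines and sines, so the pull-back to the cell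
  is a trigonometric polynomial.\<close>

lemma trigpolys_real_polynomial:
  assumes "real_polynomial_function p"
  shows "(\<lambda>x :: real^'m. of_real (p (torus_embedding x))) \<in> trigpolys"
  using assms
proof induction
  case (linear f)
  interpret f: bounded_linear f by fact
  have dec: "z = (\<Sum>j\<in>UNIV. Re (z $ j) *\<^sub>R axis j 1 + Im (z $ j) *\<^sub>R axis j \<i>)" for z :: "complex^'m"
  proof -
    have "(\<Sum>j\<in>UNIV. Re (z $ j) *\<^sub>R axis j 1 + Im (z $ j) *\<^sub>R axis j \<i>) $ i
        = (\<Sum>j\<in>UNIV. if i = j then z $ j else 0)" for i
      unfolding sum_component by (intro sum.cong) (auto simp: axis_def complex_eq_iff)
    then show ?thesis by (simp add: vec_eq_iff)
  qed
  define d where "d j = (\<lambda>i. if i = j then 1 else 0 :: int)" for j :: 'm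
  have E: "cis (2 * pi * x $ j) = echar (d j) x" for j and x :: "real^'m"
  proof -
    have "(\<Sum>i\<in>UNIV. of_int (d j i) * x $ i) = (\<Sum>i\<in>UNIV. if i = j then x $ i else 0)"
      by (intro sum.cong) (auto simp: d_def)
    then show ?thesis by (simp add: echar_def)
  qed
  have re: "of_real (Re (echar k x)) = 1 / 2 * echar k x + 1 / 2 * echar (\<lambda>j. - k j) x"
    and im: "of_real (Im (echar k x)) = (- \<i> / 2) * echar k x + (\<i> / 2) * echar (\<lambda>j. - k j) x"
    for k and x :: "real^'m"
    unfolding cnj_echar[symmetric] by (simp_all add: complex_eq_iff)
  have "f (torus_embedding x) = (\<Sum>j\<in>UNIV. Re (echar (d j) x) * f (axis j 1) + Im (echar (d j) x) * f (axis j \<i>))"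
    for x :: "real^'m"
    by (subst dec) (simp only: f.sum f.add f.scaleR torus_embedding_def E vec_lambda_beta real_scaleR_def)
  then have "(\<lambda>x :: real^'m. of_real (f (torus_embedding x))) = (\<lambda>x. \<Sum>j\<in>UNIV.
      (1 / 2 * echar (d j) x + 1 / 2 * echar (\<lambda>i. - d j i) x) * of_real (f (axis j 1))
      + ((- \<i> / 2) * echar (d j) x + (\<i> / 2) * echar (\<lambda>i. - d j i) x) * of_real (f (axis j \<i>)))"
    by (simp only: of_real_sum of_real_add of_real_mult re im)
  also have "\<dots> \<in> trigpolys"
    by (intro trigpolys_sum trigpolys_add trigpolys_mult trigpolys_echar trigpolys_const)
  finally show ?case .
next
  case (const c)
  show ?case by (rule trigpolys_const)
next
  case (add f g)
  then show ?case by (simp add: trigpolys_add)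
next
  case (mult f g)
  then show ?case by (simp add: trigpolys_mult)
qed

text \<open>On compact subsets of the open cell the torus embedding is a homeomorphism onto its image, so
  Lusin-type approximants of \<open>h\<close> extend to the torus by Tietze and are approximated there by
  Stone--Weierstrass.\<close>

lemma trigpolys_dense:
  fixes h :: "real^'m \<Rightarrow> real"
  assumes h: "h \<in> borel_measurable torus" and M: "\<And>x. \<bar>h x\<bar> \<le> M"
  shows "\<exists>P. (\<forall>n. P n \<in> trigpolys) \<and> (\<forall>n. \<forall>x\<in>unit_cell. norm (P n x) \<le> M + 1) \<and>
    (AE x in torus. (\<lambda>n. P n x) \<longlonglongrightarrow> of_real (h x))"
proof -
  have M0: "M \<ge> 0" using M[of 0] by linarith
  have "h measurable_on unit_cell" using h by (simp add: measurable_on_iff_borel_measurable)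
  then obtain N g where N: "negligible N" and g: "\<And>n. continuous_on UNIV (g n)"
    and lim: "\<And>x. x \<notin> N \<Longrightarrow> (\<lambda>n. g n x) \<longlonglongrightarrow> (if x \<in> unit_cell then h x else 0)"
    unfolding measurable_on_def by blast
  \<comment> \<open>The continuous functions \<open>g n\<close> come without a bound. Clamping them
    to \<open>[- M, M]\<close> does not change their limit \<open>h\<close> and provides the bound
    that the Tietze extension preserves.\<close>
  define cl where "cl y = max (- M) (min M y)" for y
  have cl: "continuous_on S cl" "\<bar>cl y\<bar> \<le> M" for S y
    using M0 unfolding cl_def
    by (auto intro!: continuous_on_max continuous_on_min continuous_on_const continuous_on_id)
  \<comment> \<open>These boxes exhaust the open cell (\<open>K 0\<close> is empty). The faces of
    the cell, where the inverse of the embedding jumps, are left to a null set.\<close>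
  define K :: "nat \<Rightarrow> (real^'m) set" where
    "K n = cbox (\<chi> j. inverse (real (Suc n))) (\<chi> j. 1 - inverse (real (Suc n)))" for n
  have K: "K n \<subseteq> unit_cell" for n
  proof
    fix x assume x: "x \<in> K n"
    have "0 < inverse (real (Suc n))" by simp
    with x show "x \<in> unit_cell"
      unfolding K_def mem_box_cart unit_cell_def mem_Collect_eq vec_lambda_beta
      by (metis add.commute diff_add_cancel less_add_same_cancel1 less_imp_le order.strict_trans1 order_trans)
  qed
  have compK: "compact (K n)" for n by (simp add: K_def)
  let ?E = "torus_embedding :: real^'m \<Rightarrow> complex^'m"
  have "\<exists>P\<in>trigpolys. (\<forall>x\<in>unit_cell. norm (P x) \<le> M + 1) \<and>
     (\<forall>x\<in>K n. norm (P x - of_real (cl (g n x))) \<le> inverse (real (Suc n)))" for n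
  proof -
    have injK: "inj_on ?E (K n)" by (rule inj_on_subset[OF inj_on_torus_embedding K])
    define u where "u = inv_into (K n) ?E"
    have u: "u (?E x) = x" if "x \<in> K n" for x using that injK by (simp add: u_def)
    have contu: "continuous_on (?E ` K n) u"
      by (rule continuous_on_inv[OF continuous_torus_embedding compK]) (simp add: u)
    have "continuous_on (?E ` K n) (\<lambda>z. cl (g n (u z)))"
      by (intro continuous_on_compose2[OF cl(1)[of UNIV]] continuous_on_compose2[OF g] contu) auto
    moreover have "closedin (top_of_set UNIV) (?E ` K n)"
      using compK by (simp add: compact_imp_closed compact_continuous_image continuous_torus_embedding)
    ultimately obtain \<phi> where \<phi>: "continuous_on UNIV \<phi>" "\<And>z. z \<in> ?E ` K n \<Longrightarrow> \<phi> z = cl (g n (u z))"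
      "\<And>z. \<bar>\<phi> z\<bar> \<le> M"
      using M0 cl(2) by (rule_tac Tietze[of "?E ` K n" "\<lambda>z. cl (g n (u z))" UNIV M]) auto
    have "compact (?E ` cbox 0 1)" by (intro compact_continuous_image continuous_torus_embedding compact_cbox)
    then obtain p where p: "real_polynomial_function p"
      "\<And>z. z \<in> ?E ` cbox 0 1 \<Longrightarrow> \<bar>\<phi> z - p z\<bar> < inverse (real (Suc n))"
      using Stone_Weierstrass_real_polynomial_function[of "?E ` cbox 0 1" \<phi> "inverse (real (Suc n))"]
        continuous_on_subset[OF \<phi>(1)] by auto
    have cell: "unit_cell \<subseteq> cbox 0 (1 :: real^'m)"
      by (auto simp: unit_cell_def mem_box_cart less_imp_le)
    have p': "\<bar>\<phi> (?E x) - p (?E x)\<bar> < inverse (real (Suc n))" if "x \<in> unit_cell" for x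
      using that cell by (intro p(2)) auto
    show ?thesis
    proof (intro bexI[of _ "\<lambda>x. of_real (p (?E x))"] conjI ballI)
      fix x :: "real^'m" assume "x \<in> unit_cell"
      from p'[OF this] \<phi>(3)[of "?E x"] have "\<bar>p (?E x)\<bar> \<le> M + inverse (real (Suc n))" by linarith
      also have "\<dots> \<le> M + 1" by (simp add: field_simps)
      finally show "norm (complex_of_real (p (?E x))) \<le> M + 1" by simp
    next
      fix x assume x: "x \<in> K n"
      have "\<phi> (?E x) = cl (g n x)" using x by (simp add: \<phi>(2) u)
      with p'[of x] x K[of n] have "\<bar>p (?E x) - cl (g n x)\<bar> \<le> inverse (real (Suc n))"
        by (auto simp: abs_minus_commute less_imp_le)
      then show "norm (complex_of_real (p (?E x)) - of_real (cl (g n x))) \<le> inverse (real (Suc n))"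
        by (simp only: of_real_diff[symmetric] norm_of_real)
    qed (rule trigpolys_real_polynomial[OF p(1)])
  qed
  then obtain P where P: "\<And>n. P n \<in> trigpolys" "\<And>n x. x \<in> unit_cell \<Longrightarrow> norm (P n x) \<le> M + 1"
    "\<And>n x. x \<in> K n \<Longrightarrow> norm (P n x - of_real (cl (g n x))) \<le> inverse (real (Suc n))"
    by metis
  have conv: "(\<lambda>n. P n x) \<longlonglongrightarrow> of_real (h x)"
    if x: "x \<in> unit_cell" "x \<notin> N" "\<And>j. x $ j \<noteq> 0" for x
  proof -
    have "eventually (\<lambda>n. inverse (real (Suc n)) < min (x $ j) (1 - x $ j)) sequentially" for j
    proof (rule order_tendstoD(2)[OF LIMSEQ_inverse_real_of_nat])
      have "0 \<le> x $ j" "x $ j < 1" using x(1) by (auto simp: unit_cell_def)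
      then show "0 < min (x $ j) (1 - x $ j)" using x(3)[of j] by linarith
    qed
    then have "eventually (\<lambda>n. \<forall>j. inverse (real (Suc n)) < min (x $ j) (1 - x $ j)) sequentially"
      by (intro eventually_all_finite) auto
    then have ev: "eventually (\<lambda>n. x \<in> K n) sequentially"
      by eventually_elim (simp add: K_def mem_box_cart, smt (verit))
    have "(\<lambda>n. cl (g n x)) \<longlonglongrightarrow> cl (h x)"
      using lim[OF x(2)] x(1) unfolding cl_def by (auto intro!: tendsto_intros)
    also have "cl (h x) = h x" using M[of x] by (auto simp: cl_def)
    finally have 1: "(\<lambda>n. of_real (cl (g n x)) :: complex) \<longlonglongrightarrow> of_real (h x)" by (intro tendsto_of_real)
    have 2: "(\<lambda>n. P n x - of_real (cl (g n x))) \<longlonglongrightarrow> 0"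
      by (rule Lim_null_comparison[OF eventually_mono[OF ev] LIMSEQ_inverse_real_of_nat]) (rule P(3))
    show ?thesis using tendsto_add[OF 2 1] by simp
  qed
  have "negligible (N \<union> (\<Union>j. {x. x $ j = 0}))"
    using N by (intro negligible_Un negligible_Union) (auto simp: negligible_standard_hyperplane_cart)
  then have "AE x in lebesgue. x \<notin> N \<union> (\<Union>j. {x. x $ j = 0})"
    unfolding negligible_iff_null_sets by (rule AE_not_in)
  then have "AE x in lebesgue. x \<in> unit_cell \<longrightarrow> (\<lambda>n. P n x) \<longlonglongrightarrow> of_real (h x)"
    by eventually_elim (auto intro: conv)
  then have "AE x in torus. (\<lambda>n. P n x) \<longlonglongrightarrow> of_real (h x)"
    by (subst AE_restrict_space_iff) auto
  with P show ?thesis by blast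
qed

text \<open>Passes from polynomials to bounded measurable test functions, by dominated convergence
  along uniformly bounded polynomials tending to \<open>h\<close> almost everywhere. The inequality
  \<open>hB\<close> is strict so that the approximants eventually satisfy it too and
  \<open>bd\<close> applies to them.\<close>

lemma lacunary_duality:
  fixes G :: "real^'m \<Rightarrow> complex" and h :: "real^'m \<Rightarrow> real"
  assumes G: "integrable torus G" and h: "h \<in> borel_measurable torus" "\<And>x. \<bar>h x\<bar> \<le> M"
    and q: "q > 0" and S: "S \<ge> 0"
    and hB: "(LINT x|torus. \<bar>h x\<bar> powr q) < B powr q"
    and bd: "\<And>P. P \<in> trigpolys \<Longrightarrow> (\<integral>\<^sup>+x. ennreal (norm (P x) powr q) \<partial>torus) \<le> ennreal (B powr q)
       \<Longrightarrow> norm (LINT x|torus. G x * P x) \<le> S"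
  shows "norm (LINT x|torus. G x * of_real (h x)) \<le> S"
proof -
  obtain P where P: "\<And>n. P n \<in> trigpolys" "\<And>n x. x \<in> unit_cell \<Longrightarrow> norm (P n x) \<le> M + 1"
    "AE x in torus. (\<lambda>n. P n x) \<longlonglongrightarrow> of_real (h x)"
    using trigpolys_dense[OF h] by blast
  have [measurable]: "P n \<in> borel_measurable torus" for n
    using P(1)[of n] by (auto simp: trigpolys_def)
  have M0: "M \<ge> 0" using h(2)[of 0] by linarith
  note [measurable] = h(1) borel_measurable_integrable[OF G]
  have AEb: "AE x in torus. norm (P n x) \<le> M + 1" for n
    by (intro AE_I2) (use P(2) in \<open>simp add: space_restrict_space\<close>)
  have "(\<lambda>n. LINT x|torus. norm (P n x) powr q) \<longlonglongrightarrow> (LINT x|torus. \<bar>h x\<bar> powr q)"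
  proof (rule integral_dominated_convergence)
    show "integrable torus (\<lambda>x :: real^'m. (M + 1) powr q)"
      by (rule integrable_torus_bounded[of _ "(M + 1) powr q"]) auto
    show "AE x in torus. (\<lambda>n. norm (P n x) powr q) \<longlonglongrightarrow> \<bar>h x\<bar> powr q"
      using P(3)
    proof eventually_elim
      case (elim x)
      have "(\<lambda>n. norm (P n x)) \<longlonglongrightarrow> \<bar>h x\<bar>" using tendsto_norm[OF elim] by simp
      then show ?case using q by (intro tendsto_powr2) auto
    qed
    show "AE x in torus. norm (norm (P n x) powr q) \<le> (M + 1) powr q" for n
      using AEb[of n] by eventually_elim (use q in \<open>auto intro: powr_mono2\<close>)
  qed auto
  then have ev: "eventually (\<lambda>n. (LINT x|torus. norm (P n x) powr q) < B powr q) sequentially"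
    using hB by (rule order_tendstoD)
  have lim: "(\<lambda>n. LINT x|torus. G x * P n x) \<longlonglongrightarrow> (LINT x|torus. G x * of_real (h x))"
  proof (rule integral_dominated_convergence)
    show "integrable torus (\<lambda>x. norm (G x) * (M + 1))" using G by auto
    show "AE x in torus. (\<lambda>n. G x * P n x) \<longlonglongrightarrow> G x * of_real (h x)"
      using P(3) by eventually_elim (intro tendsto_intros)
    show "AE x in torus. norm (G x * P n x) \<le> norm (G x) * (M + 1)" for n
      using AEb[of n] by eventually_elim (auto simp: norm_mult intro: mult_left_mono)
  qed auto
  show ?thesis
  proof (rule tendsto_upperbound[OF tendsto_norm[OF lim]])
    show "eventually (\<lambda>n. norm (LINT x|torus. G x * P n x) \<le> S) sequentially"
      using ev
    proof eventually_elim
      case (elim n)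
      have "integrable torus (\<lambda>x. norm (P n x) powr q)"
      proof (rule finite_measure.integrable_const_bound[OF finite_measure_torus])
        show "AE x in torus. norm (norm (P n x) powr q) \<le> (M + 1) powr q"
          using AEb[of n] by eventually_elim (use q in \<open>auto intro: powr_mono2\<close>)
      qed auto
      then have "(\<integral>\<^sup>+x. ennreal (norm (P n x) powr q) \<partial>torus) = ennreal (LINT x|torus. norm (P n x) powr q)"
        by (intro nn_integral_eq_integral) auto
      also have "\<dots> \<le> ennreal (B powr q)" using elim by (intro ennreal_leI) simp
      finally show ?case by (intro bd P)
    qed
  qed auto
qed

text \<open>Dual to the lower bound: test \<open>G\<close> against \<open>sgn G * min \<bar>G\<bar> K ^ (2 * r - 1)\<close>.\<close>

lemma lacunary_upper_bound:
  assumes r: "r > 0"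
  shows "\<exists>C>0. \<forall>(G :: real^'m \<Rightarrow> real) A. integrable torus G \<longrightarrow>
     (\<forall>k. k \<notin> lacunary \<longrightarrow> fcoef (\<lambda>x. of_real (G x)) k = 0) \<longrightarrow> A \<ge> 0 \<longrightarrow>
     (\<forall>F. finite F \<longrightarrow> F \<subseteq> lacunary \<longrightarrow> (\<Sum>k\<in>F. (norm (fcoef (\<lambda>x. of_real (G x)) k))\<^sup>2) \<le> A\<^sup>2) \<longrightarrow>
     (\<integral>\<^sup>+x. ennreal (\<bar>G x\<bar> ^ (2 * r)) \<partial>torus) \<le> ennreal ((C * A) ^ (2 * r))"
proof -
  define q where "q = conj_exp r"
  have q: "q > 1" "(2 * real r - 1) * q = 2 * real r" using r by (auto simp: q_def field_simps)
  obtain C where C: "C > 0" and low: "\<And>(P :: real^'m \<Rightarrow> complex) B F. P \<in> borel_measurable torus \<Longrightarrow> B > 0 \<Longrightarrow>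
     (\<integral>\<^sup>+x. ennreal (norm (P x) powr q) \<partial>torus) \<le> ennreal (B powr q) \<Longrightarrow>
     finite F \<Longrightarrow> F \<subseteq> lacunary \<Longrightarrow> (\<Sum>k\<in>F. (norm (fcoef P k))\<^sup>2) \<le> (C * B)\<^sup>2"
    using lacunary_lower_bound[OF r, where 'm = 'm] unfolding q_def by blast
  have "(\<integral>\<^sup>+x. ennreal (\<bar>G x\<bar> ^ (2 * r)) \<partial>torus) \<le> ennreal ((C * A) ^ (2 * r))"
    if G: "integrable torus G" and spec: "\<And>k. k \<notin> lacunary \<Longrightarrow> fcoef (\<lambda>x. of_real (G x)) k = 0"
      and A: "A \<ge> 0"
      and l2: "\<And>F. finite F \<Longrightarrow> F \<subseteq> lacunary \<Longrightarrow> (\<Sum>k\<in>F. (norm (fcoef (\<lambda>x. of_real (G x)) k))\<^sup>2) \<le> A\<^sup>2"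
    for G :: "real^'m \<Rightarrow> real" and A
  proof -
    let ?m = "\<lambda>x K. min \<bar>G x\<bar> (real K)"
    define H where "H x = complex_of_real (G x)" for x
    have H: "integrable torus H" using G unfolding H_def by (rule integrable_of_real)
    note [measurable] = borel_measurable_integrable[OF G]
    \<comment> \<open>Only the lacunary frequencies of \<open>P\<close> meet the spectrum of
      \<open>H\<close>. Cauchy--Schwarz over these uses \<open>l2\<close> for \<open>H\<close> and,
      for the coefficients of \<open>P\<close>, the lower bound applied to \<open>P\<close>
      itself.\<close>
    have poly: "norm (LINT x|torus. H x * P x) \<le> A * (C * B)"
      if P: "P \<in> trigpolys" and B: "B > 0"
        and PB: "(\<integral>\<^sup>+x. ennreal (norm (P x) powr q) \<partial>torus) \<le> ennreal (B powr q)" for P B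
    proof -
      obtain c F where F: "finite F" "P = trigsum c F" using P by (auto simp: trigpolys_def)
      define F' where "F' = F \<inter> lacunary"
      have F': "finite F'" "F' \<subseteq> lacunary" "F' \<subseteq> F" using F by (auto simp: F'_def)
      have neg: "(\<lambda>j. - k j) \<in> lacunary \<longleftrightarrow> k \<in> lacunary" for k :: "'m \<Rightarrow> int"
        by (simp add: lacunary_def)
      have "(LINT x|torus. H x * P x) = (\<Sum>k\<in>F. c k * fcoef H (\<lambda>j. - k j))"
        using has_bochner_integral_trigsum_mult[OF H, of c F] F by (simp add: has_bochner_integral_iff)
      also have "\<dots> = (\<Sum>k\<in>F'. c k * fcoef H (\<lambda>j. - k j))"
        using F spec neg unfolding F'_def H_def by (intro sum.mono_neutral_right) auto
      finally have "norm (LINT x|torus. H x * P x) \<le> (\<Sum>k\<in>F'. norm (c k) * norm (fcoef H (\<lambda>j. - k j)))"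
        by (simp add: order_trans[OF norm_sum] norm_mult)
      also have "\<dots> = (\<Sum>k\<in>F'. \<bar>norm (c k)\<bar> * \<bar>norm (fcoef H (\<lambda>j. - k j))\<bar>)" by simp
      also have "\<dots> \<le> L2_set (\<lambda>k. norm (c k)) F' * L2_set (\<lambda>k. norm (fcoef H (\<lambda>j. - k j))) F'"
        by (rule L2_set_mult_ineq)
      also have "\<dots> \<le> (C * B) * A"
      proof (rule mult_mono)
        have "(\<Sum>k\<in>F'. (norm (fcoef P k))\<^sup>2) \<le> (C * B)\<^sup>2"
          using F B PB F' by (intro low) auto
        also have "(\<Sum>k\<in>F'. (norm (fcoef P k))\<^sup>2) = (\<Sum>k\<in>F'. (norm (c k))\<^sup>2)"
          using F F' by (intro sum.cong) (auto simp: fcoef_trigsum)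
        finally show "L2_set (\<lambda>k. norm (c k)) F' \<le> C * B"
          unfolding L2_set_def using C B by (intro real_le_lsqrt) auto
        have "inj_on (\<lambda>k j. - (k j :: int)) F'" by (auto simp: inj_on_def fun_eq_iff)
        then have "(\<Sum>k\<in>F'. (norm (fcoef H (\<lambda>j. - k j)))\<^sup>2) = (\<Sum>k\<in>(\<lambda>k j. - k j) ` F'. (norm (fcoef H k))\<^sup>2)"
          by (simp add: sum.reindex)
        also have "\<dots> \<le> A\<^sup>2" unfolding H_def using F' neg by (intro l2) auto
        finally show "L2_set (\<lambda>k. norm (fcoef H (\<lambda>j. - k j))) F' \<le> A"
          unfolding L2_set_def using A by (intro real_le_lsqrt) auto
      qed (use C B in auto)
      finally show ?thesis by (simp add: mult_ac)
    qed
    \<comment> \<open>Truncation at height \<open>K\<close> makes the test function bounded and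
      \<open>J\<close> finite, so that a power of \<open>J\<close> may be cancelled; the result is
      uniform in \<open>K\<close>.\<close>
    have trunc: "(\<integral>\<^sup>+x. ennreal (?m x K ^ (2 * r)) \<partial>torus) \<le> ennreal ((C * A) ^ (2 * r))" for K :: nat
    proof -
      define h where "h x = sgn (G x) * ?m x K ^ (2 * r - 1)" for x
      define J where "J = (LINT x|torus. ?m x K ^ (2 * r))"
      have meas: "h \<in> borel_measurable torus" unfolding h_def by measurable
      have hK: "\<bar>h x\<bar> \<le> real K ^ (2 * r - 1)" for x
        by (auto simp: h_def abs_mult sgn_if intro: power_mono)
      have intJ: "integrable torus (\<lambda>x. ?m x K ^ (2 * r))"
        by (rule integrable_torus_bounded[of _ "real K ^ (2 * r)"]) (auto intro: power_mono)
      have J0: "J \<ge> 0" unfolding J_def by (intro integral_nonneg_AE AE_I2) auto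
      have hq: "\<bar>h x\<bar> powr q = ?m x K ^ (2 * r)" for x
      proof (cases "?m x K = 0")
        case True
        then show ?thesis using r q by (auto simp: h_def power_0_left)
      next
        case False
        then have pos: "?m x K > 0" "G x \<noteq> 0" by auto
        then have "\<bar>h x\<bar> = ?m x K powr (2 * real r - 1)"
          using r by (simp add: h_def abs_mult abs_sgn_eq powr_realpow[symmetric] of_nat_diff)
        then have "\<bar>h x\<bar> powr q = ?m x K powr (2 * real r)"
          using q(2) by (simp add: powr_powr)
        then show ?thesis using pos powr_realpow[of "?m x K" "2 * r"] by simp
      qed
      have Gh: "?m x K ^ (2 * r) \<le> G x * h x" for x
      proof -
        have "?m x K ^ (2 * r) = ?m x K * ?m x K ^ (2 * r - 1)"
          using r by (cases "2 * r") auto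
        also have "\<dots> \<le> \<bar>G x\<bar> * ?m x K ^ (2 * r - 1)" by (intro mult_right_mono) auto
        also have "\<dots> = G x * h x" by (auto simp: h_def sgn_if)
        finally show ?thesis .
      qed
      have key: "J \<le> A * C * B" if B: "B > J powr (1 / q)" for B
      proof -
        have B0: "B > 0" using B powr_ge_zero[of J "1 / q"] by linarith
        have "J = (J powr (1 / q)) powr q" using q J0 by (simp add: powr_powr)
        also have "\<dots> < B powr q" using B q by (intro powr_less_mono2) auto
        finally have JB: "J < B powr q" .
        have "norm (LINT x|torus. H x * of_real (h x)) \<le> A * (C * B)"
        proof (rule lacunary_duality[OF H meas hK])
          show "(LINT x|torus. \<bar>h x\<bar> powr q) < B powr q" using JB by (simp add: hq J_def)
        qed (use q A C B0 poly in auto)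
        also have "(LINT x|torus. H x * of_real (h x)) = of_real (LINT x|torus. G x * h x)"
          by (simp add: H_def flip: of_real_mult)
        finally have 1: "(LINT x|torus. G x * h x) \<le> A * C * B" by (simp add: mult_ac)
        have "integrable torus (\<lambda>x. G x * h x)"
        proof (rule Bochner_Integration.integrable_bound)
          show "integrable torus (\<lambda>x. G x * real K ^ (2 * r - 1))" using G by auto
          show "AE x in torus. norm (G x * h x) \<le> norm (G x * real K ^ (2 * r - 1))"
            using hK by (intro AE_I2) (auto simp: abs_mult intro: mult_left_mono)
        qed (use meas in measurable)
        then have "J \<le> (LINT x|torus. G x * h x)"
          unfolding J_def by (intro integral_mono[OF intJ] Gh)
        with 1 show ?thesis by simp
      qed
      \<comment> \<open>The \<open>L_q\<close> norm of \<open>h\<close> is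
        \<open>J powr (1 / q)\<close>, and \<open>key\<close> holds for every larger
        \<open>B\<close>. Since \<open>1 - 1 / q = 1 / (2 * r)\<close>, cancelling leaves
        \<open>J powr (1 / (2 * r)) \<le> A * C\<close>.\<close>
      have "J \<le> A * C * J powr (1 / q)"
      proof (rule tendsto_lowerbound)
        show "((\<lambda>B. A * C * B) \<longlongrightarrow> A * C * J powr (1 / q)) (at_right (J powr (1 / q)))"
          by (intro tendsto_intros)
        show "\<forall>\<^sub>F B in at_right (J powr (1 / q)). J \<le> A * C * B"
          using eventually_at_right_less by eventually_elim (rule key)
      qed auto
      have "J \<le> (C * A) ^ (2 * r)"
      proof (cases "J = 0")
        case False
        then have Jpos: "J > 0" using J0 by simp
        have "J powr (1 / q) * J powr (1 / (2 * real r)) = J"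
          using Jpos q r by (simp add: powr_add[symmetric] q_def field_simps)
        with \<open>J \<le> A * C * J powr (1 / q)\<close> Jpos
        have "J powr (1 / (2 * real r)) \<le> A * C"
          by (metis mult.commute mult_le_cancel_left_pos powr_gt_zero less_irrefl)
        then have "(J powr (1 / (2 * real r))) ^ (2 * r) \<le> (A * C) ^ (2 * r)"
          by (intro power_mono) auto
        also have "(J powr (1 / (2 * real r))) ^ (2 * r) = J"
          using Jpos r by (simp add: powr_powr flip: powr_realpow)
        finally show ?thesis by (simp add: mult.commute)
      qed (use A C in auto)
      moreover have "(\<integral>\<^sup>+x. ennreal (?m x K ^ (2 * r)) \<partial>torus) = ennreal J"
        unfolding J_def by (intro nn_integral_eq_integral intJ AE_I2) auto
      ultimately show ?thesis by (simp add: ennreal_leI)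
    qed
    have "(\<lambda>K. \<integral>\<^sup>+x. ennreal (?m x K ^ (2 * r)) \<partial>torus) \<longlonglongrightarrow> (\<integral>\<^sup>+x. ennreal (\<bar>G x\<bar> ^ (2 * r)) \<partial>torus)"
    proof (rule nn_integral_LIMSEQ)
      show "incseq (\<lambda>K x. ennreal (?m x K ^ (2 * r)))"
        by (intro incseq_SucI le_funI ennreal_leI power_mono) auto
      show "(\<lambda>K. ennreal (?m x K ^ (2 * r))) \<longlonglongrightarrow> ennreal (\<bar>G x\<bar> ^ (2 * r))" for x
      proof (rule tendsto_eventually)
        obtain N where "\<bar>G x\<bar> \<le> real N" using real_arch_simple by blast
        then show "\<forall>\<^sub>F K in sequentially. ennreal (?m x K ^ (2 * r)) = ennreal (\<bar>G x\<bar> ^ (2 * r))"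
          by (intro eventually_sequentiallyI[of N]) (simp add: min_absorb1)
      qed
    qed measurable
    then show ?thesis by (rule LIMSEQ_le_const2) (use trunc in blast)
  qed
  then show ?thesis using C by blast
qed

section \<open>Lorentz norms\<close>

lemma nn_integral_powr_Ioo:
  assumes "a > 0" "m > 0"
  shows "(\<integral>\<^sup>+t\<in>{0<..<m}. ennreal (t powr (a - 1)) \<partial>lborel) = ennreal (m powr a / a)"
proof -
  have "((\<lambda>t. t powr (a - 1)) has_integral (m powr a / a)) {0<..<m}"
    using has_integral_powr_from_0[of "a - 1" m] assms by (simp add: has_integral_Icc_iff_Ioo)
  then show ?thesis
    using nn_integral_has_integral_lebesgue[of "{0<..<m}" "\<lambda>t. t powr (a - 1)" "m powr a / a"]
    by (simp add: ennreal_mult' ennreal_indicator nn_integral_completion mult.commute)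
qed

lemma ennpowr_mono: "x \<le> y \<Longrightarrow> a > 0 \<Longrightarrow> ennpowr x a \<le> ennpowr y a"
  by (auto simp: ennpowr_def top_unique less_top intro!: ennreal_leI powr_mono2 enn2real_mono)

lemma ennpowr_ennreal: "x \<ge> 0 \<Longrightarrow> ennpowr (ennreal x) a = ennreal (x powr a)"
  by (simp add: ennpowr_def)

lemma le_if_ennpowr_le:
  assumes "ennpowr x a \<le> ennreal y" "a > 0" "y \<ge> 0"
  shows "x \<le> ennreal (y powr (1 / a))"
proof (cases x)
  case (real r)
  then have "r powr a \<le> y" using assms by (simp add: ennpowr_ennreal)
  then have "(r powr a) powr (1 / a) \<le> y powr (1 / a)" using assms by (intro powr_mono2) auto
  then show ?thesis using real assms by (simp add: powr_powr ennreal_leI)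
next
  case top
  then show ?thesis using assms by (simp add: ennpowr_def top_unique)
qed

definition dilate :: "(real^'m \<Rightarrow> real) \<Rightarrow> real^'m \<Rightarrow> real" where
  "dilate f x = f ((2 * pi) *\<^sub>R x)"

definition distribution_fn :: "(real^'m \<Rightarrow> real) \<Rightarrow> real \<Rightarrow> real" where
  "distribution_fn G y = measure torus {x \<in> space torus. y < \<bar>G x\<bar>}"

lemma rearrangement_eq:
  "rearrangement f t = Inf {y. 0 \<le> y \<and> distribution_fn (dilate f) y \<le> t}"
proof -
  have "measure lebesgue {x \<in> unit_cell. y < \<bar>f ((2 * pi) *\<^sub>R x)\<bar>} = distribution_fn (dilate f) y" for y
    unfolding distribution_fn_def dilate_def
    by (subst measure_restrict_space) (auto simp: space_restrict_space)
  then show ?thesis by (simp add: rearrangement_def)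
qed

lemma distribution_fn_antimono:
  assumes "G \<in> borel_measurable torus" "y \<le> z"
  shows "distribution_fn G z \<le> distribution_fn G y"
  unfolding distribution_fn_def
proof (rule finite_measure.finite_measure_mono[OF finite_measure_torus])
  show "{x \<in> space torus. y < \<bar>G x\<bar>} \<in> sets torus" using assms(1) by measurable
qed (use assms in auto)

text \<open>Nonemptiness keeps the \<open>Inf\<close> in the rearrangement from being an unspecified
  value. It follows from continuity from above: the level sets of a finite-valued function shrink to
  the empty set.\<close>

lemma rearrangement_nonneg:
  assumes "dilate f \<in> borel_measurable torus" "t > 0"
  shows "{y. 0 \<le> y \<and> distribution_fn (dilate f) y \<le> t} \<noteq> {}" "rearrangement f t \<ge> 0"
proof -
  have m: "{x \<in> space torus. y < \<bar>dilate f x\<bar>} \<in> sets torus" for y using assms(1) by measurable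
  have "(\<lambda>n. measure torus {x \<in> space torus. real n < \<bar>dilate f x\<bar>}) \<longlonglongrightarrow>
      measure torus (\<Inter>n. {x \<in> space torus. real n < \<bar>dilate f x\<bar>})"
  proof (rule finite_measure.finite_Lim_measure_decseq[OF finite_measure_torus])
    show "decseq (\<lambda>n. {x \<in> space torus. real n < \<bar>dilate f x\<bar>})" by (auto simp: decseq_def)
  qed (use m in auto)
  also have "(\<Inter>n. {x \<in> space torus. real n < \<bar>dilate f x\<bar>}) = {}"
  proof -
    have "\<exists>n. \<not> real n < \<bar>dilate f x\<bar>" for x using real_arch_simple[of "\<bar>dilate f x\<bar>"] by (auto simp: not_less)
    then show ?thesis by blast
  qed
  finally have "(\<lambda>n. distribution_fn (dilate f) (real n)) \<longlonglongrightarrow> 0"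
    by (simp add: distribution_fn_def)
  then have "eventually (\<lambda>n. distribution_fn (dilate f) (real n) < t) sequentially"
    using assms(2) by (rule order_tendstoD)
  then obtain n where "distribution_fn (dilate f) (real n) < t"
    by (auto simp: eventually_sequentially)
  then show *: "{y. 0 \<le> y \<and> distribution_fn (dilate f) y \<le> t} \<noteq> {}"
    by (auto intro!: exI[of _ "real n"])
  show "rearrangement f t \<ge> 0" unfolding rearrangement_eq using * by (intro cInf_greatest) auto
qed

text \<open>Chebyshev's inequality gives the bound \<open>A * t powr (- 1 / s)\<close> for the
  rearrangement. What remains is the integral of \<open>t powr (\<tau> / p - \<tau> / s - 1)\<close>
  over the unit interval, finite because \<open>p < s\<close>.\<close>

lemma lorentz_norm_le:
  assumes "0 < p" "p < s" "\<tau> > 0"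
  shows "\<exists>K>0. \<forall>(f :: real^'m \<Rightarrow> real) A. dilate f \<in> borel_measurable torus \<longrightarrow> A > 0 \<longrightarrow>
    (\<integral>\<^sup>+x. ennreal (\<bar>dilate f x\<bar> powr s) \<partial>torus) \<le> ennreal (A powr s) \<longrightarrow>
    lorentz_norm p \<tau> f \<le> ennreal (K * A)"
proof -
  define c where "c = \<tau> / p - \<tau> / s"
  have c: "c > 0" using assms by (simp add: c_def field_simps)
  have "lorentz_norm p \<tau> f \<le> ennreal (c powr (- 1 / \<tau>) * A)"
    if [measurable]: "dilate f \<in> borel_measurable torus" and A: "A > 0"
      and I: "(\<integral>\<^sup>+x. ennreal (\<bar>dilate f x\<bar> powr s) \<partial>torus) \<le> ennreal (A powr s)"
    for f :: "real^'m \<Rightarrow> real" and A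
  proof -
    have le: "rearrangement f t \<le> A * t powr (- 1 / s)" if t: "t > 0" for t
    proof -
      define y where "y = A * t powr (- 1 / s)"
      have y: "y > 0" using A t by (simp add: y_def)
      define E where "E = {x \<in> space torus. y < \<bar>dilate f x\<bar>}"
      have E: "E \<in> sets torus" unfolding E_def by measurable
      have "ennreal (y powr s) * emeasure torus E = (\<integral>\<^sup>+x. ennreal (y powr s) * indicator E x \<partial>torus)"
        using E by (simp add: nn_integral_cmult_indicator)
      also have "\<dots> \<le> (\<integral>\<^sup>+x. ennreal (\<bar>dilate f x\<bar> powr s) \<partial>torus)"
        using y assms by (intro nn_integral_mono) (auto simp: E_def indicator_def intro!: ennreal_leI powr_mono2)
      also have "\<dots> \<le> ennreal (A powr s)" by fact
      finally have "y powr s * measure torus E \<le> A powr s"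
        by (simp add: finite_measure.emeasure_eq_measure[OF finite_measure_torus] flip: ennreal_mult)
      also have "A powr s = y powr s * t"
        using A t assms by (simp add: y_def powr_mult powr_powr powr_neg_one)
      finally have "measure torus E \<le> t" using y by simp
      then have "distribution_fn (dilate f) y \<le> t" by (simp add: distribution_fn_def E_def)
      then show ?thesis
        unfolding rearrangement_eq y_def[symmetric] using y by (intro cInf_lower bdd_belowI[of _ 0]) auto
    qed
    have "(\<integral>\<^sup>+t\<in>{0<..<1}. ennreal (rearrangement f t powr \<tau> * t powr (\<tau> / p - 1)) \<partial>lborel)
      \<le> (\<integral>\<^sup>+t\<in>{0<..<1}. ennreal (A powr \<tau>) * ennreal (t powr (c - 1)) \<partial>lborel)"
    proof (intro nn_integral_mono)
      fix t :: real
      show "ennreal (rearrangement f t powr \<tau> * t powr (\<tau> / p - 1)) * indicator {0<..<1} t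
        \<le> ennreal (A powr \<tau>) * ennreal (t powr (c - 1)) * indicator {0<..<1} t"
      proof (cases "t \<in> {0<..<1}")
        case True
        then have t: "t > 0" by simp
        have "rearrangement f t powr \<tau> * t powr (\<tau> / p - 1) \<le> (A * t powr (- 1 / s)) powr \<tau> * t powr (\<tau> / p - 1)"
          using assms t by (intro mult_right_mono powr_mono2 le rearrangement_nonneg) auto
        also have "\<dots> = A powr \<tau> * t powr (c - 1)"
          using A t by (simp add: powr_mult powr_powr c_def flip: powr_add) (simp add: algebra_simps)
        finally show ?thesis using True by (simp add: ennreal_leI flip: ennreal_mult)
      qed simp
    qed
    also have "\<dots> = ennreal (A powr \<tau>) * (\<integral>\<^sup>+t\<in>{0<..<1}. ennreal (t powr (c - 1)) \<partial>lborel)"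
      by (simp add: nn_integral_cmult mult.assoc)
    also have "\<dots> = ennreal (A powr \<tau> / c)"
      using c by (simp add: nn_integral_powr_Ioo flip: ennreal_mult)
    finally have "lorentz_norm p \<tau> f \<le> ennpowr (ennreal (A powr \<tau> / c)) (1 / \<tau>)"
      unfolding lorentz_norm_def using assms by (intro ennpowr_mono) auto
    also have "\<dots> = ennreal (c powr (- 1 / \<tau>) * A)"
      using c A assms by (simp add: ennpowr_ennreal powr_divide powr_powr powr_minus_divide)
    finally show ?thesis .
  qed
  then show ?thesis using c by (intro exI[of _ "c powr (- 1 / \<tau>)"]) auto
qed

text \<open>The weak-type estimate. If the level set above \<open>y\<close> has measure
  \<open>m\<close>, the rearrangement is at least \<open>y\<close> on \<open>(0, m)\<close>, and
  \<open>m \<le> 1\<close>; this part of the norm integral alone is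
  \<open>y powr \<tau> * m powr (\<tau> / p)\<close> times \<open>p / \<tau>\<close>.\<close>

lemma distribution_fn_le_lorentz:
  assumes p: "p > 0" "\<tau> > 0" and [measurable]: "dilate f \<in> borel_measurable torus"
    and N: "N > 0" "lorentz_norm p \<tau> f \<le> ennreal N" and y: "y > 0"
  shows "distribution_fn (dilate f) y \<le> ((\<tau> / p) powr (1 / \<tau>) * N / y) powr p"
proof (cases "distribution_fn (dilate f) y > 0")
  case True
  define m where "m = distribution_fn (dilate f) y"
  have m: "m > 0" using True by (simp add: m_def)
  have "measure torus (space (torus :: (real^'a) measure)) = 1"
    using emeasure_torus by (simp add: measure_def)
  then have m1: "m \<le> 1"
    unfolding m_def distribution_fn_def
    using finite_measure.bounded_measure[OF finite_measure_torus] by metis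
  have ge: "rearrangement f u \<ge> y" if u: "0 < u" "u < m" for u
    unfolding rearrangement_eq
  proof (intro cInf_greatest rearrangement_nonneg(1))
    fix z assume "z \<in> {y. 0 \<le> y \<and> distribution_fn (dilate f) y \<le> u}"
    then have "distribution_fn (dilate f) z < distribution_fn (dilate f) y" using u by (auto simp: m_def)
    then show "y \<le> z" using distribution_fn_antimono[of "dilate f" z y] by (cases "z \<le> y") auto
  qed (use u in auto)
  have "ennreal (y powr \<tau>) * ennreal (m powr (\<tau> / p) / (\<tau> / p)) =
     ennreal (y powr \<tau>) * (\<integral>\<^sup>+t\<in>{0<..<m}. ennreal (t powr (\<tau> / p - 1)) \<partial>lborel)"
    using p m by (subst nn_integral_powr_Ioo) auto
  also have "\<dots> = (\<integral>\<^sup>+t\<in>{0<..<m}. ennreal (y powr \<tau>) * ennreal (t powr (\<tau> / p - 1)) \<partial>lborel)"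
    by (simp add: nn_integral_cmult mult.assoc)
  also have "\<dots> \<le> (\<integral>\<^sup>+t\<in>{0<..<1}. ennreal (rearrangement f t powr \<tau> * t powr (\<tau> / p - 1)) \<partial>lborel)"
    using y p m1 ge
    by (intro nn_integral_mono)
      (auto simp: indicator_def simp flip: ennreal_mult intro!: ennreal_leI mult_right_mono powr_mono2)
  also have "\<dots> \<le> ennreal (N powr (1 / (1 / \<tau>)))"
    using N p unfolding lorentz_norm_def by (intro le_if_ennpowr_le) auto
  finally have "y powr \<tau> * (m powr (\<tau> / p) / (\<tau> / p)) \<le> N powr \<tau>"
    using p m by (simp flip: ennreal_mult)
  then have "m powr (\<tau> / p) \<le> (\<tau> / p) * (N / y) powr \<tau>"
    using p y N by (simp add: powr_divide field_simps)
  then have "(m powr (\<tau> / p)) powr (p / \<tau>) \<le> ((\<tau> / p) * (N / y) powr \<tau>) powr (p / \<tau>)"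
    using p by (intro powr_mono2) auto
  then have "m \<le> ((\<tau> / p) * (N / y) powr \<tau>) powr (p / \<tau>)"
    using p m by (simp add: powr_powr)
  also have "\<dots> = ((\<tau> / p) powr (1 / \<tau>) * N / y) powr p"
    using p y N by (simp add: powr_mult powr_powr powr_divide)
  finally show ?thesis by (simp add: m_def)
qed (auto intro: order_trans[of _ 0])

text \<open>The weak-type estimate is summed over the level sets at heights
  \<open>A * 2 ^ k\<close>. With \<open>A = c * N\<close> they have measure at most
  \<open>2 powr (- k * p)\<close>, and the series converges because \<open>q < p\<close>.\<close>

lemma lorentz_norm_ge:
  assumes p: "0 < q" "q < p" "\<tau> > 0"
  shows "\<exists>K>0. \<forall>(f :: real^'m \<Rightarrow> real) N. dilate f \<in> borel_measurable torus \<longrightarrow> N > 0 \<longrightarrow>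
    lorentz_norm p \<tau> f \<le> ennreal N \<longrightarrow>
    (\<integral>\<^sup>+x. ennreal (\<bar>dilate f x\<bar> powr q) \<partial>torus) \<le> ennreal ((K * N) powr q)"
proof -
  define c where "c = (\<tau> / p) powr (1 / \<tau>)"
  have c: "c > 0" using p by (simp add: c_def)
  \<comment> \<open>In units of \<open>A powr q\<close>: the largest value of the
    \<open>q\<close>-th power between heights \<open>A * 2 ^ k\<close> and
    \<open>A * 2 ^ (k + 1)\<close>, times the bound for the measure of the set above the lower
    height. The 1 added in \<open>S\<close> covers the points below height \<open>A\<close>.\<close>
  define a where "a k = 2 powr ((real k + 1) * q) * 2 powr (- real k * p)" for k :: nat
  have a: "a k = 2 powr q * (2 powr (q - p)) ^ k" for k
    by (simp add: a_def powr_add[symmetric] powr_power) (simp add: algebra_simps)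
  have "2 powr (q - p) < (1 :: real)" using p by (simp add: powr_less_one)
  then have sa: "summable a" unfolding a by (intro summable_mult summable_geometric) auto
  have a0: "a k \<ge> 0" for k by (simp add: a_def)
  define S where "S = 1 + suminf a"
  have S: "S > 0" using suminf_nonneg[OF sa a0] by (simp add: S_def)
  define K where "K = c * S powr (1 / q)"
  have "(\<integral>\<^sup>+x. ennreal (\<bar>dilate f x\<bar> powr q) \<partial>torus) \<le> ennreal ((K * N) powr q)"
    if [measurable]: "dilate f \<in> borel_measurable torus" and N: "N > 0" "lorentz_norm p \<tau> f \<le> ennreal N"
    for f :: "real^'m \<Rightarrow> real" and N
  proof -
    define A where "A = c * N"
    have A: "A > 0" using c N by (simp add: A_def)
    define E where "E k = {x \<in> space torus. A * 2 ^ k < \<bar>dilate f x\<bar>}" for k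
    have E[measurable]: "E k \<in> sets torus" for k unfolding E_def by measurable
    let ?c = "\<lambda>k x. ennreal (2 powr ((real k + 1) * q)) * indicator (E k) x"
    let ?G = "\<lambda>x. \<bar>dilate f x\<bar>"
    have mE: "emeasure torus (E k) \<le> ennreal (2 powr (- real k * p))" for k
    proof -
      have "distribution_fn (dilate f) (A * 2 ^ k) \<le> (c * N / (A * 2 ^ k)) powr p"
        unfolding c_def using N A p by (intro distribution_fn_le_lorentz) auto
      also have "\<dots> = 2 powr (- real k * p)"
        using c N by (simp add: A_def powr_divide powr_realpow[symmetric] powr_powr powr_minus_divide)
      finally show ?thesis
        by (simp add: finite_measure.emeasure_eq_measure[OF finite_measure_torus] E_def distribution_fn_def ennreal_leI)
    qed
    have pt: "ennreal (?G x powr q) \<le> ennreal (A powr q) * (1 + (\<Sum>k. ?c k x))"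
      if x: "x \<in> space torus" for x
    proof (cases "?G x \<le> A")
      case True
      then have "ennreal (?G x powr q) \<le> ennreal (A powr q) * 1"
        using p by (auto intro!: ennreal_leI powr_mono2)
      also have "\<dots> \<le> ennreal (A powr q) * (1 + (\<Sum>k. ?c k x))"
        by (intro mult_left_mono) auto
      finally show ?thesis .
    next
      case False
      obtain n where n: "?G x / A < 2 ^ n" using real_arch_pow[of 2 "?G x / A"] by auto
      define k where "k = (LEAST k. ?G x \<le> A * 2 ^ Suc k)"
      have "?G x \<le> A * 2 ^ n" using n A by (simp add: field_simps)
      also have "\<dots> \<le> A * 2 ^ Suc n" using A by simp
      finally have k1: "?G x \<le> A * 2 ^ Suc k" unfolding k_def by (rule LeastI)
      have k2: "x \<in> E k"
      proof (cases k)
        case 0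
        then show ?thesis using False x by (simp add: E_def)
      next
        case (Suc k')
        then have "\<not> ?G x \<le> A * 2 ^ Suc k'" using not_less_Least[of k' "\<lambda>k. ?G x \<le> A * 2 ^ Suc k"] unfolding k_def[symmetric] by simp
        then show ?thesis using x Suc by (simp add: E_def)
      qed
      have "?G x powr q \<le> (A * 2 ^ Suc k) powr q" using k1 p by (intro powr_mono2) auto
      also have "\<dots> = A powr q * 2 powr ((real k + 1) * q)"
      proof -
        have "(2::real) ^ Suc k = 2 powr (real k + 1)"
          by (simp add: powr_realpow[symmetric] powr_add)
        then show ?thesis using A by (simp only: powr_mult powr_powr)
      qed
      finally have "ennreal (?G x powr q) \<le> ennreal (A powr q) * (?c k x)"
        using k2 by (simp add: ennreal_leI flip: ennreal_mult)
      also have "\<dots> \<le> ennreal (A powr q) * (1 + (\<Sum>k. ?c k x))"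
      proof (rule mult_left_mono)
        have le: "g k \<le> 1 + suminf g" for g :: "nat \<Rightarrow> ennreal"
          using sum_le_suminf[of g "{k}"] by (simp add: add_increasing)
        show "?c k x
            \<le> 1 + (\<Sum>k. ?c k x)"
          by (rule le)
      qed simp
      finally show ?thesis .
    qed
    have "(\<integral>\<^sup>+x. ennreal (?G x powr q) \<partial>torus) \<le>
       (\<integral>\<^sup>+x. ennreal (A powr q) * (1 + (\<Sum>k. ?c k x)) \<partial>torus)"
      by (intro nn_integral_mono pt)
    also have "\<dots> = ennreal (A powr q) * (1 + (\<Sum>k. ennreal (2 powr ((real k + 1) * q)) * emeasure torus (E k)))"
      using emeasure_torus[where 'm = 'm]
      by (simp add: nn_integral_cmult nn_integral_add nn_integral_suminf nn_integral_cmult_indicator)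
    also have "\<dots> \<le> ennreal (A powr q) * (1 + (\<Sum>k. ennreal (a k)))"
      unfolding a_def using mE
      by (intro mult_left_mono add_left_mono suminf_le summableI) (auto simp: ennreal_mult mult_left_mono)
    also have "\<dots> = ennreal (A powr q * S)"
      using suminf_ennreal2[OF a0 sa] suminf_nonneg[OF sa a0]
      by (simp add: S_def ennreal_mult ennreal_plus flip: ennreal_1)
    also have "A powr q * S = (K * N) powr q"
      using c N S p by (simp add: A_def K_def powr_mult powr_powr)
    finally show ?thesis .
  qed
  then show ?thesis using c S by (intro exI[of _ K]) (auto simp: K_def)
qed

section \<open>Energy of the Fourier coefficients\<close>

lemma nn_integral_count_space_le:
  fixes f :: "'a::countable \<Rightarrow> ennreal"
  assumes "\<And>F. finite F \<Longrightarrow> F \<subseteq> S \<Longrightarrow> sum f F \<le> c"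
  shows "(\<integral>\<^sup>+x. f x \<partial>count_space S) \<le> c"
proof (cases "finite S")
  case True
  then show ?thesis using assms by (simp add: nn_integral_count_space_finite)
next
  case False
  then have e: "bij_betw (from_nat_into S) UNIV S" by (intro bij_betw_from_nat_into) auto
  have "(\<integral>\<^sup>+x. f x \<partial>count_space S) = (\<Sum>n. f (from_nat_into S n))"
    by (simp add: nn_integral_bij_count_space[symmetric, OF e] nn_integral_count_space_nat)
  also have "\<dots> \<le> c"
  proof (rule suminf_le_const[OF summableI])
    fix n
    have "inj_on (from_nat_into S) {..<n}" using e by (auto simp: bij_betw_def inj_on_def)
    then have "(\<Sum>i<n. f (from_nat_into S i)) = sum f (from_nat_into S ` {..<n})"
      by (simp add: sum.reindex)
    also have "\<dots> \<le> c"
      using e by (intro assms) (auto simp: bij_betw_def)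
    finally show "(\<Sum>i<n. f (from_nat_into S i)) \<le> c" .
  qed
  finally show ?thesis .
qed

text \<open>The estimates above ask for a positive upper bound of a norm. Letting this bound
  decrease to the norm itself yields the estimate with the exact value, also when that value is
  zero.\<close>

lemma ennreal_le_limit:
  fixes b :: real and g :: "real \<Rightarrow> real"
  assumes "\<And>B. B > b \<Longrightarrow> x \<le> ennreal (g B)" "continuous (at_right b) g"
  shows "x \<le> ennreal (g b)"
proof (rule tendsto_lowerbound)
  show "((\<lambda>B. ennreal (g B)) \<longlongrightarrow> ennreal (g b)) (at_right b)"
    using assms(2) by (intro tendsto_ennrealI) (simp add: continuous_within)
  show "\<forall>\<^sub>F B in at_right b. x \<le> ennreal (g B)"
    using eventually_at_right_less by eventually_elim (rule assms(1))
qed auto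

text \<open>An integral over counting measure, so that the weighted sum of squares exists in
  \<open>[0, \<infinity>]\<close> without summability conditions. It sees the lacunary frequencies
  only, whatever the spectrum of \<open>f\<close> is.\<close>

definition energy :: "(real^'m \<Rightarrow> real) \<Rightarrow> (('m \<Rightarrow> int) \<Rightarrow> real) \<Rightarrow> ennreal" where
  "energy f w = (\<integral>\<^sup>+k. ennreal (w k * (norm (fourier_coeff f k))\<^sup>2) \<partial>count_space lacunary)"

lemma fourier_coeff_dilate: "fourier_coeff f k = fcoef (\<lambda>x. of_real (dilate f x)) k"
  by (simp add: fourier_coeff_eq_fcoef dilate_def)

text \<open>As \<open>r\<close> grows, \<open>conj_exp r\<close> decreases to 1; it is below
  \<open>p\<close> as soon as \<open>2 * r * (p - 1) > p\<close>.\<close>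

lemma exists_conj_exp:
  assumes "p > (1 :: real)"
  shows "\<exists>r>0. conj_exp r < p \<and> p < 2 * real r"
proof -
  obtain r :: nat where r: "real r > max p (p / (p - 1))" using reals_Archimedean2 by blast
  have "r > 0" using r assms by (cases r) auto
  moreover have "p < 2 * real r" using r assms by simp
  moreover have "conj_exp r < p"
  proof -
    have "real r * (p - 1) > p" using r assms by (simp add: field_simps)
    moreover have "real r * (p - 1) > 0" using \<open>r > 0\<close> assms by simp
    ultimately have "2 * real r < p * (2 * real r - 1)" by (simp add: algebra_simps)
    then show ?thesis using \<open>r > 0\<close> by (simp add: field_simps)
  qed
  ultimately show ?thesis by blast
qed

lemma integrable_if_lorentz_norm_finite:
  assumes p: "p > 1" "\<tau> > 0" and m: "dilate f \<in> borel_measurable torus"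
    and fin: "lorentz_norm p \<tau> f < \<infinity>"
  shows "integrable torus (dilate f)"
proof -
  define q where "q = (1 + p) / 2"
  have q: "1 < q" "q < p" using p by (auto simp: q_def)
  then have q0: "0 < q" by simp
  define N where "N = enn2real (lorentz_norm p \<tau> f) + 1"
  have "lorentz_norm p \<tau> f \<le> ennreal N"
    using fin by (cases "lorentz_norm p \<tau> f") (auto simp: N_def ennreal_leI)
  moreover have "N > 0" by (simp add: N_def add_nonneg_pos)
  moreover obtain K where "\<And>(f :: real^'a \<Rightarrow> real) N. dilate f \<in> borel_measurable torus \<Longrightarrow> N > 0 \<Longrightarrow>
      lorentz_norm p \<tau> f \<le> ennreal N \<Longrightarrow>
      (\<integral>\<^sup>+x. ennreal (\<bar>dilate f x\<bar> powr q) \<partial>torus) \<le> ennreal ((K * N) powr q)"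
    using lorentz_norm_ge[OF q0 q(2) p(2), where 'm = 'a] by blast
  ultimately have "(\<integral>\<^sup>+x. ennreal (\<bar>dilate f x\<bar> powr q) \<partial>torus) \<le> ennreal ((K * N) powr q)"
    using m by blast
  then have "integrable torus (\<lambda>x. complex_of_real (dilate f x))"
    using q m by (intro integrable_torus_powr[of _ q]) (auto simp: le_less_trans)
  then have "integrable torus (\<lambda>x. Re (complex_of_real (dilate f x)))" by (rule integrable_Re)
  then show ?thesis by simp
qed

text \<open>For \<open>conj_exp r < p\<close> the Lorentz norm dominates the \<open>L_q\<close> norm
  with \<open>q = conj_exp r\<close>, and the dual lower bound passes from there to the lacunary
  coefficients. In this generality it applies to \<open>f\<close> minus arbitrary
  approximants.\<close>

lemma energy_le_lorentz_norm:
  assumes p: "p > 1" "\<tau> > 0"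
  shows "\<exists>C>0. \<forall>f :: real^'m \<Rightarrow> real. dilate f \<in> borel_measurable torus \<longrightarrow>
    energy f (\<lambda>_. 1) \<le> ennreal C * (lorentz_norm p \<tau> f)\<^sup>2"
proof -
  obtain r where r: "r > 0" "conj_exp r < p" using exists_conj_exp[OF p(1)] by blast
  have q: "conj_exp r > 0" using r by simp
  obtain C where C: "C > 0" and low: "\<And>(G :: real^'m \<Rightarrow> complex) B F. G \<in> borel_measurable torus \<Longrightarrow> B > 0 \<Longrightarrow>
     (\<integral>\<^sup>+x. ennreal (norm (G x) powr conj_exp r) \<partial>torus) \<le> ennreal (B powr conj_exp r) \<Longrightarrow>
     finite F \<Longrightarrow> F \<subseteq> lacunary \<Longrightarrow> (\<Sum>k\<in>F. (norm (fcoef G k))\<^sup>2) \<le> (C * B)\<^sup>2"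
    using lacunary_lower_bound[OF r(1), where 'm = 'm] by blast
  obtain K where K: "K > 0" and lor: "\<And>(f :: real^'m \<Rightarrow> real) N. dilate f \<in> borel_measurable torus \<Longrightarrow> N > 0 \<Longrightarrow>
    lorentz_norm p \<tau> f \<le> ennreal N \<Longrightarrow>
    (\<integral>\<^sup>+x. ennreal (\<bar>dilate f x\<bar> powr conj_exp r) \<partial>torus) \<le> ennreal ((K * N) powr conj_exp r)"
    using lorentz_norm_ge[OF q r(2) p(2), where 'm = 'm] by blast
  have "energy f (\<lambda>_. 1) \<le> ennreal ((C * K)\<^sup>2) * (lorentz_norm p \<tau> f)\<^sup>2"
    if m[measurable]: "dilate f \<in> borel_measurable torus" for f :: "real^'m \<Rightarrow> real"
  proof (cases "lorentz_norm p \<tau> f")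
    case (real N0)
    have "energy f (\<lambda>_. 1) \<le> ennreal ((C * K * N0)\<^sup>2)"
    proof (rule ennreal_le_limit[where b = N0 and g = "\<lambda>N. (C * K * N)\<^sup>2"])
      fix N assume N: "N > N0"
      have N0: "N > 0" using N real by simp
      show "energy f (\<lambda>_. 1) \<le> ennreal ((C * K * N)\<^sup>2)"
        unfolding energy_def
      proof (rule nn_integral_count_space_le)
        fix F :: "('m \<Rightarrow> int) set" assume F: "finite F" "F \<subseteq> lacunary"
        have "(\<Sum>k\<in>F. (norm (fcoef (\<lambda>x. of_real (dilate f x)) k))\<^sup>2) \<le> (C * (K * N))\<^sup>2"
        proof (rule low)
          show "(\<integral>\<^sup>+x. ennreal (norm (complex_of_real (dilate f x)) powr conj_exp r) \<partial>torus)
              \<le> ennreal ((K * N) powr conj_exp r)"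
            using lor[OF m N0] N real by (simp add: ennreal_leI)
        qed (use K N0 F in auto)
        then show "(\<Sum>k\<in>F. ennreal (1 * (norm (fourier_coeff f k))\<^sup>2)) \<le> ennreal ((C * K * N)\<^sup>2)"
          by (simp add: sum_ennreal ennreal_leI fourier_coeff_dilate mult.assoc)
      qed
    qed (auto intro!: continuous_intros)
    also have "\<dots> = ennreal ((C * K)\<^sup>2) * (lorentz_norm p \<tau> f)\<^sup>2"
      using real by (simp add: power_mult_distrib ennreal_power flip: ennreal_mult)
    finally show ?thesis .
  next
    case top
    then show ?thesis using C K by (simp add: ennreal_mult_top)
  qed
  then show ?thesis using C K by (intro exI[of _ "(C * K)\<^sup>2"]) auto
qed

text \<open>For \<open>p < 2 * r\<close> the moment of order \<open>2 * r\<close> dominates the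
  Lorentz norm. The spectral hypothesis is what allows \<open>energy\<close>, blind to other
  frequencies, to bound a norm from above.\<close>

lemma lorentz_norm_le_energy:
  assumes p: "p > 1" "\<tau> > 0"
  shows "\<exists>C>0. \<forall>f :: real^'m \<Rightarrow> real. integrable torus (dilate f) \<longrightarrow>
    (\<forall>k. k \<notin> lacunary \<longrightarrow> fourier_coeff f k = 0) \<longrightarrow>
    (lorentz_norm p \<tau> f)\<^sup>2 \<le> ennreal C * energy f (\<lambda>_. 1)"
proof -
  have p0: "p > 0" using p by simp
  obtain r where r: "r > 0" "p < 2 * real r" using exists_conj_exp[OF p(1)] by blast
  obtain C where C: "C > 0" and up: "\<And>(G :: real^'m \<Rightarrow> real) A. integrable torus G \<Longrightarrow>
     (\<And>k. k \<notin> lacunary \<Longrightarrow> fcoef (\<lambda>x. of_real (G x)) k = 0) \<Longrightarrow> A \<ge> 0 \<Longrightarrow>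
     (\<And>F. finite F \<Longrightarrow> F \<subseteq> lacunary \<Longrightarrow> (\<Sum>k\<in>F. (norm (fcoef (\<lambda>x. of_real (G x)) k))\<^sup>2) \<le> A\<^sup>2) \<Longrightarrow>
     (\<integral>\<^sup>+x. ennreal (\<bar>G x\<bar> ^ (2 * r)) \<partial>torus) \<le> ennreal ((C * A) ^ (2 * r))"
    using lacunary_upper_bound[OF r(1), where 'm = 'm] by blast
  obtain K where K: "K > 0" and lor: "\<And>(f :: real^'m \<Rightarrow> real) A. dilate f \<in> borel_measurable torus \<Longrightarrow> A > 0 \<Longrightarrow>
    (\<integral>\<^sup>+x. ennreal (\<bar>dilate f x\<bar> powr (2 * real r)) \<partial>torus) \<le> ennreal (A powr (2 * real r)) \<Longrightarrow>
    lorentz_norm p \<tau> f \<le> ennreal (K * A)"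
    using lorentz_norm_le[OF p0 r(2) p(2), where 'm = 'm] by blast
  have "(lorentz_norm p \<tau> f)\<^sup>2 \<le> ennreal ((K * C)\<^sup>2) * energy f (\<lambda>_. 1)"
    if int: "integrable torus (dilate f)" and spec: "\<And>k. k \<notin> lacunary \<Longrightarrow> fourier_coeff f k = 0"
    for f :: "real^'m \<Rightarrow> real"
  proof (cases "energy f (\<lambda>_. 1)")
    case (real E)
    have sums: "(\<Sum>k\<in>F. (norm (fourier_coeff f k))\<^sup>2) \<le> E" if F: "finite F" "F \<subseteq> lacunary" for F
    proof -
      have "ennreal (\<Sum>k\<in>F. (norm (fourier_coeff f k))\<^sup>2) = (\<integral>\<^sup>+k. ennreal (1 * (norm (fourier_coeff f k))\<^sup>2) \<partial>count_space F)"
        using F by (simp add: nn_integral_count_space_finite)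
      also have "\<dots> = (\<integral>\<^sup>+k. ennreal (1 * (norm (fourier_coeff f k))\<^sup>2) * indicator F k \<partial>count_space UNIV)"
        by (simp add: nn_integral_count_space_indicator)
      also have "\<dots> \<le> (\<integral>\<^sup>+k. ennreal (1 * (norm (fourier_coeff f k))\<^sup>2) * indicator lacunary k \<partial>count_space UNIV)"
        using F(2) by (intro nn_integral_mono) (auto simp: indicator_def)
      also have "\<dots> = ennreal E"
        using real by (simp add: energy_def nn_integral_count_space_indicator)
      finally show ?thesis using real by simp
    qed
    have "lorentz_norm p \<tau> f \<le> ennreal (K * C * sqrt E)"
    proof (rule ennreal_le_limit[where b = "sqrt E" and g = "\<lambda>A. K * C * A"])
      fix A assume A: "A > sqrt E"
      have A0: "A > 0" using A real by (metis order.strict_trans1 real_sqrt_ge_zero)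
      have "(\<integral>\<^sup>+x. ennreal (\<bar>dilate f x\<bar> ^ (2 * r)) \<partial>torus) \<le> ennreal ((C * A) ^ (2 * r))"
      proof (rule up[OF int])
        fix F :: "('m \<Rightarrow> int) set" assume "finite F" "F \<subseteq> lacunary"
        then have "(\<Sum>k\<in>F. (norm (fcoef (\<lambda>x. of_real (dilate f x)) k))\<^sup>2) \<le> E"
          using sums by (simp add: fourier_coeff_dilate)
        also have "E = (sqrt E)\<^sup>2" using real by simp
        also have "\<dots> \<le> A\<^sup>2" using A real by (intro power_mono) auto
        finally show "(\<Sum>k\<in>F. (norm (fcoef (\<lambda>x. of_real (dilate f x)) k))\<^sup>2) \<le> A\<^sup>2" .
      qed (use spec A0 in \<open>auto simp: fourier_coeff_dilate\<close>)
      also have "(\<integral>\<^sup>+x. ennreal (\<bar>dilate f x\<bar> ^ (2 * r)) \<partial>torus) = (\<integral>\<^sup>+x. ennreal (\<bar>dilate f x\<bar> powr (2 * real r)) \<partial>torus)"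
      proof (intro nn_integral_cong arg_cong[of _ _ ennreal])
        fix x show "\<bar>dilate f x\<bar> ^ (2 * r) = \<bar>dilate f x\<bar> powr (2 * real r)"
          using r powr_realpow'[of "\<bar>dilate f x\<bar>" "2 * r"] by simp
      qed
      also have "(C * A) ^ (2 * r) = (C * A) powr (2 * real r)"
        using C A0 powr_realpow[of "C * A" "2 * r"] by simp
      finally have "lorentz_norm p \<tau> f \<le> ennreal (K * (C * A))"
        using C A0 int by (intro lor) auto
      then show "lorentz_norm p \<tau> f \<le> ennreal (K * C * A)" by (simp add: mult.assoc)
    qed (auto intro!: continuous_intros)
    then have "(lorentz_norm p \<tau> f)\<^sup>2 \<le> (ennreal (K * C * sqrt E))\<^sup>2" by (intro power_mono) auto
    also have "\<dots> = ennreal ((K * C)\<^sup>2) * energy f (\<lambda>_. 1)"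
      using real C K by (simp add: power_mult_distrib ennreal_power flip: ennreal_mult)
    finally show ?thesis .
  next
    case top
    then show ?thesis using C K by (simp add: ennreal_mult_top)
  qed
  then show ?thesis using C K by (intro exI[of _ "(K * C)\<^sup>2"]) auto
qed

text \<open>Completeness of Lebesgue measure. It is applied to the mixed difference, which agrees
  with a measurable sum of a series only almost everywhere.\<close>

lemma borel_measurable_torus_cong_AE:
  fixes f g :: "real^'m \<Rightarrow> 'b::euclidean_space"
  assumes "f \<in> borel_measurable torus" "AE x in torus. g x = f x"
  shows "g \<in> borel_measurable torus"
proof -
  have "AE x in lebesgue. x \<in> unit_cell \<longrightarrow> g x = f x"
    using assms(2) by (simp add: AE_restrict_space_iff)
  then have N: "negligible {x. \<not> (x \<in> unit_cell \<longrightarrow> g x = f x)}"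
    by (simp add: negligible_iff_null_sets completion.AE_iff_null_sets)
  have "f measurable_on unit_cell" using assms(1) by (simp add: measurable_on_iff_borel_measurable)
  from measurable_on_spike[OF this N, of g] show ?thesis
    by (auto simp: measurable_on_iff_borel_measurable)
qed

section \<open>Periodic functions and their translates\<close>

definition periodic_2pi :: "(real^'m \<Rightarrow> real) \<Rightarrow> bool" where
  "periodic_2pi f \<longleftrightarrow> (\<forall>x j. f (x + axis j (2 * pi)) = f x)"

lemma periodic_2pi_int:
  assumes "periodic_2pi f"
  shows "f (x + axis j (2 * pi * of_int n)) = f x"
proof (induction n arbitrary: x rule: int_induct[where k = 0])
  case base
  have "x + axis j (2 * pi * of_int 0) = x" by (simp add: axis_def vec_eq_iff)
  then show ?case by (simp only:)
next
  case (step1 i)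
  have "x + axis j (2 * pi * of_int (i + 1)) = (x + axis j (2 * pi * of_int i)) + axis j (2 * pi)"
    by (simp add: vec_eq_iff axis_def algebra_simps)
  then show ?case using assms step1 by (simp only: periodic_2pi_def)
next
  case (step2 i)
  have "x + axis j (2 * pi * of_int i) = (x + axis j (2 * pi * of_int (i - 1))) + axis j (2 * pi)"
    by (simp add: vec_eq_iff axis_def algebra_simps)
  then show ?case using assms step2 by (metis periodic_2pi_def)
qed

lemma dilate_periodic:
  assumes "periodic_2pi f" "z \<in> int_vectors"
  shows "dilate f (x + z) = dilate f x"
proof -
  obtain k :: "'a \<Rightarrow> int" where k: "z = (\<chi> j. of_int (k j))" using assms(2) by auto
  have "f (y + (\<Sum>j\<in>J. axis j (2 * pi * of_int (k j)))) = f y" for J y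
  proof (induction J arbitrary: y rule: infinite_finite_induct)
    case (insert j J)
    have "y + (\<Sum>j\<in>insert j J. axis j (2 * pi * of_int (k j)))
        = (y + axis j (2 * pi * of_int (k j))) + (\<Sum>j\<in>J. axis j (2 * pi * of_int (k j)))"
      using insert by (simp add: algebra_simps)
    then show ?case by (simp only: insert.IH periodic_2pi_int[OF assms(1)])
  qed auto
  from this[of "(2 * pi) *\<^sub>R x" UNIV]
  have "f ((2 * pi) *\<^sub>R x + (\<Sum>j\<in>UNIV. axis j (2 * pi * of_int (k j)))) = f ((2 * pi) *\<^sub>R x)" .
  moreover have "(\<Sum>j\<in>UNIV. axis j (2 * pi * of_int (k j))) = (2 * pi) *\<^sub>R z"
  proof -
    have "(\<Sum>j\<in>UNIV. axis j (2 * pi * of_int (k j))) $ i = (\<Sum>j\<in>UNIV. if i = j then 2 * pi * of_int (k j) else 0)" for i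
      unfolding sum_component by (intro sum.cong) (auto simp: axis_def)
    then show ?thesis by (simp add: vec_eq_iff k)
  qed
  ultimately show ?thesis by (simp add: dilate_def scaleR_add_right)
qed

lemma borel_measurable_dilate:
  assumes "f \<in> borel_measurable lebesgue"
  shows "dilate f \<in> borel_measurable lebesgue" "dilate f \<in> borel_measurable torus"
proof -
  have "(\<lambda>x. f ((2 * pi) *\<^sub>R x)) \<in> borel_measurable lebesgue"
    using measurable_compose[OF lebesgue_measurable_scaling assms] .
  then show "dilate f \<in> borel_measurable lebesgue" by (simp add: dilate_def[abs_def])
  then show "dilate f \<in> borel_measurable torus" by (rule measurable_restrict_space1)
qed

lemma dilate_translation:
  assumes f: "f \<in> borel_measurable lebesgue" "periodic_2pi f" and int: "integrable torus (dilate f)"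
  shows "has_bochner_integral torus (\<lambda>x. complex_of_real (dilate f (a + x)) * echar (\<lambda>j. - k j) x)
      (echar k a * fourier_coeff f k)"
    and "integrable torus (\<lambda>x. dilate f (a + x))"
    and "(LINT x|torus. \<bar>dilate f (a + x)\<bar>) = (LINT x|torus. \<bar>dilate f x\<bar>)"
proof -
  note per = dilate_periodic[OF f(2)]
  note [measurable] = borel_measurable_dilate[OF f(1)]
  let ?F = "\<lambda>x. complex_of_real (dilate f x) * echar (\<lambda>j. - k j) x"
  have "integrable torus ?F"
    by (rule Bochner_Integration.integrable_bound[OF int]) (auto simp: norm_mult)
  then have "has_bochner_integral torus ?F (fourier_coeff f k)"
    by (simp add: has_bochner_integral_iff fourier_coeff_dilate fcoef_def)
  then have "has_bochner_integral torus (\<lambda>x. ?F (a + x)) (fourier_coeff f k)"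
  proof (rule has_bochner_integral_tile_translation[OF tiles_unit_cell, rotated 2])
    show "?F \<in> borel_measurable lebesgue" by measurable
    show "?F (x + z) = ?F x" if "z \<in> int_vectors" for x z
      by (simp only: per[OF that] echar_add_right echar_int_vectors[OF that] mult_1_right)
  qed
  then have "has_bochner_integral torus (\<lambda>x. echar k a * ?F (a + x)) (echar k a * fourier_coeff f k)"
    by (rule has_bochner_integral_mult_right) 
  moreover have "echar k a * ?F (a + x) = complex_of_real (dilate f (a + x)) * echar (\<lambda>j. - k j) x" for x
  proof -
    have "echar k a * echar (\<lambda>j. - k j) a = 1" by (simp flip: echar_add)
    then show ?thesis by (simp add: echar_add_right algebra_simps)
  qed
  ultimately show "has_bochner_integral torus (\<lambda>x. complex_of_real (dilate f (a + x)) * echar (\<lambda>j. - k j) x)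
      (echar k a * fourier_coeff f k)" by simp
  have "has_bochner_integral torus (\<lambda>x. dilate f (a + x)) (LINT x|torus. dilate f x)"
    by (rule has_bochner_integral_tile_translation_real[OF tiles_unit_cell])
      (use int in \<open>simp_all only: has_bochner_integral_iff per borel_measurable_dilate[OF f(1)] simp_thms\<close>)
  then show "integrable torus (\<lambda>x. dilate f (a + x))" by (simp add: has_bochner_integral_iff)
  have "has_bochner_integral torus (\<lambda>x. \<bar>dilate f (a + x)\<bar>) (LINT x|torus. \<bar>dilate f x\<bar>)"
    by (rule has_bochner_integral_tile_translation_real[OF tiles_unit_cell, of "\<lambda>x. \<bar>dilate f x\<bar>"])
      (use int in \<open>simp_all only: has_bochner_integral_iff per integrable_abs simp_thms borel_measurable_abs borel_measurable_dilate[OF f(1)]\<close>)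
  then show "(LINT x|torus. \<bar>dilate f (a + x)\<bar>) = (LINT x|torus. \<bar>dilate f x\<bar>)"
    by (simp add: has_bochner_integral_iff)
qed

section \<open>Mixed differences\<close>

text \<open>By the asymptotics of the binomial coefficients the terms are bounded by a constant
  times \<open>n powr (- (\<alpha> + 1))\<close>.\<close>

lemma abs_summable_gbinomial:
  fixes \<alpha> :: real
  assumes "\<alpha> > 0"
  shows "summable (\<lambda>n. \<bar>\<alpha> gchoose n\<bar>)"
proof -
  have "convergent (\<lambda>n. (\<alpha> gchoose n) / ((-1) ^ n / exp ((\<alpha> + 1) * of_real (ln (real n)))))"
    using gbinomial_asymptotic[of \<alpha>] by (auto simp: convergent_def)
  then have "Bseq (\<lambda>n. (\<alpha> gchoose n) / ((-1) ^ n / exp ((\<alpha> + 1) * of_real (ln (real n)))))"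
    by (rule convergent_imp_Bseq)
  then obtain K where K: "\<And>n. norm ((\<alpha> gchoose n) / ((-1) ^ n / exp ((\<alpha> + 1) * of_real (ln (real n))))) \<le> K"
    by (auto simp: Bseq_def)
  show ?thesis
  proof (rule summable_comparison_test')
    show "summable (\<lambda>n. K * real n powr (- (\<alpha> + 1)))"
      using assms by (intro summable_mult) (simp add: summable_real_powr_iff)
    fix n :: nat assume n: "n \<ge> 1"
    have "\<bar>\<alpha> gchoose n\<bar> * real n powr (\<alpha> + 1) \<le> K"
      using K[of n] n by (simp add: abs_mult power_abs powr_def)
    then show "norm \<bar>\<alpha> gchoose n\<bar> \<le> K * real n powr (- (\<alpha> + 1))"
      using n unfolding powr_minus_divide by (simp add: pos_le_divide_eq)
  qed
qed

lemma norm_one_minus_cis: "norm (1 - cis \<theta>) = \<bar>2 * sin (\<theta> / 2)\<bar>"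
proof -
  have "(norm (1 - cis \<theta>))\<^sup>2 = (1 - cos \<theta>)\<^sup>2 + (sin \<theta>)\<^sup>2" by (simp add: cmod_power2)
  also have "\<dots> = 2 - 2 * cos \<theta>"
    using sin_cos_squared_add[of \<theta>] by (simp add: power2_eq_square algebra_simps)
  also have "\<dots> = (2 * sin (\<theta> / 2))\<^sup>2"
    using cos_double_sin[of "\<theta> / 2"] by (simp add: power_mult_distrib)
  finally show ?thesis by (metis norm_ge_zero power2_abs power2_eq_iff_nonneg abs_ge_zero)
qed

text \<open>By dominated convergence the binomial series remains valid on the boundary of the unit disc.\<close>

lemma norm_binomial_series_boundary:
  fixes \<alpha> :: real
  assumes \<alpha>: "\<alpha> > 0"
  shows "norm (\<Sum>n. of_real (\<alpha> gchoose n) * (- cis \<theta>) ^ n) = \<bar>2 * sin (\<theta> / 2)\<bar> powr \<alpha>"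
proof -
  let ?F = "at_left (1::real)"
  define a where "a n x = of_real (\<alpha> gchoose n) * (of_real x * (- cis \<theta>)) ^ n" for n and x :: real
  have gb: "of_real (\<alpha> gchoose n) = (of_real \<alpha> gchoose n :: complex)" for n
    by (simp add: gbinomial_prod_rev)
  have nb: "eventually (\<lambda>x::real. 0 < x \<and> x < 1) ?F"
    by (intro eventually_conj eventually_at_leftI[of 0]) (auto intro: eventually_at_leftI[of 0])
  have "((\<lambda>x. suminf (\<lambda>n. a n x)) \<longlongrightarrow> suminf (\<lambda>n. of_real (\<alpha> gchoose n) * (- cis \<theta>) ^ n)) ?F"
  proof (rule tannerys_theorem[THEN conjunct2, THEN conjunct2])
    show "((\<lambda>x. a n x) \<longlongrightarrow> of_real (\<alpha> gchoose n) * (- cis \<theta>) ^ n) ?F" for n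
    proof -
      have "((\<lambda>x. a n x) \<longlongrightarrow> of_real (\<alpha> gchoose n) * (of_real 1 * (- cis \<theta>)) ^ n) ?F"
        unfolding a_def by (intro tendsto_intros)
      then show ?thesis by simp
    qed
    have "eventually (\<lambda>(n, x). norm (a n x) \<le> \<bar>\<alpha> gchoose n\<bar>) (at_top \<times>\<^sub>F ?F)"
      unfolding eventually_prod_filter
    proof (intro exI conjI allI impI)
      show "eventually (\<lambda>_::nat. True) at_top" by simp
      show "eventually (\<lambda>x::real. 0 < x \<and> x < 1) ?F" by (rule nb)
      fix n :: nat and x :: real assume x: "0 < x \<and> x < 1"
      have "x ^ n \<le> 1" using x by (intro power_le_one) auto
      then show "case (n, x) of (n, x) \<Rightarrow> norm (a n x) \<le> \<bar>\<alpha> gchoose n\<bar>"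
        using x by (simp add: a_def norm_mult norm_power mult_left_le)
    qed
    then show "eventually (\<lambda>(n, x). norm (a n x) \<le> \<bar>\<alpha> gchoose n\<bar>) (at_top \<times>\<^sub>F ?F)" .
  qed (use abs_summable_gbinomial[OF \<alpha>] in auto)
  moreover have "eventually (\<lambda>x. suminf (\<lambda>n. a n x) = (1 + of_real x * (- cis \<theta>)) powr of_real \<alpha>) ?F"
    using nb
  proof eventually_elim
    case (elim x)
    then have "norm (of_real x * (- cis \<theta>)) < 1" by (simp add: norm_mult)
    from gen_binomial_complex[OF this, of "of_real \<alpha>"] show ?case
      by (simp add: a_def gb sums_iff)
  qed
  ultimately have "((\<lambda>x. (1 + of_real x * (- cis \<theta>)) powr of_real \<alpha>) \<longlongrightarrow> suminf (\<lambda>n. of_real (\<alpha> gchoose n) * (- cis \<theta>) ^ n)) ?F"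
    by (rule Lim_transform_eventually)
  from tendsto_norm[OF this]
  have 1: "((\<lambda>x. norm (1 + of_real x * (- cis \<theta>)) powr \<alpha>) \<longlongrightarrow> norm (suminf (\<lambda>n. of_real (\<alpha> gchoose n) * (- cis \<theta>) ^ n))) ?F"
    by (simp add: norm_powr_real_powr')
  have "((\<lambda>x. norm (1 + of_real x * (- cis \<theta>)) powr \<alpha>) \<longlongrightarrow> norm (1 + of_real 1 * (- cis \<theta>)) powr \<alpha>) ?F"
    using \<alpha> by (intro tendsto_powr2 tendsto_intros) auto
  from tendsto_unique[OF _ 1 this] show ?thesis
    by (simp add: norm_one_minus_cis)
qed

lemma product_family_summable:
  fixes a :: "'m::finite \<Rightarrow> nat \<Rightarrow> complex"
  assumes "\<And>j. summable (\<lambda>n. norm (a j n))"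
  shows "(\<lambda>\<nu>. norm (\<Prod>j\<in>UNIV. a j (\<nu> j))) summable_on UNIV"
    and "(\<Sum>\<^sub>\<infinity>\<nu>. \<Prod>j\<in>UNIV. a j (\<nu> j)) = (\<Prod>j\<in>UNIV. \<Sum>n. a j n)"
proof -
  have s: "Infinite_Sum.abs_summable_on (a j) UNIV" for j
    using assms[of j] by (intro norm_summable_imp_summable_on) simp
  have eq: "(PiE UNIV (\<lambda>_. UNIV) :: ('m \<Rightarrow> nat) set) = UNIV" by (simp add: PiE_UNIV_domain)
  have "Infinite_Sum.abs_summable_on (\<lambda>\<nu>. \<Prod>j\<in>UNIV. a j (\<nu> j)) (PiE UNIV (\<lambda>_. UNIV))"
    unfolding abs_summable_equivalent
    by (rule abs_summable_on_prod_PiE) (use s in \<open>auto simp: abs_summable_equivalent\<close>)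
  then show "(\<lambda>\<nu>. norm (\<Prod>j\<in>UNIV. a j (\<nu> j))) summable_on UNIV" by (simp only: eq)
  have inf: "infsum (a j) UNIV = (\<Sum>n. a j n)" for j
    using norm_summable_imp_has_sum[OF assms[of j] summable_sums[OF summable_norm_cancel[OF assms[of j]]]]
    by (rule infsumI)
  have "infsum (\<lambda>\<nu>. \<Prod>j\<in>UNIV. a j (\<nu> j)) (PiE UNIV (\<lambda>_. UNIV)) = (\<Prod>j\<in>UNIV. infsum (a j) UNIV)"
    by (rule infsum_prod_PiE_abs) (use s in auto)
  then show "(\<Sum>\<^sub>\<infinity>\<nu>. \<Prod>j\<in>UNIV. a j (\<nu> j)) = (\<Prod>j\<in>UNIV. \<Sum>n. a j n)" by (simp only: eq inf)
qed

text \<open>Translations preserve the \<open>L^1\<close> norm over the cell, so absolutely summable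
  weights make the series absolutely convergent almost everywhere and integrable term by term. The
  multi-indices are enumerated by the natural numbers because the convergence theorems concern
  sequences.\<close>

lemma fourier_coeff_series:
  fixes f g :: "real^'m \<Rightarrow> real" and b :: "('m \<Rightarrow> nat) \<Rightarrow> real" and s :: "('m \<Rightarrow> nat) \<Rightarrow> real^'m"
  assumes f: "f \<in> borel_measurable lebesgue" "periodic_2pi f" "integrable torus (dilate f)"
    and b: "(\<lambda>\<nu>. norm (b \<nu>)) summable_on UNIV"
    and g: "\<And>x. dilate g x = (\<Sum>\<^sub>\<infinity>\<nu>. b \<nu> * dilate f (s \<nu> + x))"
  shows "integrable torus (dilate g)"
    and "fourier_coeff g k = fourier_coeff f k * (\<Sum>\<^sub>\<infinity>\<nu>. of_real (b \<nu>) * echar k (s \<nu>))"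
proof -
  have inf: "infinite (UNIV :: ('m \<Rightarrow> nat) set)"
  proof
    assume "finite (UNIV :: ('m \<Rightarrow> nat) set)"
    then have "finite (range (\<lambda>n (j::'m). n :: nat))" by (rule finite_subset[rotated]) simp
    moreover have "inj (\<lambda>n (j::'m). n :: nat)" by (auto simp: inj_def fun_eq_iff)
    ultimately show False using finite_imageD infinite_UNIV_nat by blast
  qed
  define e :: "nat \<Rightarrow> 'm \<Rightarrow> nat" where "e = from_nat_into UNIV"
  have e: "bij_betw e UNIV UNIV" unfolding e_def using inf by (intro bij_betw_from_nat_into) auto
  have re: "infsum h UNIV = infsum (\<lambda>i. h (e i)) UNIV" for h :: "('m \<Rightarrow> nat) \<Rightarrow> 'c::{topological_comm_monoid_add,t2_space}"
    using infsum_reindex_bij_betw[OF e, of h] by simp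
  have sb: "summable (\<lambda>i. \<bar>b (e i)\<bar>)"
    using b summable_on_reindex_bij_betw[OF e, of "\<lambda>\<nu>. norm (b \<nu>)"]
    by (intro summable_on_imp_summable) simp
  define G where "G i x = b (e i) * dilate f (s (e i) + x)" for i x
  have intG: "integrable torus (G i)" for i
    unfolding G_def using dilate_translation(2)[OF f, of "s (e i)"] by simp
  define I where "I = (LINT x|torus. \<bar>dilate f x\<bar>)"
  have normG: "(LINT x|torus. norm (G i x)) = \<bar>b (e i)\<bar> * I" for i
    using dilate_translation(2,3)[OF f, of "s (e i)"] by (simp add: G_def abs_mult I_def)
  have sG: "summable (\<lambda>i. LINT x|torus. norm (G i x))"
    unfolding normG by (intro summable_mult2 sb)
  have "(\<integral>\<^sup>+x. (\<Sum>i. ennreal (norm (G i x))) \<partial>torus) = (\<Sum>i. \<integral>\<^sup>+x. ennreal (norm (G i x)) \<partial>torus)"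
    using intG by (intro nn_integral_suminf) auto
  also have "\<dots> = (\<Sum>i. ennreal (LINT x|torus. norm (G i x)))"
    using intG by (subst nn_integral_eq_integral) auto
  also have "\<dots> = ennreal (\<Sum>i. LINT x|torus. norm (G i x))"
    using sG by (intro suminf_ennreal2) (auto simp: integral_nonneg_AE)
  finally have "(\<integral>\<^sup>+x. (\<Sum>i. ennreal (norm (G i x))) \<partial>torus) \<noteq> \<infinity>" by simp
  then have "AE x in torus. (\<Sum>i. ennreal (norm (G i x))) \<noteq> \<infinity>"
    using intG by (intro nn_integral_noteq_infinite) auto
  then have AEs: "AE x in torus. summable (\<lambda>i. norm (G i x))"
    by eventually_elim (auto intro: summable_suminf_not_top)
  have AEg: "AE x in torus. dilate g x = (\<Sum>i. G i x)"
    using AEs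
  proof eventually_elim
    case (elim x)
    have "dilate g x = infsum (\<lambda>i. G i x) UNIV" by (simp only: g re G_def)
    also have "\<dots> = (\<Sum>i. G i x)"
      using norm_summable_imp_has_sum[OF elim summable_sums[OF summable_norm_cancel[OF elim]]]
      by (rule infsumI)
    finally show ?case .
  qed
  have intS: "integrable torus (\<lambda>x. \<Sum>i. G i x)"
    using intG AEs sG by (rule integrable_suminf)
  have meas: "dilate g \<in> borel_measurable torus"
    using borel_measurable_integrable[OF intS] AEg by (rule borel_measurable_torus_cong_AE)
  show "integrable torus (dilate g)"
    using intS by (rule integrable_cong_AE_imp) (use meas AEg in \<open>auto elim: eventually_mono\<close>)
  define H where "H i x = complex_of_real (G i x) * echar (\<lambda>j. - k j) x" for i x
  have H: "has_bochner_integral torus (H i) (of_real (b (e i)) * (echar k (s (e i)) * fourier_coeff f k))" for i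
    using has_bochner_integral_mult_right[OF dilate_translation(1)[OF f, of "s (e i)" k], of "of_real (b (e i))"]
    by (simp add: H_def[abs_def] G_def mult.assoc)
  have sH: "summable (\<lambda>i. LINT x|torus. norm (H i x))"
    using sG by (simp add: H_def norm_mult)
  have AEsH: "AE x in torus. summable (\<lambda>i. norm (H i x))"
    using AEs by eventually_elim (simp add: H_def norm_mult)
  have intH: "integrable torus (H i)" for i using H by (simp add: has_bochner_integral_iff)
  have "fourier_coeff g k = (LINT x|torus. complex_of_real (dilate g x) * echar (\<lambda>j. - k j) x)"
    by (simp add: fourier_coeff_dilate fcoef_def)
  also have "\<dots> = (LINT x|torus. (\<Sum>i. H i x))"
  proof (rule integral_cong_AE)
    show "AE x in torus. complex_of_real (dilate g x) * echar (\<lambda>j. - k j) x = (\<Sum>i. H i x)"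
      using AEg AEs
    proof eventually_elim
      case (elim x)
      have "summable (\<lambda>i. G i x)" using elim(2) by (rule summable_norm_cancel)
      then show ?case unfolding H_def elim(1)
        by (subst suminf_mult2[symmetric]) (auto simp: summable_of_real suminf_of_real)
    qed
  qed (use meas intH in measurable)
  also have "\<dots> = (\<Sum>i. integral\<^sup>L torus (H i))"
    using intH AEsH sH by (rule integral_suminf)
  also have "\<dots> = (\<Sum>i. fourier_coeff f k * (of_real (b (e i)) * echar k (s (e i))))"
    using H by (simp add: has_bochner_integral_iff mult_ac)
  also have "\<dots> = fourier_coeff f k * (\<Sum>i. of_real (b (e i)) * echar k (s (e i)))"
    by (rule suminf_mult, rule summable_norm_cancel) (use sb in \<open>simp add: norm_mult\<close>)
  also have "(\<Sum>i. of_real (b (e i)) * echar k (s (e i))) = infsum (\<lambda>i. of_real (b (e i)) * echar k (s (e i))) UNIV"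
  proof -
    have "summable (\<lambda>i. norm (of_real (b (e i)) * echar k (s (e i))))" using sb by (simp add: norm_mult)
    from infsumI[OF norm_summable_imp_has_sum[OF this summable_sums[OF summable_norm_cancel[OF this]]]]
    show ?thesis by simp
  qed
  also have "\<dots> = (\<Sum>\<^sub>\<infinity>\<nu>. of_real (b \<nu>) * echar k (s \<nu>))" by (rule re[symmetric])
  finally show "fourier_coeff g k = fourier_coeff f k * (\<Sum>\<^sub>\<infinity>\<nu>. of_real (b \<nu>) * echar k (s \<nu>))" .
qed

text \<open>Each translate contributes a phase, and the multiplier factorises over the axes into
  \<open>cis (k j * \<alpha> $ j * h $ j)\<close> times the binomial series of
  \<open>1 - cis (- k j * h $ j)\<close> with exponent \<open>\<alpha> $ j\<close>. Only its modulus
  is recorded, which avoids any choice of branch for the complex power.\<close>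

lemma mixed_difference_fourier:
  fixes f :: "real^'m \<Rightarrow> real"
  assumes \<alpha>: "\<And>j. \<alpha> $ j > 0"
    and f: "f \<in> borel_measurable lebesgue" "periodic_2pi f" "integrable torus (dilate f)"
  shows "integrable torus (dilate (mixed_difference \<alpha> h f))"
    and "norm (fourier_coeff (mixed_difference \<alpha> h f) k) =
      norm (fourier_coeff f k) * (\<Prod>j\<in>UNIV. \<bar>2 * sin (of_int (k j) * h $ j / 2)\<bar> powr (\<alpha> $ j))"
proof -
  define b :: "('m \<Rightarrow> nat) \<Rightarrow> real" where "b \<nu> = (\<Prod>j\<in>UNIV. (-1) ^ \<nu> j * ((\<alpha> $ j) gchoose \<nu> j))" for \<nu>
  \<comment> \<open>The steps are divided by \<open>2 * pi\<close> because \<open>dilate f\<close>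
    lives in the variable of the unit cell.\<close>
  define s :: "('m \<Rightarrow> nat) \<Rightarrow> real^'m" where "s \<nu> = (\<chi> i. (\<alpha> $ i - real (\<nu> i)) * h $ i / (2 * pi))" for \<nu>
  have s: "(2 * pi) *\<^sub>R (s \<nu> + x) = (2 * pi) *\<^sub>R x + (\<Sum>i\<in>UNIV. ((\<alpha> $ i - real (\<nu> i)) * h $ i) *\<^sub>R axis i 1)" for \<nu> x
  proof -
    have comp: "(\<Sum>i\<in>UNIV. ((\<alpha> $ i - real (\<nu> i)) * h $ i) *\<^sub>R (axis i 1 :: real^'m)) $ l
        = (\<Sum>i\<in>UNIV. if l = i then (\<alpha> $ i - real (\<nu> i)) * h $ i else 0)" for l
      unfolding sum_component by (intro sum.cong) (auto simp: axis_def)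
    show ?thesis
      unfolding vec_eq_iff vector_add_component vector_scaleR_component comp by (simp add: s_def field_simps)
  qed
  have b: "b \<nu> = (-1) ^ (\<Sum>j\<in>UNIV. \<nu> j) * (\<Prod>j\<in>UNIV. (\<alpha> $ j) gchoose \<nu> j)" for \<nu>
    by (simp add: b_def prod.distrib power_sum)
  have g: "dilate (mixed_difference \<alpha> h f) x = (\<Sum>\<^sub>\<infinity>\<nu>. b \<nu> * dilate f (s \<nu> + x))" for x
    by (simp only: dilate_def mixed_difference_def s b)
  define a where "a j n = of_real ((-1) ^ n * ((\<alpha> $ j) gchoose n)) * cis (of_int (k j) * (\<alpha> $ j - real n) * h $ j)" for j n
  have na: "norm (a j n) = \<bar>(\<alpha> $ j) gchoose n\<bar>" for j n
    by (simp add: a_def norm_mult norm_power power_abs abs_mult)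
  have suma: "summable (\<lambda>n. norm (a j n))" for j
    unfolding na by (rule abs_summable_gbinomial[OF \<alpha>])
  have echar_s: "echar k (s \<nu>) = (\<Prod>j\<in>UNIV. cis (of_int (k j) * (\<alpha> $ j - real (\<nu> j)) * h $ j))" for \<nu>
  proof -
    have "cis (sum t J) = (\<Prod>j\<in>J. cis (t j))" for t :: "'m \<Rightarrow> real" and J
      by (induction J rule: infinite_finite_induct) (auto simp: cis_mult[symmetric])
    moreover have "2 * pi * (\<Sum>j\<in>UNIV. of_int (k j) * s \<nu> $ j) = (\<Sum>j\<in>UNIV. of_int (k j) * (\<alpha> $ j - real (\<nu> j)) * h $ j)"
      unfolding sum_distrib_left by (intro sum.cong) (auto simp: s_def)
    ultimately show ?thesis by (simp add: echar_def)
  qed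
  have ab: "of_real (b \<nu>) * echar k (s \<nu>) = (\<Prod>j\<in>UNIV. a j (\<nu> j))" for \<nu>
    unfolding b_def echar_s a_def by (simp add: prod.distrib)
  have "norm (b \<nu>) = norm (\<Prod>j\<in>UNIV. a j (\<nu> j))" for \<nu>
    unfolding ab[symmetric] by (simp add: norm_mult)
  then have sb: "(\<lambda>\<nu>. norm (b \<nu>)) summable_on UNIV"
    using product_family_summable(1)[of a, OF suma] by simp
  show "integrable torus (dilate (mixed_difference \<alpha> h f))"
    by (rule fourier_coeff_series(1)[OF f sb g])
  have 1: "norm (\<Sum>n. a j n) = \<bar>2 * sin (of_int (k j) * h $ j / 2)\<bar> powr (\<alpha> $ j)" for j
  proof -
    define \<theta> where "\<theta> = - (of_int (k j) * h $ j)"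
    have "a j n = cis (of_int (k j) * \<alpha> $ j * h $ j) * (of_real ((\<alpha> $ j) gchoose n) * (- cis \<theta>) ^ n)" for n
    proof -
      have "of_int (k j) * (\<alpha> $ j - real n) * h $ j = of_int (k j) * \<alpha> $ j * h $ j + real n * \<theta>"
        by (simp add: \<theta>_def algebra_simps)
      then have "cis (of_int (k j) * (\<alpha> $ j - real n) * h $ j) = cis (of_int (k j) * \<alpha> $ j * h $ j) * cis \<theta> ^ n"
        by (simp only: cis_mult Complex.DeMoivre)
      then show ?thesis by (simp add: a_def power_minus[of "cis \<theta>"])
    qed
    moreover have "summable (\<lambda>n. of_real ((\<alpha> $ j) gchoose n) * (- cis \<theta>) ^ n)"
      by (rule summable_norm_cancel) (use abs_summable_gbinomial[OF \<alpha>] in \<open>simp add: norm_mult norm_power\<close>)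
    ultimately have "(\<Sum>n. a j n) = cis (of_int (k j) * \<alpha> $ j * h $ j) * (\<Sum>n. of_real ((\<alpha> $ j) gchoose n) * (- cis \<theta>) ^ n)"
      by (simp add: suminf_mult)
    then have "norm (\<Sum>n. a j n) = \<bar>2 * sin (\<theta> / 2)\<bar> powr (\<alpha> $ j)"
      using norm_binomial_series_boundary[OF \<alpha>] by (simp add: norm_mult)
    then show ?thesis by (simp add: \<theta>_def)
  qed
  have "fourier_coeff (mixed_difference \<alpha> h f) k = fourier_coeff f k * (\<Prod>j\<in>UNIV. \<Sum>n. a j n)"
    unfolding fourier_coeff_series(2)[OF f sb g] ab product_family_summable(2)[of a, OF suma] ..
  then show "norm (fourier_coeff (mixed_difference \<alpha> h f) k) =
      norm (fourier_coeff f k) * (\<Prod>j\<in>UNIV. \<bar>2 * sin (of_int (k j) * h $ j / 2)\<bar> powr (\<alpha> $ j))"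
    by (simp add: norm_mult prod_norm[symmetric] 1)
qed

section \<open>Lacunary functions and angular approximation\<close>

text \<open>Expanding every cosine by Euler's formula turns the product into a sum of characters
  over all sign patterns \<open>\<epsilon>\<close>, with frequencies
  \<open>\<epsilon> j * 2 ^ \<nu> j\<close>.\<close>

lemma fourier_coeff_cos_prod:
  fixes \<nu> :: "'m::finite \<Rightarrow> nat"
  assumes "\<exists>j. \<bar>k j\<bar> \<noteq> 2 ^ \<nu> j"
  shows "fourier_coeff (\<lambda>x. \<Prod>j\<in>UNIV. cos (2 ^ \<nu> j * x $ j)) k = 0"
proof -
  define S where "S = PiE (UNIV :: 'm set) (\<lambda>_. {1, -1 :: int})"
  have eq: "complex_of_real (\<Prod>j\<in>UNIV. cos (2 ^ \<nu> j * (((2 * pi) *\<^sub>R x) $ j)))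
      = (\<Sum>\<epsilon>\<in>S. (1 / 2) ^ CARD('m) * echar (\<lambda>j. \<epsilon> j * 2 ^ \<nu> j) x)" for x :: "real^'m"
  proof -
    have cosE: "complex_of_real (cos (2 ^ \<nu> j * (((2 * pi) *\<^sub>R x) $ j)))
        = (\<Sum>e\<in>{1, -1 :: int}. 1 / 2 * cis (2 * pi * of_int (e * 2 ^ \<nu> j) * x $ j))" for j
      by (simp add: complex_eq_iff mult_ac)
    have prodE: "(\<Prod>j\<in>UNIV. cis (2 * pi * of_int (\<epsilon> j * 2 ^ \<nu> j) * x $ j)) = echar (\<lambda>j. \<epsilon> j * 2 ^ \<nu> j) x" for \<epsilon> :: "'m \<Rightarrow> int"
    proof -
      have "cis (sum t J) = (\<Prod>j\<in>J. cis (t j))" for t :: "'m \<Rightarrow> real" and J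
        by (induction J rule: infinite_finite_induct) (auto simp: cis_mult[symmetric])
      then show ?thesis by (simp add: echar_def sum_distrib_left mult.assoc)
    qed
    have "complex_of_real (\<Prod>j\<in>UNIV. cos (2 ^ \<nu> j * (((2 * pi) *\<^sub>R x) $ j)))
        = (\<Prod>j\<in>UNIV. \<Sum>e\<in>{1, -1 :: int}. 1 / 2 * cis (2 * pi * of_int (e * 2 ^ \<nu> j) * x $ j))"
      unfolding of_real_prod cosE ..
    also have "\<dots> = (\<Sum>\<epsilon>\<in>S. \<Prod>j\<in>UNIV. 1 / 2 * cis (2 * pi * of_int (\<epsilon> j * 2 ^ \<nu> j) * x $ j))"
      unfolding S_def by (rule prod_sum_PiE) auto
    also have "\<dots> = (\<Sum>\<epsilon>\<in>S. (1 / 2) ^ CARD('m) * echar (\<lambda>j. \<epsilon> j * 2 ^ \<nu> j) x)"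
      unfolding prod.distrib prodE by simp
    finally show ?thesis .
  qed
  have ne: "(\<lambda>j. \<epsilon> j * 2 ^ \<nu> j + - k j) \<noteq> (\<lambda>_. 0)" if "\<epsilon> \<in> S" for \<epsilon>
  proof
    assume "(\<lambda>j. \<epsilon> j * 2 ^ \<nu> j + - k j) = (\<lambda>_. 0)"
    then have "k j = \<epsilon> j * 2 ^ \<nu> j" for j by (simp add: fun_eq_iff)
    moreover have "\<epsilon> j = 1 \<or> \<epsilon> j = (-1)" for j
      using PiE_mem[OF that[unfolded S_def], of j] by auto
    ultimately have "\<bar>k j\<bar> = 2 ^ \<nu> j" for j
      by (metis abs_minus_cancel abs_mult abs_one abs_power2 mult_1 mult_minus_left power_abs abs_numeral)
    with assms show False by auto
  qed
  have "has_bochner_integral torus (\<lambda>x. \<Sum>\<epsilon>\<in>S. (1 / 2) ^ CARD('m) * echar (\<lambda>j. \<epsilon> j * 2 ^ \<nu> j + - k j) x)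
      (\<Sum>\<epsilon>\<in>S. (1 / 2) ^ CARD('m) * (if (\<lambda>j. \<epsilon> j * 2 ^ \<nu> j + - k j) = (\<lambda>_. 0) then 1 else 0))"
    by (intro has_bochner_integral_sum has_bochner_integral_mult_right has_bochner_integral_echar)
  then have "(LINT x|torus. (\<Sum>\<epsilon>\<in>S. (1 / 2) ^ CARD('m) * echar (\<lambda>j. \<epsilon> j * 2 ^ \<nu> j + - k j) x)) = 0"
    using ne by (simp add: has_bochner_integral_iff)
  then show ?thesis
    unfolding fourier_coeff_eq_fcoef fcoef_def eq by (simp only: sum_distrib_right echar_add mult.assoc)
qed

lemma has_lacunary_series_spectrum:
  assumes "has_lacunary_series f c" "k \<notin> lacunary"
  shows "fourier_coeff f k = 0"
proof -
  have "fourier_coeff (\<lambda>x. \<Prod>j\<in>UNIV. cos (2 ^ \<nu> j * x $ j)) k = 0" for \<nu> :: "'a \<Rightarrow> nat"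
    using assms(2) by (intro fourier_coeff_cos_prod) (auto simp: lacunary_def)
  then show ?thesis using assms(1) by (simp add: has_lacunary_series_def)
qed

text \<open>Every preimage is a countable union of translates of its part in one tile. This is
  needed for slices of \<open>f\<close>, whose measurability is at first known over one period
  only.\<close>

lemma tiles_borel_measurable:
  fixes F :: "'a::euclidean_space \<Rightarrow> real"
  assumes t: "tiles D Z" and F: "F \<in> borel_measurable (lebesgue_on D)"
    and per: "\<And>x z. z \<in> Z \<Longrightarrow> F (x + z) = F x"
  shows "F \<in> borel_measurable lebesgue"
proof (rule measurableI)
  fix A :: "real set" assume A: "A \<in> sets borel"
  have D: "D \<in> sets lebesgue" and Z: "countable Z" and ex: "\<And>x. \<exists>!z. z \<in> Z \<and> x - z \<in> D"
    using t by (auto simp: tiles_def)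
  define E where "E = {x \<in> D. F x \<in> A}"
  have "F -` A \<inter> space (lebesgue_on D) \<in> sets (lebesgue_on D)"
    using F A by (rule measurable_sets)
  then have E: "E \<in> sets lebesgue"
    using D by (simp add: E_def space_restrict_space sets_restrict_space_iff vimage_def Int_def conj_commute)
  have "F -` A \<inter> space lebesgue = (\<Union>z\<in>Z. (+) z ` E)"
  proof (intro equalityI subsetI)
    fix x assume x: "x \<in> F -` A \<inter> space lebesgue"
    obtain z where z: "z \<in> Z" "x - z \<in> D" using ex[of x] by blast
    have "F (x - z) = F x" using per[OF z(1), of "x - z"] by simp
    then have "x - z \<in> E" using x z by (simp add: E_def)
    then show "x \<in> (\<Union>z\<in>Z. (+) z ` E)" using z(1) by (intro UN_I[of z] image_eqI[of _ _ "x - z"]) auto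
  next
    fix x assume "x \<in> (\<Union>z\<in>Z. (+) z ` E)"
    then obtain z y where "z \<in> Z" "y \<in> E" "x = z + y" by blast
    then show "x \<in> F -` A \<inter> space lebesgue" using per[of z y] by (simp add: E_def add.commute)
  qed
  also have "\<dots> \<in> sets lebesgue"
    using Z E by (intro sets.countable_UN') (auto intro: lebesgue_sets_translation)
  finally show "F -` A \<inter> space lebesgue \<in> sets lebesgue" .
qed simp

section \<open>Vanishing integrals along the axes\<close>

text \<open>The zero-mean condition integrates over a closed interval, whose translates overlap at
  the endpoints; dropping the null set \<open>{1}\<close> gives the half-open interval, which tiles
  the line.\<close>

lemma has_bochner_integral_unit_interval_translation:
  fixes \<phi> :: "real \<Rightarrow> real"
  assumes per: "\<And>x n. \<phi> (x + of_int n) = \<phi> x" and I: "has_bochner_integral (lebesgue_on {0..1}) \<phi> I"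
  shows "has_bochner_integral (lebesgue_on {0..1}) (\<lambda>s. \<phi> (a + s)) I"
proof -
  have per': "\<phi> (x + z) = \<phi> x" if "z \<in> \<int>" for x z using that per by (auto elim: Ints_cases)
  have "\<phi> \<in> borel_measurable (lebesgue_on {0..1})"
    using I unfolding has_bochner_integral_iff by (blast intro: borel_measurable_integrable)
  then have "\<phi> \<in> borel_measurable (lebesgue_on {0..<1})"
    by (rule measurable_restrict_mono) auto
  then have m: "\<phi> \<in> borel_measurable lebesgue"
    by (rule tiles_borel_measurable[OF tiles_unit_interval]) (rule per')
  have ma: "(\<lambda>s. \<phi> (a + s)) \<in> borel_measurable lebesgue"
    using measurable_compose[OF measurable_lebesgue_translation m] .
  have iff: "has_bochner_integral (lebesgue_on {0..1}) \<psi> I \<longleftrightarrow> has_bochner_integral (lebesgue_on {0..<1}) \<psi> I"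
    if \<psi>[measurable]: "\<psi> \<in> borel_measurable lebesgue" for \<psi> :: "real \<Rightarrow> real"
  proof -
    have "AE x in lebesgue. x \<noteq> (1::real)"
      by (rule AE_completion[OF AE_lborel_singleton])
    then have "AE x in lebesgue. indicator {0..1} x *\<^sub>R \<psi> x = indicator {0..<1} x *\<^sub>R \<psi> x"
      by eventually_elim (auto simp: indicator_def)
    then have "has_bochner_integral lebesgue (\<lambda>x. indicator {0..1} x *\<^sub>R \<psi> x) I
        \<longleftrightarrow> has_bochner_integral lebesgue (\<lambda>x. indicator {0..<1} x *\<^sub>R \<psi> x) I"
    proof (rule has_bochner_integral_cong_AE[rotated 2])
      show "(\<lambda>x. indicator {0..1} x *\<^sub>R \<psi> x) \<in> borel_measurable lebesgue"
        "(\<lambda>x. indicator {0..<1} x *\<^sub>R \<psi> x) \<in> borel_measurable lebesgue"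
        by (intro borel_measurable_scaleR borel_measurable_indicator \<psi>; simp)+
    qed
    then show ?thesis by (simp add: has_bochner_integral_restrict_space)
  qed
  show ?thesis
    unfolding iff[OF ma]
    by (rule has_bochner_integral_tile_translation_real[OF tiles_unit_interval m])
      (use per' I iff[OF m] in auto)
qed

abbreviation slice_pt :: "'m \<Rightarrow> real \<Rightarrow> real^'m \<Rightarrow> real^'m" where
  "slice_pt i s x \<equiv> (2 * pi) *\<^sub>R (\<chi> l. if l = i then s else x $ l)"

definition zero_mean :: "(real^'m \<Rightarrow> real) \<Rightarrow> bool" where
  "zero_mean f \<longleftrightarrow> (\<forall>i. AE x in lebesgue.
     has_bochner_integral (lebesgue_on {0..1}) (\<lambda>s. f (slice_pt i s x)) 0)"

lemma zero_mean_diff: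
  assumes "zero_mean f" "zero_mean g"
  shows "zero_mean (\<lambda>x. f x - g x)"
  unfolding zero_mean_def
proof
  fix i
  have "AE x in lebesgue.
     has_bochner_integral (lebesgue_on {0..1}) (\<lambda>s. f (slice_pt i s x)) 0"
    "AE x in lebesgue.
     has_bochner_integral (lebesgue_on {0..1}) (\<lambda>s. g (slice_pt i s x)) 0"
    using assms by (auto simp: zero_mean_def)
  then show "AE x in lebesgue. has_bochner_integral (lebesgue_on {0..1})
     (\<lambda>s. f (slice_pt i s x) - g (slice_pt i s x)) 0"
  proof eventually_elim
    case (elim x)
    from has_bochner_integral_diff[OF elim] show ?case by simp
  qed
qed

lemma zero_mean_average:
  assumes "\<And>s. s < N \<Longrightarrow> zero_mean (f s)"
  shows "zero_mean (\<lambda>x. (\<Sum>s<N. f s x) / real N)"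
  unfolding zero_mean_def
proof
  fix i
  have "AE x in lebesgue. \<forall>s\<in>{..<N}.
     has_bochner_integral (lebesgue_on {0..1}) (\<lambda>t. f s (slice_pt i t x)) 0"
    using assms by (subst AE_finite_all) (auto simp: zero_mean_def)
  then show "AE x in lebesgue. has_bochner_integral (lebesgue_on {0..1})
     (\<lambda>t. (\<Sum>s<N. f s (slice_pt i t x)) / real N) 0"
  proof eventually_elim
    case (elim x)
    have "has_bochner_integral (lebesgue_on {0..1})
     (\<lambda>t. (\<Sum>s<N. f s (slice_pt i t x)) / real N) ((\<Sum>s<N. 0) / real N)"
      by (intro has_bochner_integral_divide_zero has_bochner_integral_sum) (use elim in auto)
    then show ?case by simp
  qed
qed

text \<open>In the direction of the translation each slice is merely shifted, and periodicity keeps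
  its integral. In any other direction the slice moves to a parallel one, and the exceptional null
  set is translated along with it.\<close>

lemma zero_mean_translation:
  fixes f :: "real^'m \<Rightarrow> real"
  assumes zm: "zero_mean f" and per: "periodic_2pi f"
  shows "zero_mean (\<lambda>x. f (x + axis j (2 * pi * c)))"
  unfolding zero_mean_def
proof
  fix i :: 'm
  define P where "P x \<longleftrightarrow> has_bochner_integral (lebesgue_on {0..1})
    (\<lambda>s. f (slice_pt i s x)) 0" for x
  have P: "AE x in lebesgue. P x" using zm by (simp add: zero_mean_def P_def)
  show "AE x in lebesgue. has_bochner_integral (lebesgue_on {0..1})
     (\<lambda>s. f (slice_pt i s x + axis j (2 * pi * c))) 0"
  proof (cases "i = j")
    case True
    show ?thesis using P
    proof eventually_elim
      case (elim x)
      define \<phi> where "\<phi> s = f (slice_pt i s x)" for s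
      have "\<phi> (s + of_int n) = \<phi> s" for s n
      proof -
        have "slice_pt i (s + of_int n) x
            = slice_pt i s x + axis i (2 * pi * of_int n)"
          by (simp add: vec_eq_iff axis_def algebra_simps)
        then show ?thesis by (simp only: \<phi>_def periodic_2pi_int[OF per])
      qed
      moreover have "has_bochner_integral (lebesgue_on {0..1}) \<phi> 0"
        using elim unfolding P_def \<phi>_def[abs_def] .
      ultimately have "has_bochner_integral (lebesgue_on {0..1}) (\<lambda>s. \<phi> (c + s)) 0"
        by (rule has_bochner_integral_unit_interval_translation)
      moreover have "slice_pt i (c + s) x
            = slice_pt i s x + axis j (2 * pi * c)" for s
        using True by (simp add: vec_eq_iff axis_def algebra_simps)
      ultimately show ?case by (simp only: \<phi>_def)
    qed
  next
    case False
    have "AE x in distr lebesgue lebesgue (\<lambda>x. axis j c + x). P x"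
      using P by (simp only: lebesgue_eq_distr_translation[symmetric])
    then have "AE x in lebesgue. P (axis j c + x)"
      by (rule AE_distrD[OF measurable_lebesgue_translation])
    moreover have "(2 * pi) *\<^sub>R (\<chi> l. if l = i then s else (axis j c + x) $ l)
        = slice_pt i s x + axis j (2 * pi * c)" for s x
      using False by (simp add: vec_eq_iff axis_def algebra_simps)
    ultimately show ?thesis by (simp only: P_def)
  qed
qed

text \<open>The class in which the approximants are constructed. Finite energy takes the place of a
  finite Lorentz norm, to which it is equivalent here, because it is visibly inherited when
  coefficients are deleted.\<close>

definition lacunary_fun :: "(real^'m \<Rightarrow> real) \<Rightarrow> bool" where
  "lacunary_fun f \<longleftrightarrow> f \<in> borel_measurable lebesgue \<and> periodic_2pi f \<and> integrable torus (dilate f) \<and>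
     (\<forall>k. k \<notin> lacunary \<longrightarrow> fourier_coeff f k = 0) \<and> energy f (\<lambda>_. 1) < \<infinity> \<and> zero_mean f"

lemma lacunary_fun_lorentz:
  assumes "p > 1" "\<tau> > 0" "lacunary_fun f"
  shows "f \<in> lorentz_space_zero_mean p \<tau>"
proof -
  obtain C where "(lorentz_norm p \<tau> f)\<^sup>2 \<le> ennreal C * energy f (\<lambda>_. 1)"
    using lorentz_norm_le_energy[OF assms(1,2), where 'm = 'a] assms(3) unfolding lacunary_fun_def by blast
  also have "\<dots> < \<infinity>" using assms(3) by (simp add: lacunary_fun_def ennreal_mult_less_top)
  finally have "lorentz_norm p \<tau> f < \<infinity>"
    by (cases "lorentz_norm p \<tau> f") auto
  then show ?thesis
    using assms(3) by (simp add: lacunary_fun_def lorentz_space_zero_mean_def lorentz_space_def periodic_2pi_def zero_mean_def)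
qed

lemma lacunary_class_lacunary_fun:
  assumes p: "p > 1" "\<tau> > 0" and f: "f \<in> lacunary_class p \<tau>"
  shows "lacunary_fun f"
proof -
  have m: "f \<in> borel_measurable lebesgue" and fin: "lorentz_norm p \<tau> f < \<infinity>"
    using f by (auto simp: lacunary_class_def lorentz_space_zero_mean_def lorentz_space_def)
  have "integrable torus (dilate f)"
    by (rule integrable_if_lorentz_norm_finite[OF p borel_measurable_dilate(2)[OF m] fin])
  moreover obtain C where "energy f (\<lambda>_. 1) \<le> ennreal C * (lorentz_norm p \<tau> f)\<^sup>2"
    using energy_le_lorentz_norm[OF p, where 'm = 'a] borel_measurable_dilate(2)[OF m] by blast
  moreover have "ennreal C * (lorentz_norm p \<tau> f)\<^sup>2 < \<infinity>"
    using fin by (simp add: ennreal_mult_less_top power_less_top_ennreal)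
  ultimately show ?thesis
    using f has_lacunary_series_spectrum
    by (auto simp: lacunary_fun_def lacunary_class_def lorentz_space_zero_mean_def lorentz_space_def
        periodic_2pi_def zero_mean_def)
qed

lemma fourier_coeff_diff:
  assumes "integrable torus (dilate f)" "integrable torus (dilate g)"
  shows "integrable torus (dilate (\<lambda>x. f x - g x))"
    and "fourier_coeff (\<lambda>x. f x - g x) k = fourier_coeff f k - fourier_coeff g k"
proof -
  have d: "dilate (\<lambda>x. f x - g x) = (\<lambda>x. dilate f x - dilate g x)" by (simp add: dilate_def fun_eq_iff)
  show "integrable torus (dilate (\<lambda>x. f x - g x))" unfolding d using assms by (rule Bochner_Integration.integrable_diff)
  have i: "integrable torus (\<lambda>x. complex_of_real (dilate u x) * echar (\<lambda>j. - k j) x)"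
    if "integrable torus (dilate u)" for u
    by (rule Bochner_Integration.integrable_bound[OF that]) (use that in \<open>auto simp: norm_mult\<close>)
  show "fourier_coeff (\<lambda>x. f x - g x) k = fourier_coeff f k - fourier_coeff g k"
    using i[OF assms(1)] i[OF assms(2)]
    by (simp add: fourier_coeff_dilate fcoef_def d left_diff_distrib)
qed

lemma fourier_coeff_diff_sum:
  assumes "integrable torus (dilate f)" "\<And>j. j \<in> J \<Longrightarrow> integrable torus (dilate (T j))"
  shows "integrable torus (dilate (\<lambda>x. f x - (\<Sum>j\<in>J. T j x))) \<and>
    fourier_coeff (\<lambda>x. f x - (\<Sum>j\<in>J. T j x)) k = fourier_coeff f k - (\<Sum>j\<in>J. fourier_coeff (T j) k)"
  using assms(2)
proof (induction J rule: infinite_finite_induct)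
  case (insert j J)
  let ?g = "\<lambda>x. f x - (\<Sum>j\<in>J. T j x)"
  have eq: "(\<lambda>x. f x - (\<Sum>j\<in>insert j J. T j x)) = (\<lambda>x. ?g x - T j x)" using insert.hyps by (simp add: algebra_simps)
  show ?case unfolding eq using insert fourier_coeff_diff[of ?g "T j"] by simp
qed (use assms(1) in auto)

lemma energy_mono:
  assumes "\<And>k. k \<in> lacunary \<Longrightarrow> w k * (norm (fourier_coeff f k))\<^sup>2 \<le> v k * (norm (fourier_coeff g k))\<^sup>2"
  shows "energy f w \<le> energy g v"
  unfolding energy_def using assms by (intro nn_integral_mono ennreal_leI) auto

lemma lacunary_fun_diff:
  assumes "lacunary_fun f" "lacunary_fun g" "\<And>k. fourier_coeff g k = fourier_coeff f k \<or> fourier_coeff g k = 0"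
  shows "lacunary_fun (\<lambda>x. f x - g x)"
proof -
  have int: "integrable torus (dilate f)" "integrable torus (dilate g)" using assms by (auto simp: lacunary_fun_def)
  note co = fourier_coeff_diff[OF int]
  have "energy (\<lambda>x. f x - g x) (\<lambda>_. 1) \<le> energy f (\<lambda>_. 1)"
  proof (rule energy_mono)
    fix k
    have "norm (fourier_coeff f k - fourier_coeff g k) \<le> norm (fourier_coeff f k)"
      using assms(3)[of k] by (elim disjE) simp_all
    then show "1 * (norm (fourier_coeff (\<lambda>x. f x - g x) k))\<^sup>2 \<le> 1 * (norm (fourier_coeff f k))\<^sup>2"
      unfolding co(2) by (simp add: power_mono)
  qed
  then have "energy (\<lambda>x. f x - g x) (\<lambda>_. 1) < \<infinity>"
    using assms(1) by (auto simp: lacunary_fun_def intro: le_less_trans)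
  then show ?thesis using assms(1,2) co zero_mean_diff[of f g] unfolding lacunary_fun_def
    by (auto simp: periodic_2pi_def)
qed

section \<open>Projections by averaging over translates\<close>

definition axis_average :: "'m \<Rightarrow> nat \<Rightarrow> (real^'m \<Rightarrow> real) \<Rightarrow> real^'m \<Rightarrow> real" where
  "axis_average j N f x = (\<Sum>s<N. f (x + axis j (2 * pi * (real s / real N)))) / real N"

lemma sum_roots_of_unity:
  assumes N: "N > 0"
  shows "(\<Sum>s<N. cis (2 * pi * of_int k * (real s / real N))) = (if int N dvd k then of_nat N else 0)"
proof -
  define z where "z = cis (2 * pi * of_int k / real N)"
  have zs: "cis (2 * pi * of_int k * (real s / real N)) = z ^ s" for s
    by (simp add: z_def Complex.DeMoivre mult_ac)
  show ?thesis
  proof (cases "int N dvd k")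
    case True
    then obtain q where "k = int N * q" by blast
    then have "2 * pi * of_int k / real N = 2 * pi * of_int q" using N by simp
    then have "z = 1" unfolding z_def by (simp only: cis_multiple_2pi[OF Ints_of_int])
    then show ?thesis unfolding zs using True by simp
  next
    case False
    have "z \<noteq> 1"
    proof
      assume "z = 1"
      then have "cos (2 * pi * of_int k / real N) = 1" by (simp add: z_def complex_eq_iff)
      then obtain n :: int where "2 * pi * of_int k / real N = of_int n * 2 * pi"
        using cos_one_2pi_int by blast
      then have "2 * pi * of_int k = 2 * pi * (of_int n * real N)" using N by (simp add: field_simps)
      then have "of_int k = (of_int n * real N)" by simp
      then have "of_int k = (of_int (n * int N) :: real)" by simp
      then have "k = n * int N" by (simp only: of_int_eq_iff)
      then show False using False by simp
    qed
    moreover have "z ^ N = 1"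
    proof -
      have "real N * (2 * pi * of_int k / real N) = 2 * pi * of_int k" using N by simp
      then show ?thesis unfolding z_def Complex.DeMoivre by (simp only: cis_multiple_2pi[OF Ints_of_int])
    qed
    ultimately show ?thesis unfolding zs using False by (simp add: geometric_sum)
  qed
qed

text \<open>The translates multiply the coefficient at \<open>k\<close> by powers of an
  \<open>N\<close>-th root of unity, whose mean detects divisibility of \<open>k j\<close> by
  \<open>N\<close>. As a finite combination of translates the average stays periodic with vanishing
  line integrals, and its energy can only drop.\<close>

lemma lacunary_fun_axis_average:
  fixes f :: "real^'m \<Rightarrow> real"
  assumes f: "lacunary_fun f" and N: "N > 0"
  shows "fourier_coeff (axis_average j N f) k = (if int N dvd k j then fourier_coeff f k else 0)"
    and "lacunary_fun (axis_average j N f)"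
proof -
  have m: "f \<in> borel_measurable lebesgue" and per: "periodic_2pi f" and int: "integrable torus (dilate f)"
    and spec: "\<And>k. k \<notin> lacunary \<Longrightarrow> fourier_coeff f k = 0" and fin: "energy f (\<lambda>_. 1) < \<infinity>" and zm: "zero_mean f"
    using f by (auto simp: lacunary_fun_def)
  define a :: "nat \<Rightarrow> real^'m" where "a s = axis j (real s / real N)" for s
  have d: "dilate (axis_average j N f) x = (\<Sum>s<N. dilate f (a s + x)) / real N" for x
  proof -
    have "(2 * pi) *\<^sub>R (a s + x) = (2 * pi) *\<^sub>R x + axis j (2 * pi * (real s / real N))" for s
      by (simp add: a_def vec_eq_iff axis_def algebra_simps)
    then show ?thesis by (simp only: dilate_def axis_average_def)
  qed
  have "has_bochner_integral torus (\<lambda>x. (\<Sum>s<N. complex_of_real (dilate f (a s + x)) * echar (\<lambda>j. - k j) x) / of_nat N)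
     ((\<Sum>s<N. echar k (a s) * fourier_coeff f k) / of_nat N)" for k
    by (intro has_bochner_integral_divide_zero has_bochner_integral_sum dilate_translation(1)[OF m per int])
  moreover have "(\<lambda>x. (\<Sum>s<N. complex_of_real (dilate f (a s + x)) * echar (\<lambda>j. - k j) x) / of_nat N)
      = (\<lambda>x. complex_of_real (dilate (axis_average j N f) x) * echar (\<lambda>j. - k j) x)" for k
    by (simp add: d sum_distrib_right)
  ultimately have 1: "fourier_coeff (axis_average j N f) k = (\<Sum>s<N. echar k (a s) * fourier_coeff f k) / of_nat N" for k
    by (simp add: has_bochner_integral_iff fourier_coeff_dilate fcoef_def)
  have 2: "(\<Sum>s<N. echar k (a s) * fourier_coeff f k) = (if int N dvd k j then of_nat N else 0) * fourier_coeff f k" for k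
    unfolding sum_distrib_right[symmetric] a_def echar_axis sum_roots_of_unity[OF N] ..
  show co: "fourier_coeff (axis_average j N f) k = (if int N dvd k j then fourier_coeff f k else 0)" for k
    unfolding 1 2 using N by simp
  have "axis_average j N f \<in> borel_measurable lebesgue"
  proof -
    have "(\<lambda>x. f (axis j (2 * pi * (real s / real N)) + x)) \<in> borel_measurable lebesgue" for s
      using measurable_compose[OF measurable_lebesgue_translation m] .
    then have "(\<lambda>x. (\<Sum>s<N. f (axis j (2 * pi * (real s / real N)) + x)) / real N) \<in> borel_measurable lebesgue"
      by measurable
    then show ?thesis by (simp add: axis_average_def[abs_def] add.commute)
  qed
  moreover have "periodic_2pi (axis_average j N f)"
    unfolding periodic_2pi_def axis_average_def
  proof (intro allI)
    fix x i
    have "f (x + axis i (2 * pi) + axis j c) = f (x + axis j c)" for c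
    proof -
      have "x + axis i (2 * pi) + axis j c = (x + axis j c) + axis i (2 * pi)" by simp
      then show ?thesis using per unfolding periodic_2pi_def by metis
    qed
    then show "(\<Sum>s<N. f (x + axis i (2 * pi) + axis j (2 * pi * (real s / real N)))) / real N =
       (\<Sum>s<N. f (x + axis j (2 * pi * (real s / real N)))) / real N" by (simp only:)
  qed
  moreover have "integrable torus (dilate (axis_average j N f))"
  proof -
    have "integrable torus (\<lambda>x. (\<Sum>s<N. dilate f (a s + x)) / real N)"
      by (intro integrable_divide_zero Bochner_Integration.integrable_sum impI dilate_translation(2)[OF m per int])
    then show ?thesis unfolding d[symmetric] .
  qed
  moreover have "energy (axis_average j N f) (\<lambda>_. 1) < \<infinity>"
  proof (rule le_less_trans[OF _ fin])
    show "energy (axis_average j N f) (\<lambda>_. 1) \<le> energy f (\<lambda>_. 1)"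
      by (rule energy_mono) (simp add: co)
  qed
  moreover have "zero_mean (axis_average j N f)"
    unfolding axis_average_def[abs_def] by (intro zero_mean_average zero_mean_translation zm per)
  ultimately show "lacunary_fun (axis_average j N f)"
    using spec by (simp add: lacunary_fun_def co)
qed

lemma exists_dyadic_threshold: "\<exists>V. \<forall>\<nu>. (2 ^ \<nu> > l) \<longleftrightarrow> V \<le> \<nu>" for l :: nat
proof -
  define V where "V = (LEAST V. 2 ^ V > l)"
  have V: "2 ^ V > l" unfolding V_def by (rule LeastI[of _ l]) simp
  have "(2 ^ \<nu> > l) \<longleftrightarrow> V \<le> \<nu>" for \<nu>
  proof
    assume "2 ^ \<nu> > l"
    then show "V \<le> \<nu>" unfolding V_def by (rule Least_le)
  next
    assume "V \<le> \<nu>"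
    then have "(2::nat) ^ V \<le> 2 ^ \<nu>" by (intro power_increasing) auto
    with V show "2 ^ \<nu> > l" by linarith
  qed
  then show ?thesis by blast
qed

text \<open>Averaging over the \<open>2 ^ V\<close> equidistant translates along an axis is the projection onto the
  frequencies divisible by \<open>2 ^ V\<close>; for a lacunary spectrum these are the large ones.\<close>

lemma angle_decomposition:
  fixes f :: "real^'m \<Rightarrow> real"
  assumes p: "p > 1" "\<tau> > 0" and f: "lacunary_fun f" and J: "finite J"
  shows "\<exists>g T. lacunary_fun g \<and> (\<forall>j\<in>J. T j \<in> trig_poly_in_var p \<tau> j (l j)) \<and>
    g = (\<lambda>x. f x - (\<Sum>j\<in>J. T j x)) \<and>
    (\<forall>k\<in>lacunary. fourier_coeff g k = (if \<forall>j\<in>J. int (l j) < \<bar>k j\<bar> then fourier_coeff f k else 0))"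
  using J
proof induction
  case empty
  then show ?case using f by (intro exI[of _ f]) auto
next
  case (insert j J)
  then obtain g T where g: "lacunary_fun g" "\<And>j. j \<in> J \<Longrightarrow> T j \<in> trig_poly_in_var p \<tau> j (l j)"
    "g = (\<lambda>x. f x - (\<Sum>j\<in>J. T j x))"
    "\<And>k. k \<in> lacunary \<Longrightarrow> fourier_coeff g k = (if \<forall>j\<in>J. int (l j) < \<bar>k j\<bar> then fourier_coeff f k else 0)"
    by blast
  obtain V where V: "\<And>\<nu>. 2 ^ \<nu> > l j \<longleftrightarrow> V \<le> \<nu>" using exists_dyadic_threshold[of "l j"] by blast
  define N :: nat where "N = 2 ^ V"
  have N: "N > 0" by (simp add: N_def)
  have dv: "int N dvd k j \<longleftrightarrow> int (l j) < \<bar>k j\<bar>" if k: "k \<in> lacunary" for k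
  proof -
    obtain \<nu> where \<nu>: "\<bar>k j\<bar> = 2 ^ \<nu>" using k by (auto simp: lacunary_def)
    have "int N dvd k j \<longleftrightarrow> int N dvd \<bar>k j\<bar>" by simp
    also have "\<dots> \<longleftrightarrow> (2::int) ^ V dvd 2 ^ \<nu>" unfolding \<nu> N_def by simp
    also have "\<dots> \<longleftrightarrow> V \<le> \<nu>" by (simp add: dvd_power_iff)
    also have "\<dots> \<longleftrightarrow> 2 ^ \<nu> > l j" by (simp add: V)
    also have "\<dots> \<longleftrightarrow> int (l j) < \<bar>k j\<bar>" unfolding \<nu> by (metis of_nat_less_iff of_nat_numeral of_nat_power)
    finally show ?thesis .
  qed
  \<comment> \<open>One more axis is treated: the part \<open>S\<close> of \<open>g\<close> with low
    frequencies in the variable \<open>j\<close> becomes the new approximant, and the average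
    \<open>g'\<close> is what is left.\<close>
  define g' where "g' = axis_average j N g"
  define S where "S = (\<lambda>x. g x - g' x)"
  have g': "lacunary_fun g'" and cg': "\<And>k. fourier_coeff g' k = (if int N dvd k j then fourier_coeff g k else 0)"
    unfolding g'_def using lacunary_fun_axis_average[OF g(1) N] by blast+
  have int: "integrable torus (dilate g)" "integrable torus (dilate g')"
    using g(1) g' by (auto simp: lacunary_fun_def)
  have "lacunary_fun S"
    unfolding S_def by (rule lacunary_fun_diff[OF g(1) g']) (simp add: cg')
  then have "S \<in> lorentz_space_zero_mean p \<tau>" by (rule lacunary_fun_lorentz[OF p])
  moreover have "fourier_coeff S k = 0" if "int (l j) < \<bar>k j\<bar>" for k
  proof (cases "k \<in> lacunary")
    case True
    then show ?thesis using that dv[of k] unfolding S_def by (simp add: fourier_coeff_diff(2)[OF int] cg')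
  next
    case False
    then show ?thesis using \<open>lacunary_fun S\<close> by (simp add: lacunary_fun_def)
  qed
  ultimately have S: "S \<in> trig_poly_in_var p \<tau> j (l j)"
    by (simp add: trig_poly_in_var_def)
  show ?case
  proof (intro exI[of _ g'] exI[of _ "T(j := S)"] conjI ballI)
    show "lacunary_fun g'" by fact
    show "(T(j := S)) i \<in> trig_poly_in_var p \<tau> i (l i)" if "i \<in> insert j J" for i
      using that S g(2) by auto
    have "(\<Sum>i\<in>insert j J. (T(j := S)) i x) = S x + (\<Sum>i\<in>J. T i x)" for x
    proof -
      have "(\<Sum>i\<in>J. (T(j := S)) i x) = (\<Sum>i\<in>J. T i x)" using insert.hyps by (intro sum.cong) auto
      then show ?thesis using insert.hyps by simp
    qed
    then show "g' = (\<lambda>x. f x - (\<Sum>i\<in>insert j J. (T(j := S)) i x))"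
      by (simp add: S_def g(3) fun_eq_iff)
    fix k :: "'m \<Rightarrow> int" assume "k \<in> lacunary"
    then show "fourier_coeff g' k = (if \<forall>j\<in>insert j J. int (l j) < \<bar>k j\<bar> then fourier_coeff f k else 0)"
      by (simp add: cg' dv g(4))
  qed
qed

definition angle_energy :: "(real^'m \<Rightarrow> real) \<Rightarrow> ('m \<Rightarrow> nat) \<Rightarrow> ennreal" where
  "angle_energy f l = energy f (\<lambda>k. of_bool (\<forall>j. int (l j) < \<bar>k j\<bar>))"

lemma angle_approx_le:
  assumes p: "p > 1" "\<tau> > 0"
  shows "\<exists>C>0. \<forall>(f :: real^'m \<Rightarrow> real) l. lacunary_fun f \<longrightarrow>
    (angle_approx p \<tau> l f)\<^sup>2 \<le> ennreal C * angle_energy f l"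
proof -
  obtain C where C: "C > 0" and up: "\<And>f :: real^'m \<Rightarrow> real. integrable torus (dilate f) \<Longrightarrow>
    (\<And>k. k \<notin> lacunary \<Longrightarrow> fourier_coeff f k = 0) \<Longrightarrow> (lorentz_norm p \<tau> f)\<^sup>2 \<le> ennreal C * energy f (\<lambda>_. 1)"
    using lorentz_norm_le_energy[OF p, where 'm = 'm] by blast
  have "(angle_approx p \<tau> l f)\<^sup>2 \<le> ennreal C * angle_energy f l"
    if f: "lacunary_fun f" for f :: "real^'m \<Rightarrow> real" and l
  proof -
    obtain g T where g: "lacunary_fun g" "\<forall>j\<in>UNIV. T j \<in> trig_poly_in_var p \<tau> j (l j)"
      "g = (\<lambda>x. f x - (\<Sum>j\<in>UNIV. T j x))"
      "\<And>k. k \<in> lacunary \<Longrightarrow> fourier_coeff g k = (if \<forall>j\<in>UNIV. int (l j) < \<bar>k j\<bar> then fourier_coeff f k else 0)"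
      using angle_decomposition[OF p f finite_class.finite_UNIV, of l] by blast
    have "angle_approx p \<tau> l f \<le> lorentz_norm p \<tau> g"
      unfolding angle_approx_def g(3) by (rule INF_lower) (use g(2) in simp)
    then have "(angle_approx p \<tau> l f)\<^sup>2 \<le> (lorentz_norm p \<tau> g)\<^sup>2" by (rule power_mono) simp
    also have "\<dots> \<le> ennreal C * energy g (\<lambda>_. 1)"
      using g(1) by (intro up) (auto simp: lacunary_fun_def)
    also have "energy g (\<lambda>_. 1) \<le> angle_energy f l"
      unfolding angle_energy_def by (rule energy_mono) (simp add: g(4))
    finally show ?thesis by (simp add: mult_left_mono)
  qed
  then show ?thesis using C by blast
qed

text \<open>No competitor can touch a coefficient with \<open>\<bar>k j\<bar> > l j\<close> for all
  \<open>j\<close>, since each summand \<open>T j\<close> has coefficient 0 there. Every admissible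
  remainder therefore has at least the angle energy of \<open>f\<close>, and the infimum inherits
  the bound.\<close>

lemma angle_approx_ge:
  assumes p: "p > 1" "\<tau> > 0"
  shows "\<exists>C>0. \<forall>(f :: real^'m \<Rightarrow> real) l. lacunary_fun f \<longrightarrow>
    angle_energy f l \<le> ennreal C * (angle_approx p \<tau> l f)\<^sup>2"
proof -
  obtain C where C: "C > 0" and low: "\<And>f :: real^'m \<Rightarrow> real. dilate f \<in> borel_measurable torus \<Longrightarrow>
    energy f (\<lambda>_. 1) \<le> ennreal C * (lorentz_norm p \<tau> f)\<^sup>2"
    using energy_le_lorentz_norm[OF p, where 'm = 'm] by blast
  have "angle_energy f l \<le> ennreal C * (angle_approx p \<tau> l f)\<^sup>2"
    if f: "lacunary_fun f" for f :: "real^'m \<Rightarrow> real" and l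
  proof -
    have intf: "integrable torus (dilate f)" using f by (auto simp: lacunary_fun_def)
    have *: "angle_energy f l \<le> ennreal C * (lorentz_norm p \<tau> (\<lambda>x. f x - (\<Sum>j\<in>UNIV. T j x)))\<^sup>2"
      if T: "\<And>j. T j \<in> trig_poly_in_var p \<tau> j (l j)" for T
    proof -
      define g where "g = (\<lambda>x. f x - (\<Sum>j\<in>UNIV. T j x))"
      have intT: "integrable torus (dilate (T j))" for j
      proof (rule integrable_if_lorentz_norm_finite[OF p])
        have "T j \<in> lorentz_space p \<tau>"
          using T[of j] by (auto simp: trig_poly_in_var_def lorentz_space_zero_mean_def)
        then show "dilate (T j) \<in> borel_measurable torus" "lorentz_norm p \<tau> (T j) < \<infinity>"
          by (auto simp: lorentz_space_def intro: borel_measurable_dilate(2))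
      qed
      have g: "integrable torus (dilate g)" "\<And>k. fourier_coeff g k = fourier_coeff f k - (\<Sum>j\<in>UNIV. fourier_coeff (T j) k)"
        using fourier_coeff_diff_sum[OF intf, of UNIV T] intT unfolding g_def by simp_all
      have "angle_energy f l \<le> energy g (\<lambda>_. 1)"
        unfolding angle_energy_def
      proof (rule energy_mono)
        fix k :: "'m \<Rightarrow> int"
        show "of_bool (\<forall>j. int (l j) < \<bar>k j\<bar>) * (norm (fourier_coeff f k))\<^sup>2 \<le> 1 * (norm (fourier_coeff g k))\<^sup>2"
        proof (cases "\<forall>j. int (l j) < \<bar>k j\<bar>")
          case True
          then have "fourier_coeff (T j) k = 0" for j
            using T[of j] by (auto simp: trig_poly_in_var_def)
          then show ?thesis by (simp add: g(2))
        qed auto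
      qed
      also have "\<dots> \<le> ennreal C * (lorentz_norm p \<tau> g)\<^sup>2"
        using g(1) by (intro low) auto
      finally show ?thesis by (simp add: g_def)
    qed
    show ?thesis
    proof (cases "angle_approx p \<tau> l f")
      case (real y)
      have "angle_energy f l \<le> ennreal (C * y\<^sup>2)"
      proof (rule ennreal_le_limit[where b = y and g = "\<lambda>B. C * B\<^sup>2"])
        fix B assume B: "B > y"
        then have "angle_approx p \<tau> l f < ennreal B" using real by (simp add: ennreal_less_iff)
        then obtain T where T: "\<And>j. T j \<in> trig_poly_in_var p \<tau> j (l j)"
          "lorentz_norm p \<tau> (\<lambda>x. f x - (\<Sum>j\<in>UNIV. T j x)) < ennreal B"
          unfolding angle_approx_def by (auto simp: INF_less_iff)
        have "angle_energy f l \<le> ennreal C * (lorentz_norm p \<tau> (\<lambda>x. f x - (\<Sum>j\<in>UNIV. T j x)))\<^sup>2"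
          by (rule *[OF T(1)])
        also have "\<dots> \<le> ennreal C * (ennreal B)\<^sup>2"
          using T(2) by (intro mult_left_mono power_mono) auto
        also have "\<dots> = ennreal (C * B\<^sup>2)" using B real C by (simp add: ennreal_power ennreal_mult)
        finally show "angle_energy f l \<le> ennreal (C * B\<^sup>2)" .
      qed (auto intro!: continuous_intros)
      then show ?thesis using real C by (simp add: ennreal_power ennreal_mult)
    next
      case top
      then show ?thesis using C by (simp add: ennreal_mult_top)
    qed
  qed
  then show ?thesis using C by blast
qed

section \<open>Comparison of the two sides\<close>

lemma ennpowr_half_power2: "(ennpowr c (1 / 2))\<^sup>2 = c"
proof (cases c)
  case (real r)
  have "(r powr (1 / 2))\<^sup>2 = r" using real by (simp add: powr_half_sqrt)
  then show ?thesis using real by (simp add: ennpowr_ennreal ennreal_power)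
qed (simp add: ennpowr_def power2_eq_square ennreal_mult_top)

lemma ennreal_power2_le_imp_le:
  fixes x y :: ennreal
  assumes "x\<^sup>2 \<le> y\<^sup>2"
  shows "x \<le> y"
proof (cases y)
  case (real b)
  note y = this
  show ?thesis
  proof (cases x)
    case (real a)
    have "ennreal (a\<^sup>2) \<le> ennreal (b\<^sup>2)"
      using assms unfolding y(2) real(2) ennreal_power[OF y(1)] ennreal_power[OF real(1)] .
    then have "a\<^sup>2 \<le> b\<^sup>2" by simp
    then have "a \<le> b" by (rule power2_le_imp_le[OF _ y(1)])
    then show ?thesis unfolding y(2) real(2) by (rule ennreal_leI)
  next
    case top
    have "top \<le> ennreal (b\<^sup>2)"
      using assms unfolding y(2) top ennreal_power[OF y(1)] by (simp add: power2_eq_square)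
    then show ?thesis by (simp add: top_unique)
  qed
qed simp

lemma ennreal_mult_mult: "a \<ge> 0 \<Longrightarrow> b \<ge> 0 \<Longrightarrow> ennreal a * (ennreal b * z) = ennreal (a * b) * z"
  by (simp add: ennreal_mult mult.assoc)

section \<open>Weights from sums of powers\<close>

text \<open>The mean value theorem, with the derivative compared to its value at the right endpoint;
  whether the derivative rises or falls depends on the sign of \<open>a - 1\<close>. The case
  \<open>n = 0\<close> is separate because the power need not be differentiable at 0.\<close>

lemma powr_diff_bounds:
  fixes a :: real and n :: nat
  assumes a: "a > 0"
  shows "a \<ge> 1 \<Longrightarrow> real (Suc n) powr a - real n powr a \<le> a * real (Suc n) powr (a - 1)"
    and "a \<le> 1 \<Longrightarrow> a * real (Suc n) powr (a - 1) \<le> real (Suc n) powr a - real n powr a"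
proof -
  let ?D = "real (Suc n) powr a - real n powr a"
  let ?R = "a * real (Suc n) powr (a - 1)"
  have "(a \<ge> 1 \<longrightarrow> ?D \<le> ?R) \<and>
    (a \<le> 1 \<longrightarrow> ?R \<le> ?D)"
  proof (cases "n = 0")
    case False
    have "\<exists>z. real n < z \<and> z < real (Suc n) \<and>
        ?D = (real (Suc n) - real n) * (a * z powr (a - 1))"
    proof (rule MVT2)
      fix x assume "real n \<le> x"
      then have "x > 0" using False by simp
      then show "((\<lambda>x. x powr a) has_real_derivative a * x powr (a - 1)) (at x)"
        by (auto intro!: derivative_eq_intros)
    qed simp
    then obtain z where z: "real n < z" "z < real (Suc n)"
      "?D = a * z powr (a - 1)" by auto
    have z0: "z > 0" using z(1) by linarith
    show ?thesis
    proof (intro conjI impI)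
      assume "a \<ge> 1"
      then show "?D \<le> ?R"
        unfolding z(3) using z z0 a by (intro mult_left_mono powr_mono2) auto
    next
      assume "a \<le> 1"
      then show "?R \<le> ?D"
        unfolding z(3) using z z0 a by (intro mult_left_mono powr_mono2') auto
    qed
  qed auto
  then show "a \<ge> 1 \<Longrightarrow> ?D \<le> ?R"
    and "a \<le> 1 \<Longrightarrow> ?R \<le> ?D"
    by blast+
qed

text \<open>One bound replaces all terms by the last one, the other telescopes the differences of
  \<open>\<nu> powr a\<close>. Which is the upper and which the lower one depends on whether the
  terms increase (\<open>a \<ge> 1\<close>) or decrease.\<close>

lemma sum_powr_bounds:
  fixes a :: real and N :: nat
  assumes a: "a > 0"
  shows "min 1 (1 / a) * real N powr a \<le> (\<Sum>\<nu>=1..N. real \<nu> powr (a - 1))"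
    and "(\<Sum>\<nu>=1..N. real \<nu> powr (a - 1)) \<le> max 1 (1 / a) * real N powr a"
proof -
  have card: "(\<Sum>\<nu>=1..N. real N powr (a - 1)) = real N powr a"
    using a by (cases "N = 0") (simp_all add: powr_diff)
  have tele: "real N powr a = (\<Sum>\<nu>=1..N. real \<nu> powr a - real (\<nu> - 1) powr a)" for N
    using a by (induction N) auto
  have step: "real \<nu> powr a - real (\<nu> - 1) powr a \<le> a * real \<nu> powr (a - 1)" if "a \<ge> 1" "\<nu> \<in> {1..N}" for \<nu>
    using powr_diff_bounds(1)[OF a that(1), of "\<nu> - 1"] that by simp
  have step': "a * real \<nu> powr (a - 1) \<le> real \<nu> powr a - real (\<nu> - 1) powr a" if "a \<le> 1" "\<nu> \<in> {1..N}" for \<nu>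
    using powr_diff_bounds(2)[OF a that(1), of "\<nu> - 1"] that by simp
  show "min 1 (1 / a) * real N powr a \<le> (\<Sum>\<nu>=1..N. real \<nu> powr (a - 1))"
  proof (cases "a \<ge> 1")
    case True
    have "real N powr a \<le> (\<Sum>\<nu>=1..N. a * real \<nu> powr (a - 1))"
      unfolding tele[of N] by (intro sum_mono step True)
    then show ?thesis using a True by (simp add: sum_distrib_left[symmetric] min_def field_simps)
  next
    case False
    have "real N powr a \<le> (\<Sum>\<nu>=1..N. real \<nu> powr (a - 1))"
      unfolding card[symmetric] using False by (intro sum_mono powr_mono2') auto
    then show ?thesis using a False by (simp add: min_def)
  qed
  show "(\<Sum>\<nu>=1..N. real \<nu> powr (a - 1)) \<le> max 1 (1 / a) * real N powr a"
  proof (cases "a \<ge> 1")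
    case True
    have "(\<Sum>\<nu>=1..N. real \<nu> powr (a - 1)) \<le> real N powr a"
      unfolding card[symmetric] using True by (intro sum_mono powr_mono2) auto
    then show ?thesis using a True by (simp add: max_def)
  next
    case False
    have "(\<Sum>\<nu>=1..N. a * real \<nu> powr (a - 1)) \<le> real N powr a"
      unfolding tele[of N] using False by (intro sum_mono step') auto
    then show ?thesis using a False by (simp add: sum_distrib_left[symmetric] max_def field_simps)
  qed
qed

text \<open>The contribution of one variable to the squared angle sum, with
  \<open>2 * \<alpha> $ j\<close> in the role of \<open>a\<close>: the condition
  \<open>\<nu> - 1 < \<bar>k\<bar>\<close> stops the sum at the smaller of \<open>n + 1\<close> and
  \<open>\<bar>k\<bar>\<close>.\<close>

lemma truncated_sum_powr_bounds:
  fixes a :: real and n :: nat and k :: int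
  assumes a: "a > 0" and n: "n \<ge> 1"
  defines "S \<equiv> real n powr (- a) * (\<Sum>\<nu>=1..n + 1. real \<nu> powr (a - 1) * of_bool (int (\<nu> - 1) < \<bar>k\<bar>))"
    and "w \<equiv> min 1 (\<bar>of_int k\<bar> / real n) powr a"
  shows "min 1 (1 / a) * w \<le> S" and "S \<le> max 1 (1 / a) * 2 powr a * w"
proof -
  define N where "N = min (n + 1) (nat \<bar>k\<bar>)"
  have "(\<Sum>\<nu>=1..n + 1. real \<nu> powr (a - 1) * of_bool (int (\<nu> - 1) < \<bar>k\<bar>))
      = (\<Sum>\<nu>\<in>{1..N}. real \<nu> powr (a - 1))"
    by (rule sum.mono_neutral_cong_right) (auto simp: N_def)
  then have S: "S = real n powr (- a) * (\<Sum>\<nu>=1..N. real \<nu> powr (a - 1))" by (simp add: S_def)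
  have w: "w = real n powr (- a) * (min (real n) \<bar>of_int k\<bar>) powr a"
  proof -
    have "min 1 (\<bar>of_int k\<bar> / real n) = min (real n) \<bar>of_int k\<bar> / real n"
      using n by (auto simp: min_def field_simps)
    then show ?thesis unfolding w_def by (simp add: powr_divide powr_minus_divide)
  qed
  have N1: "min (real n) \<bar>of_int k\<bar> \<le> real N"
    by (simp add: N_def)
  \<comment> \<open>Summing up to \<open>n + 1\<close> instead of \<open>n\<close> at most doubles
    the cut-off; this is the origin of the factor \<open>2 powr a\<close>.\<close>
  have N2: "real N \<le> 2 * min (real n) \<bar>of_int k\<bar>"
  proof -
    have "real N = min (real n + 1) \<bar>of_int k\<bar>" by (simp add: N_def of_nat_min)
    moreover have "min (a + 1) b \<le> 2 * min a b" if "a \<ge> 1" "b \<ge> 0" for a b :: real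
      using that by (auto simp: min_def)
    ultimately show ?thesis using n by simp
  qed
  have "min 1 (1 / a) * w = real n powr (- a) * (min 1 (1 / a) * (min (real n) \<bar>of_int k\<bar>) powr a)"
    by (simp add: w)
  also have "\<dots> \<le> real n powr (- a) * (min 1 (1 / a) * real N powr a)"
    using a N1 by (intro mult_left_mono powr_mono2) auto
  also have "\<dots> \<le> S"
    unfolding S by (intro mult_left_mono sum_powr_bounds a) auto
  finally show "min 1 (1 / a) * w \<le> S" .
  have "S \<le> real n powr (- a) * (max 1 (1 / a) * real N powr a)"
    unfolding S by (intro mult_left_mono sum_powr_bounds a) auto
  also have "\<dots> \<le> real n powr (- a) * (max 1 (1 / a) * (2 * min (real n) \<bar>of_int k\<bar>) powr a)"
    using a N2 by (intro mult_left_mono powr_mono2) auto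
  also have "\<dots> = max 1 (1 / a) * 2 powr a * w"
    by (simp add: w powr_mult)
  finally show "S \<le> max 1 (1 / a) * 2 powr a * w" .
qed

definition smoothness_weight :: "real^'m \<Rightarrow> ('m \<Rightarrow> nat) \<Rightarrow> ('m \<Rightarrow> int) \<Rightarrow> real" where
  "smoothness_weight \<alpha> n k = (\<Prod>j\<in>UNIV. min 1 (\<bar>of_int (k j)\<bar> / real (n j)) powr (2 * \<alpha> $ j))"

lemma energy_mono_scaled:
  assumes "c \<ge> 0" "\<And>k. k \<in> lacunary \<Longrightarrow> w k * (norm (fourier_coeff f k))\<^sup>2 \<le> c * v k * (norm (fourier_coeff g k))\<^sup>2"
    and "\<And>k. v k \<ge> 0"
  shows "energy f w \<le> ennreal c * energy g v"
proof -
  have "energy f w \<le> (\<integral>\<^sup>+k. ennreal c * ennreal (v k * (norm (fourier_coeff g k))\<^sup>2) \<partial>count_space lacunary)"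
    unfolding energy_def using assms
    by (intro nn_integral_mono) (auto simp: ennreal_mult[symmetric] mult.assoc intro!: ennreal_leI)
  also have "\<dots> = ennreal c * energy g v"
    unfolding energy_def by (rule nn_integral_cmult) simp
  finally show ?thesis .
qed

lemma energy_sum:
  assumes "finite I" "\<And>i. i \<in> I \<Longrightarrow> c i \<ge> 0" "\<And>i k. i \<in> I \<Longrightarrow> w i k \<ge> 0"
  shows "(\<Sum>i\<in>I. ennreal (c i) * energy f (w i)) = energy f (\<lambda>k. \<Sum>i\<in>I. c i * w i k)"
proof -
  have "(\<Sum>i\<in>I. ennreal (c i) * energy f (w i))
      = (\<Sum>i\<in>I. \<integral>\<^sup>+k. ennreal (c i) * ennreal (w i k * (norm (fourier_coeff f k))\<^sup>2) \<partial>count_space lacunary)"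
    unfolding energy_def by (simp add: nn_integral_cmult)
  also have "\<dots> = (\<integral>\<^sup>+k. (\<Sum>i\<in>I. ennreal (c i) * ennreal (w i k * (norm (fourier_coeff f k))\<^sup>2)) \<partial>count_space lacunary)"
    by (rule nn_integral_sum[symmetric]) simp
  also have "\<dots> = energy f (\<lambda>k. \<Sum>i\<in>I. c i * w i k)"
    unfolding energy_def using assms
    by (intro nn_integral_cong)
      (simp add: ennreal_mult[symmetric] sum_ennreal mult.assoc sum_distrib_right)
  finally show ?thesis .
qed

text \<open>The condition on \<open>k\<close> is a conjunction over the axes, so its indicator is a
  product and the multiple sum splits.\<close>

lemma angle_weight_eq:
  fixes \<alpha> :: "real^'m"
  shows "(\<Sum>\<nu>\<in>{\<nu>. \<forall>j. \<nu> j \<in> {1..n j + 1}}.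
      (\<Prod>j\<in>UNIV. real (\<nu> j) powr (2 * \<alpha> $ j - 1)) * of_bool (\<forall>j. int (\<nu> j - 1) < \<bar>k j\<bar>))
    = (\<Prod>j\<in>UNIV. \<Sum>\<nu>=1..n j + 1. real \<nu> powr (2 * \<alpha> $ j - 1) * of_bool (int (\<nu> - 1) < \<bar>k j\<bar>))"
proof -
  have set: "{\<nu>. \<forall>j. \<nu> j \<in> {1..n j + 1}} = PiE UNIV (\<lambda>j. {1..n j + 1})"
    by (auto simp: PiE_UNIV_domain)
  have bool: "of_bool (\<forall>j. P j) = (\<Prod>j\<in>(UNIV :: 'm set). of_bool (P j) :: real)" for P
  proof (cases "\<forall>j. P j")
    case False
    then have "(\<Prod>j\<in>(UNIV :: 'm set). of_bool (P j) :: real) = 0" by (intro prod_zero) auto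
    then show ?thesis using False by simp
  qed simp
  show ?thesis
    unfolding set bool prod.distrib[symmetric] by (rule prod_sum_PiE[symmetric]) auto
qed

text \<open>Each best approximation is replaced by an angle energy. Summing over
  \<open>\<nu>\<close> before summing over \<open>k\<close> gives the frequency \<open>k\<close> the
  weight \<open>P\<^sup>2 * B k\<close>, a product of one-variable sums comparable to the factors of
  \<open>smoothness_weight\<close>.\<close>

lemma angle_sum_equiv:
  fixes \<alpha> :: "real^'m"
  assumes p: "p > 1" "\<tau> > 0" and \<alpha>: "\<And>j. \<alpha> $ j > 0"
  shows "\<exists>a>0. \<exists>e>0. \<forall>f n. lacunary_fun f \<longrightarrow> (\<forall>j. n j \<ge> 1) \<longrightarrow>
    (angle_sum p \<tau> \<alpha> n f)\<^sup>2 \<le> ennreal a * energy f (smoothness_weight \<alpha> n) \<and>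
    energy f (smoothness_weight \<alpha> n) \<le> ennreal e * (angle_sum p \<tau> \<alpha> n f)\<^sup>2"
proof -
  obtain C where C: "C > 0" and up: "\<And>(f :: real^'m \<Rightarrow> real) l. lacunary_fun f \<Longrightarrow>
    (angle_approx p \<tau> l f)\<^sup>2 \<le> ennreal C * angle_energy f l"
    using angle_approx_le[OF p, where 'm = 'm] by blast
  obtain D where D: "D > 0" and low: "\<And>(f :: real^'m \<Rightarrow> real) l. lacunary_fun f \<Longrightarrow>
    angle_energy f l \<le> ennreal D * (angle_approx p \<tau> l f)\<^sup>2"
    using angle_approx_ge[OF p, where 'm = 'm] by blast
  define K where "K = (\<Prod>j\<in>UNIV. max 1 (1 / (2 * \<alpha> $ j)) * 2 powr (2 * \<alpha> $ j))"
  define L where "L = (\<Prod>j\<in>UNIV. min 1 (1 / (2 * \<alpha> $ j)))"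
  have K: "K > 0" unfolding K_def by (intro prod_pos mult_pos_pos) (auto simp: less_max_iff_disj)
  have L: "L > 0" unfolding L_def using \<alpha> by (intro prod_pos) (auto simp: min_def)
  have "(angle_sum p \<tau> \<alpha> n f)\<^sup>2 \<le> ennreal (C * K) * energy f (smoothness_weight \<alpha> n) \<and>
    energy f (smoothness_weight \<alpha> n) \<le> ennreal (D / L) * (angle_sum p \<tau> \<alpha> n f)\<^sup>2"
    if f: "lacunary_fun f" and n: "\<And>j. n j \<ge> 1" for f and n :: "'m \<Rightarrow> nat"
  proof -
    let ?S = "(angle_sum p \<tau> \<alpha> n f)\<^sup>2"
    let ?E = "energy f (smoothness_weight \<alpha> n)"
    let ?N = "\<lambda>k. (norm (fourier_coeff f k))\<^sup>2"
    define I where "I = {\<nu>. \<forall>j. \<nu> j \<in> {1..n j + 1}}"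
    have "I = PiE UNIV (\<lambda>j. {1..n j + 1})" by (auto simp: I_def PiE_UNIV_domain)
    then have I: "finite I" by (simp add: finite_PiE)
    define w where "w \<nu> = (\<Prod>j\<in>UNIV. real (\<nu> j) powr (2 * \<alpha> $ j - 1))" for \<nu> :: "'m \<Rightarrow> nat"
    have w: "w \<nu> \<ge> 0" for \<nu> by (auto simp: w_def intro: prod_nonneg)
    define P where "P = (\<Prod>j\<in>UNIV. real (n j) powr (- (\<alpha> $ j)))"
    have P: "P > 0" unfolding P_def
    proof (rule prod_pos)
      fix j show "0 < real (n j) powr - \<alpha> $ j" using n[of j] by simp
    qed
    have P2: "P\<^sup>2 = (\<Prod>j\<in>UNIV. real (n j) powr (- (2 * \<alpha> $ j)))"
      unfolding P_def prod_power_distrib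
      by (intro prod.cong refl) (simp add: power2_eq_square powr_add[symmetric])
    define Q where "Q = (\<Sum>\<nu>\<in>I. ennreal (w \<nu>) * angle_energy f (\<lambda>j. \<nu> j - 1))"
    define Y where "Y = (\<Sum>\<nu>\<in>I. ennreal (w \<nu>) * (angle_approx p \<tau> (\<lambda>j. \<nu> j - 1) f)\<^sup>2)"
    have as: "?S = ennreal (P\<^sup>2) * Y"
      unfolding angle_sum_def Y_def P_def[symmetric] w_def[symmetric] I_def[symmetric] power_mult_distrib ennpowr_half_power2
      using P by (simp add: ennreal_power)
    have YQ: "Y \<le> ennreal C * Q"
      unfolding Y_def Q_def sum_distrib_left
    proof (rule sum_mono)
      fix \<nu>
      have "ennreal (w \<nu>) * (angle_approx p \<tau> (\<lambda>j. \<nu> j - 1) f)\<^sup>2 \<le> ennreal (w \<nu>) * (ennreal C * angle_energy f (\<lambda>j. \<nu> j - 1))"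
        by (intro mult_left_mono up f) simp
      then show "ennreal (w \<nu>) * (angle_approx p \<tau> (\<lambda>j. \<nu> j - 1) f)\<^sup>2 \<le> ennreal C * (ennreal (w \<nu>) * angle_energy f (\<lambda>j. \<nu> j - 1))"
        by (simp add: mult_ac)
    qed
    have QY: "Q \<le> ennreal D * Y"
      unfolding Y_def Q_def sum_distrib_left
    proof (rule sum_mono)
      fix \<nu>
      have "ennreal (w \<nu>) * angle_energy f (\<lambda>j. \<nu> j - 1) \<le> ennreal (w \<nu>) * (ennreal D * (angle_approx p \<tau> (\<lambda>j. \<nu> j - 1) f)\<^sup>2)"
        by (intro mult_left_mono low f) simp
      then show "ennreal (w \<nu>) * angle_energy f (\<lambda>j. \<nu> j - 1) \<le> ennreal D * (ennreal (w \<nu>) * (angle_approx p \<tau> (\<lambda>j. \<nu> j - 1) f)\<^sup>2)"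
        by (simp add: mult_ac)
    qed
    define B where "B k = (\<Sum>\<nu>\<in>I. w \<nu> * of_bool (\<forall>j. int (\<nu> j - 1) < \<bar>k j\<bar>))" for k
    have B0: "B k \<ge> 0" for k using w by (auto simp: B_def intro!: sum_nonneg)
    have Q: "Q = energy f B"
      unfolding Q_def angle_energy_def B_def using I w by (intro energy_sum) auto
    have PB: "P\<^sup>2 * B k = (\<Prod>j\<in>UNIV. real (n j) powr (- (2 * \<alpha> $ j)) *
        (\<Sum>\<nu>=1..n j + 1. real \<nu> powr (2 * \<alpha> $ j - 1) * of_bool (int (\<nu> - 1) < \<bar>k j\<bar>)))" for k
      unfolding P2 prod.distrib B_def w_def I_def angle_weight_eq ..
    have W0: "smoothness_weight \<alpha> n k \<ge> 0" for k
      by (auto simp: smoothness_weight_def intro: prod_nonneg)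
    have Bu: "P\<^sup>2 * B k \<le> K * smoothness_weight \<alpha> n k" for k
      unfolding PB K_def smoothness_weight_def prod.distrib[symmetric] using n \<alpha>
      by (intro prod_mono conjI truncated_sum_powr_bounds mult_nonneg_nonneg sum_nonneg) auto
    have Bl: "L * smoothness_weight \<alpha> n k \<le> P\<^sup>2 * B k" for k
      unfolding PB L_def smoothness_weight_def prod.distrib[symmetric]
    proof (intro prod_mono conjI truncated_sum_powr_bounds)
      fix j
      have "min 1 (1 / (2 * \<alpha> $ j)) \<ge> 0" using \<alpha>[of j] by simp
      then show "0 \<le> min 1 (1 / (2 * \<alpha> $ j)) * min 1 (\<bar>of_int (k j)\<bar> / real (n j)) powr (2 * \<alpha> $ j)"
        by simp
    qed (use n \<alpha> in auto)
    have "?S \<le> ennreal (P\<^sup>2) * (ennreal C * Q)"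
      unfolding as by (intro mult_left_mono YQ) simp
    also have "Q \<le> ennreal (K / P\<^sup>2) * ?E"
      unfolding Q
    proof (rule energy_mono_scaled)
      fix k
      have "B k \<le> K / P\<^sup>2 * smoothness_weight \<alpha> n k" using Bu[of k] P by (simp add: field_simps)
      then show "B k * ?N k \<le> K / P\<^sup>2 * smoothness_weight \<alpha> n k * ?N k"
        by (rule mult_right_mono) simp
    qed (use K W0 in auto)
    also have "ennreal (P\<^sup>2) * (ennreal C * (ennreal (K / P\<^sup>2) * ?E))
        = ennreal (C * K) * ?E"
      using P C K by (simp add: ennreal_mult_mult)
    finally have 1: "?S \<le> ennreal (C * K) * ?E"
      by (simp add: mult_left_mono)
    have "?E \<le> ennreal (P\<^sup>2 / L) * Q"
      unfolding Q
    proof (rule energy_mono_scaled)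
      fix k
      have "smoothness_weight \<alpha> n k \<le> P\<^sup>2 / L * B k" using Bl[of k] L by (simp add: field_simps)
      then show "smoothness_weight \<alpha> n k * ?N k \<le> P\<^sup>2 / L * B k * ?N k"
        by (rule mult_right_mono) simp
    qed (use L B0 in auto)
    also have "\<dots> \<le> ennreal (P\<^sup>2 / L) * (ennreal D * Y)" by (intro mult_left_mono QY) simp
    also have "\<dots> = ennreal (D / L) * ?S"
    proof -
      have "P\<^sup>2 / L * D = D / L * P\<^sup>2" by simp
      then show ?thesis unfolding as using P D L by (simp only: ennreal_mult_mult zero_le_power2 divide_nonneg_pos less_imp_le)
    qed
    finally show ?thesis using 1 by blast
  qed
  then show ?thesis using C K D L
    by (intro exI[of _ "C * K"] exI[of _ "D / L"] conjI) auto
qed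

section \<open>A single step seen by all dyadic frequencies\<close>

text \<open>The angle \<open>pi / 3\<close> is chosen because doubling keeps both moduli: if the
  cosine is \<open>1 / 2\<close> up to sign, the cosine of the double angle is
  \<open>2 / 4 - 1 = - 1 / 2\<close>.\<close>

lemma abs_sin_cos_dyadic:
  "\<bar>sin (pi / 3 * 2 ^ i)\<bar> = sqrt 3 / 2 \<and> \<bar>cos (pi / 3 * 2 ^ i)\<bar> = 1 / 2"
proof (induction i)
  case (Suc i)
  define x where "x = pi / 3 * 2 ^ i"
  have x2: "pi / 3 * 2 ^ Suc i = 2 * x" by (simp add: x_def)
  have s: "\<bar>sin x\<bar> = sqrt 3 / 2" and c: "\<bar>cos x\<bar> = 1 / 2" using Suc unfolding x_def by blast+
  have "\<bar>sin (2 * x)\<bar> = 2 * \<bar>sin x\<bar> * \<bar>cos x\<bar>" by (simp add: sin_double abs_mult)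
  then have "\<bar>sin (2 * x)\<bar> = sqrt 3 / 2" unfolding s c by simp
  moreover have "\<bar>cos (2 * x)\<bar> = 1 / 2"
  proof -
    have "(cos x)\<^sup>2 = \<bar>cos x\<bar>\<^sup>2" by simp
    also have "\<dots> = (1 / 2)\<^sup>2" by (simp only: c)
    finally have "cos (2 * x) = - (1 / 2)" by (simp add: cos_double_cos power2_eq_square)
    then show ?thesis by simp
  qed
  ultimately show ?case unfolding x2 by blast
qed (simp add: sin_60 cos_60)

text \<open>At high frequencies the sine has modulus \<open>sqrt 3 / 2\<close>. At low ones the
  argument is \<open>pi / 3\<close> halved repeatedly, and each halving at most halves the sine, as
  \<open>sin (2 * x) \<le> 2 * sin x\<close> when \<open>sin x \<ge> 0\<close>.\<close>

lemma sin_dyadic_lower: "\<bar>sin (pi / 3 * (2 ^ \<nu> / 2 ^ s))\<bar> \<ge> 1 / 2 * min 1 (2 ^ \<nu> / 2 ^ s)"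
proof (cases "s \<le> \<nu>")
  case True
  then have "(2::real) ^ \<nu> / 2 ^ s = 2 ^ (\<nu> - s)" by (simp add: power_diff)
  then have "\<bar>sin (pi / 3 * (2 ^ \<nu> / 2 ^ s))\<bar> = sqrt 3 / 2" using abs_sin_cos_dyadic[of "\<nu> - s"] by simp
  moreover have "sqrt 3 \<ge> 1" by simp
  moreover have "1 / 2 * min 1 ((2::real) ^ \<nu> / 2 ^ s) \<le> 1 / 2 * 1" by (intro mult_left_mono) auto
  ultimately show ?thesis by linarith
next
  case False
  have "sin (pi / 3 * (1 / 2 ^ i)) \<ge> 1 / 2 * (1 / 2 ^ i)" for i :: nat
  proof (induction i)
    case 0
    have "sqrt 3 \<ge> 1" by simp
    then show ?case by (simp add: sin_60)
  next
    case (Suc i)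
    define x where "x = pi / 3 * (1 / 2 ^ Suc i)"
    have x2: "pi / 3 * (1 / 2 ^ i) = 2 * x" by (simp add: x_def)
    have "(1::real) / 2 ^ Suc i \<le> 1" by (simp add: divide_le_eq_1 one_le_power del: power_Suc)
    then have "x \<le> pi / 3 * 1" unfolding x_def by (rule mult_left_mono) simp
    moreover have "x \<ge> 0" by (simp add: x_def)
    ultimately have "sin x \<ge> 0" by (intro sin_ge_zero) linarith+
    then have "sin x * cos x \<le> sin x * 1" by (intro mult_left_mono) auto
    then have "sin (2 * x) \<le> 2 * sin x" by (simp add: sin_double)
    then show ?case using Suc unfolding x2 by (simp add: x_def)
  qed
  from this[of "s - \<nu>"] have "sin (pi / 3 * (2 ^ \<nu> / 2 ^ s)) \<ge> 1 / 2 * (2 ^ \<nu> / 2 ^ s)"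
    using False by (simp add: power_diff)
  moreover have "1 / 2 * min 1 ((2::real) ^ \<nu> / 2 ^ s) \<le> 1 / 2 * (2 ^ \<nu> / 2 ^ s)" by (intro mult_left_mono) auto
  ultimately show ?thesis by linarith
qed

text \<open>For \<open>h = 2 * pi / (3 * 2 ^ V)\<close> all high frequencies see the same value \<open>\<bar>sin (pi * 2 ^ i / 3)\<bar>\<close>, so
  a single step replaces averaging over \<open>h\<close>.\<close>

lemma exists_good_step:
  fixes n :: nat
  assumes n: "n \<ge> 1"
  shows "\<exists>h. \<bar>h\<bar> \<le> 1 / real n \<and>
    (\<forall>\<nu> k. \<bar>k\<bar> = 2 ^ \<nu> \<longrightarrow> min 1 (\<bar>of_int k\<bar> / real n) / 6 \<le> \<bar>2 * sin (of_int k * h / 2)\<bar>)"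
proof -
  \<comment> \<open>The least \<open>V\<close> puts \<open>2 ^ V\<close> between
    \<open>3 * n\<close> and \<open>6 * n\<close>. The lower bound makes the step at most
    \<open>1 / n\<close>, because \<open>2 * pi / 3 \<le> 3\<close>; the upper one yields the factor
    6.\<close>
  obtain V where V: "\<And>\<nu>. 2 ^ \<nu> > 3 * n \<longleftrightarrow> V \<le> \<nu>" using exists_dyadic_threshold[of "3 * n"] by blast
  have V1: "2 ^ V > 3 * n" using V by blast
  have "V > 0" using V1 n by (cases V) auto
  then obtain V' where V': "V = Suc V'" by (cases V) auto
  have "\<not> 2 ^ V' > 3 * n" using V V' by auto
  then have V2: "2 ^ V \<le> 6 * n" using V' by simp
  have r1: "2 ^ V \<ge> 3 * real n" 
  proof -
    have "real (3 * n) < real (2 ^ V)" using V1 by (simp only: of_nat_less_iff)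
    then show ?thesis by simp
  qed
  have r2: "2 ^ V \<le> 6 * real n" 
  proof -
    have "real (2 ^ V) \<le> real (6 * n)" using V2 by (simp only: of_nat_le_iff)
    then show ?thesis by simp
  qed
  define h where "h = 2 * pi / 3 / 2 ^ V"
  have "2 * pi / 3 \<le> 3" using pi_less_4 by simp
  have "h \<le> 1 / real n"
  proof -
    have "2 * pi / 3 * real n \<le> 3 * real n" using \<open>2 * pi / 3 \<le> 3\<close> by (intro mult_right_mono) auto
    then have "2 * pi / 3 * real n \<le> 2 ^ V" using r1 by linarith
    then show ?thesis using n by (simp add: h_def field_simps)
  qed
  moreover have "h \<ge> 0" by (simp add: h_def)
  moreover have "min 1 (\<bar>of_int k\<bar> / real n) / 6 \<le> \<bar>2 * sin (of_int k * h / 2)\<bar>" if k: "\<bar>k\<bar> = 2 ^ \<nu>" for k and \<nu> :: nat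
  proof -
    have ak: "\<bar>real_of_int k\<bar> = 2 ^ \<nu>" using k by (metis of_int_abs of_int_numeral of_int_power)
    have "\<bar>sin (of_int k * h / 2)\<bar> = \<bar>sin (\<bar>of_int k\<bar> * h / 2)\<bar>"
      by (cases "k \<ge> 0") auto
    also have "\<bar>of_int k\<bar> * h / 2 = pi / 3 * (2 ^ \<nu> / 2 ^ V)" unfolding ak by (simp add: h_def)
    finally have "\<bar>2 * sin (of_int k * h / 2)\<bar> \<ge> min 1 (2 ^ \<nu> / 2 ^ V)"
      using sin_dyadic_lower[of \<nu> V] by (simp add: abs_mult)
    moreover have "min 1 (2 ^ \<nu> / real n) / 6 \<le> min 1 (2 ^ \<nu> / 2 ^ V)"
    proof -
      have "2 ^ \<nu> / real n / 6 \<le> 2 ^ \<nu> / 2 ^ V"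
        using r2 n by (simp add: field_simps)
      moreover have "min 1 x / 6 \<le> min 1 y" if "x / 6 \<le> y" for x y :: real
        using that by (auto simp: min_def)
      ultimately show ?thesis by blast
    qed
    ultimately show ?thesis unfolding ak by (rule order_trans[rotated])
  qed
  ultimately show ?thesis by (intro exI[of _ h]) auto
qed

text \<open>From above, every admissible step obeys
  \<open>\<bar>sin t\<bar> \<le> min 1 \<bar>t\<bar>\<close> in each coordinate. From below, one
  step is enough: the multiplier is a product over the axes, so the good steps of the single
  coordinates combine into one vector, the same for all lacunary frequencies.\<close>

lemma mixed_modulus_equiv:
  fixes \<alpha> :: "real^'m"
  assumes p: "p > 1" "\<tau> > 0" and \<alpha>: "\<And>j. \<alpha> $ j > 0"
  shows "\<exists>b>0. \<exists>d>0. \<forall>f n. lacunary_fun f \<longrightarrow> (\<forall>j. n j \<ge> 1) \<longrightarrow>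
    (mixed_modulus p \<tau> \<alpha> f (\<chi> j. 1 / real (n j)))\<^sup>2 \<le> ennreal b * energy f (smoothness_weight \<alpha> n) \<and>
    energy f (smoothness_weight \<alpha> n) \<le> ennreal d * (mixed_modulus p \<tau> \<alpha> f (\<chi> j. 1 / real (n j)))\<^sup>2"
proof -
  obtain C where C: "C > 0" and up: "\<And>f :: real^'m \<Rightarrow> real. integrable torus (dilate f) \<Longrightarrow>
    (\<And>k. k \<notin> lacunary \<Longrightarrow> fourier_coeff f k = 0) \<Longrightarrow> (lorentz_norm p \<tau> f)\<^sup>2 \<le> ennreal C * energy f (\<lambda>_. 1)"
    using lorentz_norm_le_energy[OF p, where 'm = 'm] by blast
  obtain D where D: "D > 0" and low: "\<And>f :: real^'m \<Rightarrow> real. dilate f \<in> borel_measurable torus \<Longrightarrow>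
    energy f (\<lambda>_. 1) \<le> ennreal D * (lorentz_norm p \<tau> f)\<^sup>2"
    using energy_le_lorentz_norm[OF p, where 'm = 'm] by blast
  define K where "K = (\<Prod>j\<in>UNIV. 2 powr (2 * \<alpha> $ j))"
  define L where "L = (\<Prod>j\<in>UNIV. (1 / 6) powr (2 * \<alpha> $ j))"
  have K: "K > 0" and L: "L > 0" unfolding K_def L_def by (auto intro!: prod_pos)
  have "(mixed_modulus p \<tau> \<alpha> f (\<chi> j. 1 / real (n j)))\<^sup>2 \<le> ennreal (C * K) * energy f (smoothness_weight \<alpha> n) \<and>
    energy f (smoothness_weight \<alpha> n) \<le> ennreal (D / L) * (mixed_modulus p \<tau> \<alpha> f (\<chi> j. 1 / real (n j)))\<^sup>2"
    if f: "lacunary_fun f" and n: "\<And>j. n j \<ge> 1" for f and n :: "'m \<Rightarrow> nat"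
  proof -
    let ?M = "mixed_modulus p \<tau> \<alpha> f (\<chi> j. 1 / real (n j))"
    let ?E = "energy f (smoothness_weight \<alpha> n)"
    let ?N = "\<lambda>k. (norm (fourier_coeff f k))\<^sup>2"
    have m: "f \<in> borel_measurable lebesgue" "periodic_2pi f" "integrable torus (dilate f)"
      and spec: "\<And>k. k \<notin> lacunary \<Longrightarrow> fourier_coeff f k = 0"
      using f by (auto simp: lacunary_fun_def)
    define \<Delta> where "\<Delta> h = mixed_difference \<alpha> h f" for h
    define \<mu> where "\<mu> h k = (\<Prod>j\<in>UNIV. \<bar>2 * sin (of_int (k j) * h $ j / 2)\<bar> powr (2 * \<alpha> $ j))" for h :: "real^'m" and k :: "'m \<Rightarrow> int"
    have int: "integrable torus (dilate (\<Delta> h))" for h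
      unfolding \<Delta>_def by (rule mixed_difference_fourier(1)[OF \<alpha> m])
    have co: "(norm (fourier_coeff (\<Delta> h) k))\<^sup>2 = \<mu> h k * ?N k" for h k
    proof -
      have "(x powr a)\<^sup>2 = x powr (2 * a)" for x a :: real
        by (simp add: power2_eq_square powr_add[symmetric])
      then show ?thesis
        unfolding \<Delta>_def mixed_difference_fourier(2)[OF \<alpha> m] \<mu>_def power_mult_distrib prod_power_distrib
        by (simp only: mult.commute)
    qed
    have sp: "fourier_coeff (\<Delta> h) k = 0" if "k \<notin> lacunary" for h k
      using co[of h k] spec[OF that] by simp
    have W0: "smoothness_weight \<alpha> n k \<ge> 0" for k
      by (auto simp: smoothness_weight_def intro: prod_nonneg)
    define X where "X = ennreal (C * K) * ?E"
    have "lorentz_norm p \<tau> (\<Delta> h) \<le> ennpowr X (1 / 2)" if h: "\<And>j. \<bar>h $ j\<bar> \<le> 1 / real (n j)" for h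
    proof (rule ennreal_power2_le_imp_le)
      have "(lorentz_norm p \<tau> (\<Delta> h))\<^sup>2 \<le> ennreal C * energy (\<Delta> h) (\<lambda>_. 1)"
        by (rule up[OF int sp])
      also have "\<dots> \<le> ennreal C * (ennreal K * ?E)"
      proof (intro mult_left_mono energy_mono_scaled)
        fix k
        have "\<mu> h k \<le> K * smoothness_weight \<alpha> n k"
          unfolding \<mu>_def K_def smoothness_weight_def prod.distrib[symmetric]
        proof (intro prod_mono conjI)
          fix j
          have "\<bar>2 * sin (of_int (k j) * h $ j / 2)\<bar> \<le> 2 * min 1 (\<bar>of_int (k j)\<bar> / real (n j))"
          proof -
            have "\<bar>sin (of_int (k j) * h $ j / 2)\<bar> \<le> \<bar>of_int (k j) * h $ j / 2\<bar>" by (rule abs_sin_x_le_abs_x)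
            also have "\<dots> \<le> \<bar>of_int (k j)\<bar> * (1 / real (n j)) / 2"
              using h[of j] by (simp only: abs_mult abs_divide abs_numeral) (intro divide_right_mono mult_left_mono, auto)
            also have "\<dots> \<le> \<bar>of_int (k j)\<bar> / real (n j)"
            proof -
              have half: "x / 2 \<le> x" if "x \<ge> 0" for x :: real using that by simp
              show ?thesis unfolding times_divide_eq_right mult_1_right by (rule half) simp
            qed
            finally show ?thesis by (simp add: abs_mult)
          qed
          then have "\<bar>2 * sin (of_int (k j) * h $ j / 2)\<bar> powr (2 * \<alpha> $ j) \<le> (2 * min 1 (\<bar>of_int (k j)\<bar> / real (n j))) powr (2 * \<alpha> $ j)"
            using \<alpha>[of j] by (intro powr_mono2) auto
          then show "\<bar>2 * sin (of_int (k j) * h $ j / 2)\<bar> powr (2 * \<alpha> $ j) \<le> 2 powr (2 * \<alpha> $ j) * min 1 (\<bar>of_int (k j)\<bar> / real (n j)) powr (2 * \<alpha> $ j)"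
            by (simp add: powr_mult)
        qed auto
        then show "1 * (norm (fourier_coeff (\<Delta> h) k))\<^sup>2 \<le> K * smoothness_weight \<alpha> n k * ?N k"
          unfolding co mult_1 by (rule mult_right_mono) simp
      qed (use K W0 in auto)
      also have "\<dots> = (ennpowr X (1 / 2))\<^sup>2"
        unfolding ennpowr_half_power2 X_def using C K by (simp add: ennreal_mult mult.assoc)
      finally show "(lorentz_norm p \<tau> (\<Delta> h))\<^sup>2 \<le> (ennpowr X (1 / 2))\<^sup>2" .
    qed
    then have "?M \<le> ennpowr X (1 / 2)"
      unfolding mixed_modulus_def \<Delta>_def by (intro SUP_least) auto
    then have "(?M)\<^sup>2 \<le> (ennpowr X (1 / 2))\<^sup>2" by (rule power_mono) simp
    then have 1: "(?M)\<^sup>2 \<le> ennreal (C * K) * ?E"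
      unfolding ennpowr_half_power2 X_def .
    have "\<exists>h. \<forall>j. \<bar>h j\<bar> \<le> 1 / real (n j) \<and>
      (\<forall>\<nu> k. \<bar>k\<bar> = 2 ^ \<nu> \<longrightarrow> min 1 (\<bar>of_int k\<bar> / real (n j)) / 6 \<le> \<bar>2 * sin (of_int k * h j / 2)\<bar>)"
      using exists_good_step[OF n] by (intro choice) blast
    then obtain h' where h': "\<And>j. \<bar>h' j\<bar> \<le> 1 / real (n j)"
      "\<And>j \<nu> k. \<bar>k\<bar> = 2 ^ \<nu> \<Longrightarrow> min 1 (\<bar>of_int k\<bar> / real (n j)) / 6 \<le> \<bar>2 * sin (of_int k * h' j / 2)\<bar>"
      by blast
    define h where "h = (\<chi> j. h' j)"
    have "?E \<le> ennreal (1 / L) * energy (\<Delta> h) (\<lambda>_. 1)"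
    proof (rule energy_mono_scaled)
      fix k :: "'m \<Rightarrow> int" assume k: "k \<in> lacunary"
      have "L * smoothness_weight \<alpha> n k \<le> \<mu> h k"
        unfolding \<mu>_def L_def smoothness_weight_def prod.distrib[symmetric]
      proof (intro prod_mono conjI)
        fix j
        obtain \<nu> where \<nu>: "\<bar>k j\<bar> = 2 ^ \<nu>" using k by (auto simp: lacunary_def)
        have "1 / 6 * min 1 (\<bar>of_int (k j)\<bar> / real (n j)) \<le> \<bar>2 * sin (of_int (k j) * h $ j / 2)\<bar>"
          using h'(2)[OF \<nu>, of j] by (simp add: h_def)
        then have "(1 / 6 * min 1 (\<bar>of_int (k j)\<bar> / real (n j))) powr (2 * \<alpha> $ j) \<le> \<bar>2 * sin (of_int (k j) * h $ j / 2)\<bar> powr (2 * \<alpha> $ j)"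
          using \<alpha>[of j] by (intro powr_mono2) auto
        then show "(1 / 6) powr (2 * \<alpha> $ j) * min 1 (\<bar>of_int (k j)\<bar> / real (n j)) powr (2 * \<alpha> $ j) \<le> \<bar>2 * sin (of_int (k j) * h $ j / 2)\<bar> powr (2 * \<alpha> $ j)"
          by (simp only: powr_mult)
      qed auto
      then have "smoothness_weight \<alpha> n k \<le> 1 / L * \<mu> h k" using L by (simp add: field_simps)
      from mult_right_mono[OF this, of "?N k"]
      show "smoothness_weight \<alpha> n k * ?N k \<le> 1 / L * 1 * (norm (fourier_coeff (\<Delta> h) k))\<^sup>2"
        unfolding co by (simp add: mult.assoc)
    qed (use L in auto)
    also have "\<dots> \<le> ennreal (1 / L) * (ennreal D * (lorentz_norm p \<tau> (\<Delta> h))\<^sup>2)"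
      using int by (intro mult_left_mono low) auto
    also have "\<dots> \<le> ennreal (1 / L) * (ennreal D * (?M)\<^sup>2)"
    proof (intro mult_left_mono power_mono)
      show "lorentz_norm p \<tau> (\<Delta> h) \<le> ?M"
        unfolding mixed_modulus_def \<Delta>_def using h'(1) by (intro SUP_upper) (auto simp: h_def)
    qed auto
    also have "\<dots> = ennreal (D / L) * (?M)\<^sup>2"
      using D L by (simp add: ennreal_mult_mult)
    finally show ?thesis using 1 by blast
  qed
  then show ?thesis using C K D L
    by (intro exI[of _ "C * K"] exI[of _ "D / L"] conjI) auto
qed

lemma ennreal_sqrt_mult_le:
  fixes x y :: ennreal
  assumes "x\<^sup>2 \<le> ennreal c * y\<^sup>2" "c > 0"
  shows "x \<le> ennreal (sqrt c) * y"
proof (rule ennreal_power2_le_imp_le)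
  have "(ennreal (sqrt c) * y)\<^sup>2 = ennreal c * y\<^sup>2"
    using assms(2) by (simp add: power_mult_distrib ennreal_power)
  with assms(1) show "x\<^sup>2 \<le> (ennreal (sqrt c) * y)\<^sup>2" by simp
qed

theorem theorem3p3:
  fixes \<alpha> :: "real^'m" and p \<tau> :: real
  assumes "\<And>j. \<alpha> $ j > 0"
    and "(1 < p \<and> p \<le> 2 \<and> 1 < \<tau> \<and> \<tau> \<le> 2) \<or> (2 < p \<and> 1 < \<tau>)"
  shows "\<exists>C1 C2 :: real. C1 > 0 \<and> C2 > 0 \<and>
    (\<forall>f \<in> lacunary_class p \<tau>. \<forall>n :: 'm \<Rightarrow> nat. (\<forall>j. n j \<ge> 1) \<longrightarrow>
       ennreal C1 * angle_sum p \<tau> \<alpha> n f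
         \<le> mixed_modulus p \<tau> \<alpha> f (\<chi> j. 1 / real (n j)) \<and>
       mixed_modulus p \<tau> \<alpha> f (\<chi> j. 1 / real (n j))
         \<le> ennreal C2 * angle_sum p \<tau> \<alpha> n f)"
proof -
  have p: "p > 1" "\<tau> > 0" using assms(2) by auto
  obtain a e where a: "a > 0" and e: "e > 0" and A: "\<And>f (n :: 'm \<Rightarrow> nat). lacunary_fun f \<Longrightarrow> (\<And>j. n j \<ge> 1) \<Longrightarrow>
    (angle_sum p \<tau> \<alpha> n f)\<^sup>2 \<le> ennreal a * energy f (smoothness_weight \<alpha> n)"
    "\<And>f (n :: 'm \<Rightarrow> nat). lacunary_fun f \<Longrightarrow> (\<And>j. n j \<ge> 1) \<Longrightarrow>
    energy f (smoothness_weight \<alpha> n) \<le> ennreal e * (angle_sum p \<tau> \<alpha> n f)\<^sup>2"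
    using angle_sum_equiv[OF p assms(1)] by blast
  obtain b d where b: "b > 0" and d: "d > 0" and M: "\<And>f (n :: 'm \<Rightarrow> nat). lacunary_fun f \<Longrightarrow> (\<And>j. n j \<ge> 1) \<Longrightarrow>
    (mixed_modulus p \<tau> \<alpha> f (\<chi> j. 1 / real (n j)))\<^sup>2 \<le> ennreal b * energy f (smoothness_weight \<alpha> n)"
    "\<And>f (n :: 'm \<Rightarrow> nat). lacunary_fun f \<Longrightarrow> (\<And>j. n j \<ge> 1) \<Longrightarrow>
    energy f (smoothness_weight \<alpha> n) \<le> ennreal d * (mixed_modulus p \<tau> \<alpha> f (\<chi> j. 1 / real (n j)))\<^sup>2"
    using mixed_modulus_equiv[OF p assms(1)] by blast
  show ?thesis
  \<comment> \<open>Squares are compared through the energy: \<open>a\<close> and \<open>d\<close>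
    carry the angle sum to the modulus, \<open>b\<close> and \<open>e\<close> the modulus to the
    angle sum, hence the square roots.\<close>
  proof (rule exI[of _ "1 / sqrt (a * d)"], rule exI[of _ "sqrt (b * e)"], intro conjI ballI allI impI)
    show "1 / sqrt (a * d) > 0" "sqrt (b * e) > 0" using a b d e by auto
    fix f :: "real^'m \<Rightarrow> real" and n :: "'m \<Rightarrow> nat" assume "f \<in> lacunary_class p \<tau>" and n': "\<forall>j. n j \<ge> 1"
    then have f: "lacunary_fun f" by (intro lacunary_class_lacunary_fun[OF p])
    have n: "n j \<ge> 1" for j using n' by blast
    let ?A = "angle_sum p \<tau> \<alpha> n f" and ?M = "mixed_modulus p \<tau> \<alpha> f (\<chi> j. 1 / real (n j))"
    have "?A\<^sup>2 \<le> ennreal a * energy f (smoothness_weight \<alpha> n)" by (rule A(1)[OF f n])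
    also have "\<dots> \<le> ennreal a * (ennreal d * ?M\<^sup>2)" by (intro mult_left_mono M(2)[OF f n]) simp
    also have "\<dots> = ennreal (a * d) * ?M\<^sup>2" using a d by (simp add: ennreal_mult mult.assoc)
    finally have "?A \<le> ennreal (sqrt (a * d)) * ?M" using a d by (intro ennreal_sqrt_mult_le) auto
    then have "ennreal (1 / sqrt (a * d)) * ?A \<le> ennreal (1 / sqrt (a * d)) * (ennreal (sqrt (a * d)) * ?M)"
      by (rule mult_left_mono) simp
    also have "\<dots> = ?M"
    proof -
      have "ennreal (1 / sqrt (a * d)) * ennreal (sqrt (a * d)) = 1"
        using a d by (subst ennreal_mult[symmetric]) auto
      then show ?thesis by (simp add: mult.assoc[symmetric])
    qed
    finally show "ennreal (1 / sqrt (a * d)) * ?A \<le> ?M" .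
    have "?M\<^sup>2 \<le> ennreal b * energy f (smoothness_weight \<alpha> n)" by (rule M(1)[OF f n])
    also have "\<dots> \<le> ennreal b * (ennreal e * ?A\<^sup>2)" by (intro mult_left_mono A(2)[OF f n]) simp
    also have "\<dots> = ennreal (b * e) * ?A\<^sup>2" using b e by (simp add: ennreal_mult mult.assoc)
    finally show "?M \<le> ennreal (sqrt (b * e)) * ?A" using b e by (intro ennreal_sqrt_mult_le) auto
  qed
qed

end
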